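(* Let $(X,T)$ be a minimal system and $d\in\mathbb{N}$. Let $\pi:(X,T)\to(Z_{d-1},T)$ be the factor map to the maximal $(d-1)$-step pro-nilfactor of $(X,T)$. Then there exist minimal systems $(X',T)$ and $(Y',T)$ and factor maps $\theta':X'\to X$, $\pi':X'\to Y'$, $\theta:Y'\to Z_{d-1}$ with $\pi\circ\theta'=\theta\circ\pi'$ such that $\theta$ and $\theta'$ are proximal extensions and $(Y',T)$ (with respect to $\pi'$) is the topological cubic characteristic factor of order $d$ of $(X',T)$.
   Context: A (topological dynamical) system $(X,T)$ is a compact metric space $X$ with metric $\rho$ and a homeomorphism $T:X\to X$; the letter $T$ is used for the transformation of every system. It is minimal if every orbit $\{T^nx:n\in\mathbb{Z}\}$ is dense. A factor map $\pi:(X,T)\to(Y,T)$ is a continuous surjection with $\pi T=T\pi$. A pair $(x,y)\in X^2$ is proximal if $\inf_{n\in\mathbb{Z}}\rho(T^nx,T^ny)=0$. A factor map $\pi$ is a proximal extension if $\pi(x_1)=\pi(x_2)$ implies that $(x_1,x_2)$ is proximal. For $d\ge1$, $X^{[d]}=X^{2^d}$ with points $\mathbf{x}=(x_\epsilon)_{\epsilon\in\{0,1\}^d}$, and the first coordinate is $x_{\mathbf 0}$, where $\mathbf 0=(0,\ldots,0)$. For $\mathbf n\in\mathbb{Z}^d$ and $\epsilon\in\{0,1\}^d$, $\mathbf n\cdot\epsilon=\sum_i n_i\epsilon_i$. For $x\in X$, $x^{[d]}=(x,\ldots,x)\in X^{[d]}$. The face transformations $T^{[d]}_j$ ($1\le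 j\le d$) of $X^{[d]}$ are given by $(T^{[d]}_j\mathbf{x})_\epsilon=Tx_\epsilon$ if $\epsilon_j=1$ and $(T^{[d]}_j\mathbf{x})_\epsilon=x_\epsilon$ if $\epsilon_j=0$. The face group $\mathcal{F}^{[d]}$ is the group generated by $T^{[d]}_1,\ldots,T^{[d]}_d$. For $k\ge1$, $\mathbf{RP}^{[k]}(X,T)$ is the set of $(x,y)\in X^2$ such that for every $\delta>0$ there are $x',y'\in X$ and $\mathbf n\in\mathbb{Z}^k$ with $\rho(x,x')<\delta$, $\rho(y,y')<\delta$ and $\rho(T^{\mathbf n\cdot\epsilon}x',T^{\mathbf n\cdot\epsilon}y')<\delta$ for all $\epsilon\in\{0,1\}^k\setminus\{\mathbf 0\}$. For minimal $(X,T)$ this is a closed invariant equivalence relation, and $Z_k=X/\mathbf{RP}^{[k]}(X,T)$ with the induced action is the maximal $k$-step pro-nilfactor of $(X,T)$ (the maximal factor that is an inverse limit of $k$-step minimal nilsystems). $Z_0$ is the trivial one-point system. Let $\pi:(X,T)\to(Y,T)$ be a factor map. $(Y,T)$ is a topological cubic characteristic factor of order $d$ of $(X,T)$ if there is a dense $G_\delta$ set $X_0\subseteq X$ such that for each $x\in X_0$ the set $F_x=p_*\big(\overline{\mathcal{F}^{[d]}x^{[d]}}\big)\subseteq X^{2^d-1}$ is saturated for $\pi^{2^d-1}=\pi\times\cdots\times\pi$ ($2^d-1$ times), i.e. $F_x=(\pi^{2^d-1})^{-1}(\pi^{2^d-1}(F_x))$, where $p_*:X^{2^d}\to X^{2^d-1}$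 is the projection forgetting the coordinate $x_{\mathbf 0}$. Equivalently, $\overline{\mathcal{F}^{[d]}x^{[d]}}=\{x\}\times(\pi^{2^d-1})^{-1}(\pi^{2^d-1}(F_x))$ for each $x\in X_0$. *)

theory Defs
  imports
    "HOL-Analysis.Analysis"
    "HOL-Algebra.Bij"
    "HOL-Algebra.Generated_Groups"
begin

section \<open>Topological dynamical systems\<close>

text \<open>A space is a value of the library type of abstract metric spaces, i.e. a carrier set together
  with a metric on it. The values of the transformation outside the carrier are irrelevant.\<close>

definition tds :: "'a metric \<Rightarrow> ('a \<Rightarrow> 'a) \<Rightarrow> bool" where
  "tds X T \<longleftrightarrow> mspace X \<noteq> {} \<and> compact_space (mtopology_of X) \<and>
     homeomorphic_map (mtopology_of X) (mtopology_of X) T"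

definition ziter :: "'a metric \<Rightarrow> ('a \<Rightarrow> 'a) \<Rightarrow> int \<Rightarrow> 'a \<Rightarrow> 'a" where
  "ziter X T n = (if 0 \<le> n then T ^^ nat n else inv_into (mspace X) T ^^ nat (- n))"

definition minimal_tds :: "'a metric \<Rightarrow> ('a \<Rightarrow> 'a) \<Rightarrow> bool" where
  "minimal_tds X T \<longleftrightarrow> tds X T \<and>
     (\<forall>x\<in>mspace X. mtopology_of X closure_of {ziter X T n x |n. True} = mspace X)"

text \<open>Being a factor map only depends on the topologies; it is stated for topologies so that it
  also applies to the quotient space \<open>pronil_space\<close> below, which carries no preferred metric.\<close>

definition factor_map ::
  "'a topology \<Rightarrow> ('a \<Rightarrow> 'a) \<Rightarrow> 'b topology \<Rightarrow> ('b \<Rightarrow> 'b) \<Rightarrow> ('a \<Rightarrow> 'b) \<Rightarrow> bool" where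
  "factor_map X T Y S p \<longleftrightarrow> continuous_map X Y p \<and> p ` topspace X = topspace Y \<and>
     (\<forall>x\<in>topspace X. p (T x) = S (p x))"

definition proximal :: "'a metric \<Rightarrow> ('a \<Rightarrow> 'a) \<Rightarrow> 'a \<Rightarrow> 'a \<Rightarrow> bool" where
  "proximal X T x y \<longleftrightarrow> (INF n::int. mdist X (ziter X T n x) (ziter X T n y)) = 0"

definition proximal_extension ::
  "'a metric \<Rightarrow> ('a \<Rightarrow> 'a) \<Rightarrow> 'b topology \<Rightarrow> ('b \<Rightarrow> 'b) \<Rightarrow> ('a \<Rightarrow> 'b) \<Rightarrow> bool" where
  "proximal_extension X T Y S p \<longleftrightarrow> factor_map (mtopology_of X) T Y S p \<and>
     (\<forall>x1\<in>mspace X. \<forall>x2\<in>mspace X. p x1 = p x2 \<longrightarrow> proximal X T x1 x2)"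

section \<open>Cubes and the face group\<close>

text \<open>Elements of \<open>{0,1}\<^sup>d\<close> and points of \<open>X\<^sup>[\<^sup>d\<^sup>]\<close> are extensional functions on \<open>{1..d}\<close> and on
  \<open>{0,1}\<^sup>d\<close> respectively.\<close>

definition vertices :: "nat \<Rightarrow> (nat \<Rightarrow> int) set" where
  "vertices d = {1..d} \<rightarrow>\<^sub>E {0, 1}"

definition zero_vertex :: "nat \<Rightarrow> nat \<Rightarrow> int" where
  "zero_vertex d = (\<lambda>i\<in>{1..d}. 0)"

definition vdot :: "nat \<Rightarrow> (nat \<Rightarrow> int) \<Rightarrow> (nat \<Rightarrow> int) \<Rightarrow> int" where
  "vdot d n e = (\<Sum>i=1..d. n i * e i)"

definition cube_space :: "nat \<Rightarrow> 'a metric \<Rightarrow> ((nat \<Rightarrow> int) \<Rightarrow> 'a) topology" where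
  "cube_space d X = product_topology (\<lambda>_. mtopology_of X) (vertices d)"

definition diagonal_point :: "nat \<Rightarrow> 'a \<Rightarrow> (nat \<Rightarrow> int) \<Rightarrow> 'a" where
  "diagonal_point d x = (\<lambda>e\<in>vertices d. x)"

definition face_transformation ::
  "nat \<Rightarrow> 'a metric \<Rightarrow> ('a \<Rightarrow> 'a) \<Rightarrow> nat \<Rightarrow> ((nat \<Rightarrow> int) \<Rightarrow> 'a) \<Rightarrow> (nat \<Rightarrow> int) \<Rightarrow> 'a" where
  "face_transformation d X T j =
     (\<lambda>x\<in>topspace (cube_space d X). \<lambda>e\<in>vertices d. if e j = 1 then T (x e) else x e)"

definition face_group ::
  "nat \<Rightarrow> 'a metric \<Rightarrow> ('a \<Rightarrow> 'a) \<Rightarrow> (((nat \<Rightarrow> int) \<Rightarrow> 'a) \<Rightarrow> (nat \<Rightarrow> int) \<Rightarrow> 'a) set" where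
  "face_group d X T =
     generate (BijGroup (topspace (cube_space d X))) (face_transformation d X T ` {1..d})"

definition face_orbit_closure ::
  "nat \<Rightarrow> 'a metric \<Rightarrow> ('a \<Rightarrow> 'a) \<Rightarrow> 'a \<Rightarrow> ((nat \<Rightarrow> int) \<Rightarrow> 'a) set" where
  "face_orbit_closure d X T x =
     cube_space d X closure_of {g (diagonal_point d x) |g. g \<in> face_group d X T}"

section \<open>Regional proximality and the maximal pro-nilfactor\<close>

text \<open>Only the coordinates \<open>n 1, \<dots>, n k\<close> of \<open>n\<close> matter. For \<open>k = 0\<close> the last condition is void, so
  that \<open>RP 0 X T\<close> is the full relation and \<open>pronil_space 0 X T\<close> is a single point, see
  \<open>RP_0\<close> and \<open>topspace_pronil_space_0\<close>.\<close>

definition RP :: "nat \<Rightarrow> 'a metric \<Rightarrow> ('a \<Rightarrow> 'a) \<Rightarrow> ('a \<times> 'a) set" where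
  "RP k X T = {(x, y). x \<in> mspace X \<and> y \<in> mspace X \<and>
     (\<forall>\<delta>>0. \<exists>x'\<in>mspace X. \<exists>y'\<in>mspace X. \<exists>n :: nat \<Rightarrow> int.
        mdist X x x' < \<delta> \<and> mdist X y y' < \<delta> \<and>
        (\<forall>e\<in>vertices k - {zero_vertex k}.
           mdist X (ziter X T (vdot k n e) x') (ziter X T (vdot k n e) y') < \<delta>))}"

definition pronil_map :: "nat \<Rightarrow> 'a metric \<Rightarrow> ('a \<Rightarrow> 'a) \<Rightarrow> 'a \<Rightarrow> 'a set" where
  "pronil_map k X T x = RP k X T `` {x}"

text \<open>The quotient set \<open>X / RP\<close> with the quotient topology (see \<open>quotient_map_pronil_map\<close>).\<close>

definition pronil_space :: "nat \<Rightarrow> 'a metric \<Rightarrow> ('a \<Rightarrow> 'a) \<Rightarrow> 'a set topology" where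
  "pronil_space k X T = topology (\<lambda>U. U \<subseteq> mspace X // RP k X T \<and>
     openin (mtopology_of X) {x \<in> mspace X. pronil_map k X T x \<in> U})"

definition pronil_action :: "('a \<Rightarrow> 'a) \<Rightarrow> 'a set \<Rightarrow> 'a set" where
  "pronil_action T C = T ` C"

lemma openin_pronil_space:
  "openin (pronil_space k X T) U \<longleftrightarrow> U \<subseteq> mspace X // RP k X T \<and>
     openin (mtopology_of X) {x \<in> mspace X. pronil_map k X T x \<in> U}"
proof -
  let ?P = "\<lambda>U. U \<subseteq> mspace X // RP k X T \<and>
     openin (mtopology_of X) {x \<in> mspace X. pronil_map k X T x \<in> U}"
  have "istopology ?P"
    unfolding istopology_def
  proof (intro conjI allI impI)
    fix S U assume S: "?P S" and U: "?P U"
    then show "S \<inter> U \<subseteq> mspace X // RP k X T" by blast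
    have "{x \<in> mspace X. pronil_map k X T x \<in> S \<inter> U} =
      {x \<in> mspace X. pronil_map k X T x \<in> S} \<inter> {x \<in> mspace X. pronil_map k X T x \<in> U}" by blast
    then show "openin (mtopology_of X) {x \<in> mspace X. pronil_map k X T x \<in> S \<inter> U}"
      using S U by (simp add: openin_Int)
  next
    fix K assume K: "\<forall>U\<in>K. ?P U"
    then show "\<Union>K \<subseteq> mspace X // RP k X T" by blast
    have "{x \<in> mspace X. pronil_map k X T x \<in> \<Union>K} =
      \<Union>((\<lambda>U. {x \<in> mspace X. pronil_map k X T x \<in> U}) ` K)" by blast
    then show "openin (mtopology_of X) {x \<in> mspace X. pronil_map k X T x \<in> \<Union>K}"
      using K by (auto intro!: openin_Union)
  qed
  then show ?thesis
    by (simp add: pronil_space_def topology_inverse')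
qed

lemma topspace_pronil_space: "topspace (pronil_space k X T) = mspace X // RP k X T"
proof -
  have "{x \<in> mspace X. pronil_map k X T x \<in> mspace X // RP k X T} = mspace X"
    by (auto simp: pronil_map_def quotient_def)
  then have "openin (pronil_space k X T) (mspace X // RP k X T)"
    unfolding openin_pronil_space by (metis openin_topspace order_refl topspace_mtopology_of)
  then show ?thesis
    by (meson openin_pronil_space openin_subset openin_topspace subset_antisym)
qed

lemma quotient_map_pronil_map:
  "quotient_map (mtopology_of X) (pronil_space k X T) (pronil_map k X T)"
  unfolding quotient_map_def topspace_pronil_space openin_pronil_space
  by (auto simp: pronil_map_def quotient_def)

lemma RP_0: "RP 0 X T = mspace X \<times> mspace X"
proof -
  have "vertices 0 - {zero_vertex 0} = {}"
    by (auto simp: vertices_def zero_vertex_def)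
  moreover have "mdist X x x < \<delta>" if "x \<in> mspace X" "\<delta> > 0" for x \<delta>
    using that mdist_zero[of x X x] by metis
  ultimately show ?thesis
    unfolding RP_def by blast
qed

lemma topspace_pronil_space_0:
  "mspace X \<noteq> {} \<Longrightarrow> topspace (pronil_space 0 X T) = {mspace X}"
  by (auto simp: topspace_pronil_space RP_0 quotient_def)

section \<open>Cubic characteristic factors\<close>

definition punctured_vertices :: "nat \<Rightarrow> (nat \<Rightarrow> int) set" where
  "punctured_vertices d = vertices d - {zero_vertex d}"

text \<open>\<open>face_fibre d X T x\<close> is the set called \<open>F\<^sub>x\<close>: restriction to the nonzero vertices is the
  projection forgetting the coordinate at zero.\<close>

definition face_fibre ::
  "nat \<Rightarrow> 'a metric \<Rightarrow> ('a \<Rightarrow> 'a) \<Rightarrow> 'a \<Rightarrow> ((nat \<Rightarrow> int) \<Rightarrow> 'a) set" where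
  "face_fibre d X T x = (\<lambda>z. restrict z (punctured_vertices d)) ` face_orbit_closure d X T x"

definition power_map ::
  "nat \<Rightarrow> ('a \<Rightarrow> 'b) \<Rightarrow> ((nat \<Rightarrow> int) \<Rightarrow> 'a) \<Rightarrow> (nat \<Rightarrow> int) \<Rightarrow> 'b" where
  "power_map d p z = (\<lambda>e\<in>punctured_vertices d. p (z e))"

definition saturated ::
  "nat \<Rightarrow> 'a metric \<Rightarrow> ('a \<Rightarrow> 'b) \<Rightarrow> ((nat \<Rightarrow> int) \<Rightarrow> 'a) set \<Rightarrow> bool" where
  "saturated d X p F \<longleftrightarrow>
     F = {z \<in> punctured_vertices d \<rightarrow>\<^sub>E mspace X. power_map d p z \<in> power_map d p ` F}"

definition cubic_characteristic_factor ::
  "nat \<Rightarrow> 'a metric \<Rightarrow> ('a \<Rightarrow> 'a) \<Rightarrow> 'b metric \<Rightarrow> ('b \<Rightarrow> 'b) \<Rightarrow> ('a \<Rightarrow> 'b) \<Rightarrow> bool" where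
  "cubic_characteristic_factor d X T Y S p \<longleftrightarrow>
     factor_map (mtopology_of X) T (mtopology_of Y) S p \<and>
     (\<exists>X0. gdelta_in (mtopology_of X) X0 \<and> mtopology_of X closure_of X0 = mspace X \<and>
        (\<forall>x\<in>X0. saturated d X p (face_fibre d X T x)))"

text \<open>A choice of carrier type for spaces that are asserted to exist: HOL cannot quantify
  existentially over types, but every compact metric space has at most continuum many points and is
  therefore isometric to some \<open>M :: hc metric\<close>. The metric of \<open>M\<close> is arbitrary and unrelated to
  any standard one on sequences.\<close>

type_synonym hc = "nat \<Rightarrow> real"

lemma face_transformation_Bij:
  assumes "tds X T"
  shows "face_transformation d X T j \<in> Bij (topspace (cube_space d X))"
proof -
  let ?S = "topspace (cube_space d X)"
  have S: "?S = vertices d \<rightarrow>\<^sub>E mspace X" by (simp add: cube_space_def)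
  have b: "bij_betw T (mspace X) (mspace X)"
    using assms homeomorphic_imp_injective_map[of "mtopology_of X" "mtopology_of X" T]
      homeomorphic_imp_surjective_map[of "mtopology_of X" "mtopology_of X" T]
    unfolding tds_def bij_betw_def by simp
  let ?I = "inv_into (mspace X) T"
  have "bij_betw (face_transformation d X T j) ?S ?S"
  proof (rule bij_betwI)
    let ?g = "\<lambda>x. \<lambda>e\<in>vertices d. if e j = 1 then ?I (x e) else x e"
    show "face_transformation d X T j \<in> ?S \<rightarrow> ?S"
      unfolding S using bij_betw_apply[OF b]
      by (auto simp: face_transformation_def S PiE_iff)
    show "?g \<in> ?S \<rightarrow> ?S"
      unfolding S using bij_betw_apply[OF bij_betw_inv_into[OF b]]
      by (auto simp: PiE_iff)
    show "?g (face_transformation d X T j x) = x" if x: "x \<in> ?S" for x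
    proof
      fix e
      show "?g (face_transformation d X T j x) e = x e"
      proof (cases "e \<in> vertices d")
        case True
        then have "x e \<in> mspace X" using x unfolding S by blast
        then show ?thesis
          using True x bij_betw_inv_into_left[OF b] by (simp add: face_transformation_def)
      next
        case False
        then show ?thesis using PiE_arb[OF x[unfolded S] False] by simp
      qed
    qed
    show "face_transformation d X T j (?g y) = y" if y: "y \<in> ?S" for y
    proof
      fix e
      have g: "?g y \<in> ?S"
        using y bij_betw_apply[OF bij_betw_inv_into[OF b]] unfolding S by (simp add: PiE_iff)
      show "face_transformation d X T j (?g y) e = y e"
      proof (cases "e \<in> vertices d")
        case True
        then have "y e \<in> mspace X" using y unfolding S by blast
        then show ?thesis
          using True g bij_betw_inv_into_right[OF b] by (simp add: face_transformation_def)
      next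
        case False
        then show ?thesis
          using PiE_arb[OF y[unfolded S] False] g by (simp add: face_transformation_def)
      qed
    qed
  qed
  then show ?thesis by (simp add: Bij_def face_transformation_def)
qed

end

theory Submission
  imports Defs
begin

text \<open>
The proof is carried out in enveloping semigroups. Let \<open>E\<close> be the closure of the powers of
the transformation in the compact space of all self-maps, and let \<open>\<Gamma>\<close> be the closure of
the group of all \<open>(T\<^sup>m\<^sup>+\<^sup>n\<^sup>\<cdot>\<^sup>e)\<close>, indexed by the vertices
\<open>e\<close> of the \<open>d\<close>-dimensional cube. Fix an idempotent \<open>u\<close> of a minimal left ideal
of \<open>E\<close>, a point \<open>x0\<close> with \<open>u x0 = x0\<close>, and call the points of
\<open>\<Gamma> (x0, \<dots>, x0)\<close> cubes. Since minimality of an idempotent can be tested coordinatewise,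
every \<open>p \<in> \<Gamma>\<close> can be undone after applying \<open>u\<close> (\<open>cube_inverse\<close>), and the
elements \<open>u p u\<close> form a group (\<open>cube_group\<close>).

A pair that is regionally proximal of order \<open>d - 1\<close> occurs as the pair of first vertices of
the two halves of a cube whose halves otherwise agree (\<open>R_imp_face_cube\<close>). Undoing one half
turns the cube into one that is constant except at a single vertex (\<open>cube_single_e1\<close>), and by
changing one coordinate at a time, any family of \<open>u\<close>-fixed points in the class of one
\<open>u\<close>-fixed point is a cube (\<open>cube_of_related\<close>). An idempotent can be made to act on
all vertices except the zero vertex, because it may act on each upper face separately
(\<open>punctured_idempotent_in_\<Gamma>\<close>); together these facts show that regional proximality is an
equivalence relation (\<open>R_trans\<close>).

The factor \<open>Y'\<close> is a quasifactor: the orbit closure of \<open>u \<circ> D\<close> in the hyperspace of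
closed sets, where \<open>D\<close> is the set of \<open>u\<close>-fixed points in the class of \<open>x0\<close>. The
system \<open>X'\<close> is the orbit closure of the pair \<open>(x0, u \<circ> D)\<close>. Closed sets are
represented by pointwise infima of coded points, that is by their distance functions; the order
then replaces membership, and monotonicity of the elements of \<open>E\<close> replaces the calculus of
the circle operation. The group of all \<open>a = u a u\<close> that keep \<open>x0\<close> in its class
fixes \<open>u \<circ> D\<close> (\<open>stabilizer_fixes_\<psi>0\<close>). Hence two points of \<open>Y'\<close> over
the same point of the pro-nilfactor become equal under \<open>u\<close> and are proximal
(\<open>u_\<psi>0_eq_of_R\<close>), and the same holds for the fibres of \<open>X'\<close> over \<open>X\<close>.

Any point of \<open>X'\<close> in the fibre over a set \<open>p (u \<circ> D)\<close> is a limit of translates of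
pairs \<open>(w, u \<circ> D)\<close> with \<open>w \<in> D\<close>, and such pairs form cubes. Therefore the cubes of
\<open>X'\<close> are saturated over \<open>Y'\<close> (\<open>cube_saturated\<close>). Cubes are orbit closures under
the face group together with the diagonal; for a generic point \<open>x\<close> a Baire category argument
shows that the face group alone produces all cubes with first coordinate \<open>x\<close>
(\<open>generic_face_orbit_closure\<close>), so the face orbit closure of \<open>x\<close> is saturated.

To have a single compact space in which everything takes place, a point \<open>x\<close> is coded by the
distances of all \<open>T\<^sup>n x\<close> to the points of a dense sequence; the transformation becomes
a shift of indices, and points, closed sets and pairs of them are all bounded elements of
\<open>hc\<close>.
\<close>

section \<open>Compact right topological semigroups\<close>

lemma Hausdorff_space_fun:
  assumes "Hausdorff_space (euclidean :: 'b::topological_space topology)"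
  shows "Hausdorff_space (euclidean :: ('i \<Rightarrow> 'b) topology)"
  using assms by (simp add: euclidean_product_topology[symmetric] Hausdorff_space_product_topology)

lemma compact_Pi:
  assumes "\<And>i. compact (S i)"
  shows "compact {p :: 'i \<Rightarrow> 'b::topological_space. \<forall>i. p i \<in> S i}"
proof -
  have "compactin (product_topology (\<lambda>_. euclidean) UNIV) (PiE UNIV S)"
    using assms by (simp add: compactin_PiE)
  then show ?thesis
    by (simp add: euclidean_product_topology PiE_UNIV_domain Pi_def)
qed

lemma compact_closed_if_Hausdorff:
  assumes "Hausdorff_space (euclidean :: 'b::topological_space topology)" "compact (S :: 'b set)"
  shows "closed S"
  using compactin_imp_closedin[OF assms(1), of S] assms(2) by simp

text \<open>The form of Zorn's lemma behind both minimal left ideals and minimal closed subsemigroups: the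
intersection of a chain of nonempty closed subsets of a compact set is nonempty.\<close>

lemma minimal_closed_subset:
  fixes K :: "'a::topological_space set"
  assumes K: "compact K" "closed K" "K \<noteq> {}" "P K"
    and chain: "\<And>C. \<lbrakk>C \<noteq> {}; \<And>A. A \<in> C \<Longrightarrow> A \<subseteq> K \<and> closed A \<and> P A;
        \<And>A B. A \<in> C \<Longrightarrow> B \<in> C \<Longrightarrow> A \<subseteq> B \<or> B \<subseteq> A\<rbrakk> \<Longrightarrow> P (\<Inter>C)"
  obtains M where "M \<subseteq> K" "closed M" "M \<noteq> {}" "P M"
    "\<And>A. \<lbrakk>A \<subseteq> M; closed A; A \<noteq> {}; P A\<rbrakk> \<Longrightarrow> A = M"
proof -
  define F where "F = {A. A \<subseteq> K \<and> closed A \<and> A \<noteq> {} \<and> P A}"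
  have "\<exists>M\<in>uminus ` F. \<forall>X\<in>uminus ` F. M \<subseteq> X \<longrightarrow> X = M"
  proof (rule subset_Zorn_nonempty)
    show "uminus ` F \<noteq> {}" using K by (auto simp: F_def)
    fix C assume C: "C \<noteq> {}" "subset.chain (uminus ` F) C"
    define D where "D = uminus ` C"
    have DF: "D \<subseteq> F" and Dne: "D \<noteq> {}" using C by (auto simp: D_def subset_chain_def)
    have Dch: "A \<subseteq> B \<or> B \<subseteq> A" if "A \<in> D" "B \<in> D" for A B
    proof -
      have "- A \<in> C" "- B \<in> C" using that by (auto simp: D_def)
      then have "- A \<subseteq> - B \<or> - B \<subseteq> - A" using C(2) unfolding subset_chain_def by blast
      then show ?thesis by blast
    qed
    have UD: "\<Union>C = - \<Inter>D" by (auto simp: D_def)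
    have "K \<inter> \<Inter>D \<noteq> {}"
    proof (rule compact_imp_fip[OF K(1)])
      show "\<And>T. T \<in> D \<Longrightarrow> closed T" using DF by (auto simp: F_def)
      fix G assume "finite G" "G \<subseteq> D"
      then have "G \<noteq> {} \<longrightarrow> \<Inter>G \<in> G"
      proof (induction G rule: finite_induct)
        case (insert A G)
        show ?case
        proof (cases "G = {}")
          case False
          then have "\<Inter>G \<in> G" using insert by auto
          then have "A \<subseteq> \<Inter>G \<or> \<Inter>G \<subseteq> A" using insert Dch by blast
          then have "\<Inter>(insert A G) = A \<or> \<Inter>(insert A G) = \<Inter>G" by auto
          then show ?thesis using \<open>\<Inter>G \<in> G\<close> by (elim disjE) simp_all
        qed auto
      qed auto
      then consider "G = {}" | "\<Inter>G \<in> F" using \<open>G \<subseteq> D\<close> DF by blast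
      then show "K \<inter> \<Inter>G \<noteq> {}"
        by cases (use K(3) in \<open>auto simp: F_def Int_absorb1\<close>)
    qed
    moreover have "P (\<Inter>D)" by (rule chain[OF Dne]) (use DF Dch in \<open>auto simp: F_def\<close>)
    moreover have "\<Inter>D \<subseteq> K" "closed (\<Inter>D)" using DF Dne by (auto simp: F_def)
    ultimately have "\<Inter>D \<in> F" by (auto simp: F_def)
    then show "\<Union>C \<in> uminus ` F" unfolding UD by (rule imageI)
  qed
  then obtain M where M: "M \<in> F" "\<And>A. A \<in> F \<Longrightarrow> - M \<subseteq> - A \<Longrightarrow> - A = - M"
    unfolding bex_simps ball_simps by blast
  show ?thesis
  proof (rule that[of M])
    show "A = M" if "A \<subseteq> M" "closed A" "A \<noteq> {}" "P A" for A
    proof -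
      have "A \<in> F" using that M(1) by (auto simp: F_def)
      then show ?thesis using M(2)[of A] that by auto
    qed
  qed (use M(1) in \<open>auto simp: F_def\<close>)
qed

text \<open>Only right translations \<open>p \<mapsto> p q\<close> are continuous. The Hausdorff property is
stated for the topology of the type, in which form it passes to products and hence to spaces of
maps.\<close>

locale compact_semigroup =
  fixes S :: "'a::topological_space set" and m :: "'a \<Rightarrow> 'a \<Rightarrow> 'a"
  assumes haus: "Hausdorff_space (euclidean :: 'a topology)"
    and compact: "compact S" and nonempty: "S \<noteq> {}"
    and mult_closed: "\<And>p q. p \<in> S \<Longrightarrow> q \<in> S \<Longrightarrow> m p q \<in> S"
    and assoc: "\<And>p q r. m (m p q) r = m p (m q r)"
    and right_cont: "\<And>q. continuous_on UNIV (\<lambda>p. m p q)"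
begin

lemma closed_S: "closed S"
  using compact_closed_if_Hausdorff[OF haus compact] .

lemma closed_right_translate:
  assumes "A \<subseteq> S" "closed A" shows "closed ((\<lambda>p. m p q) ` A)"
proof -
  have "compact A" using assms compact by (metis compact_Int_closed inf.absorb2)
  then have "compact ((\<lambda>p. m p q) ` A)"
    by (intro compact_continuous_image continuous_on_subset[OF right_cont]) auto
  then show ?thesis using compact_closed_if_Hausdorff[OF haus] by blast
qed

lemma closed_right_stabilizer: "closed {p. m p q = r}"
proof -
  have "closed ((\<lambda>p. m p q) -` {r})"
    by (rule closed_vimage[OF _ right_cont])
      (use compact_closed_if_Hausdorff[OF haus, of "{r}"] in auto)
  then show ?thesis by (simp add: vimage_def)
qed

text \<open>The Ellis--Numakura lemma. In a minimal closed subsemigroup \<open>M\<close> with an element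
\<open>u\<close>, both \<open>M u\<close> and the stabiliser of \<open>u\<close> under left multiplication
are closed subsemigroups, so each of them is all of \<open>M\<close>, and the second one contains
\<open>u\<close>.\<close>

lemma idempotent_exists:
  assumes A: "A \<subseteq> S" "closed A" "A \<noteq> {}" "\<And>p q. p \<in> A \<Longrightarrow> q \<in> A \<Longrightarrow> m p q \<in> A"
  obtains u where "u \<in> A" "m u u = u"
proof -
  let ?P = "\<lambda>B. \<forall>p\<in>B. \<forall>q\<in>B. m p q \<in> B"
  have cA: "compact A" using A compact by (metis compact_Int_closed inf.absorb2)
  obtain M where M: "M \<subseteq> A" "closed M" "M \<noteq> {}" "?P M"
    and min: "\<And>B. \<lbrakk>B \<subseteq> M; closed B; B \<noteq> {}; ?P B\<rbrakk> \<Longrightarrow> B = M"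
  proof (rule minimal_closed_subset[of A ?P])
    fix C assume "\<And>B. B \<in> C \<Longrightarrow> B \<subseteq> A \<and> closed B \<and> ?P B"
    then show "?P (\<Inter>C)" by blast
  qed (use cA A in auto)
  obtain u where u: "u \<in> M" using M by blast
  have "(\<lambda>p. m p u) ` M = M"
  proof (rule min)
    show "closed ((\<lambda>p. m p u) ` M)" using closed_right_translate M A by auto
    show "?P ((\<lambda>p. m p u) ` M)"
    proof (intro ballI)
      fix x y assume "x \<in> (\<lambda>p. m p u) ` M" "y \<in> (\<lambda>p. m p u) ` M"
      then obtain a b where ab: "a \<in> M" "b \<in> M" "x = m a u" "y = m b u" by auto
      have "m x y = m (m (m a u) b) u" by (simp add: ab assoc)
      then show "m x y \<in> (\<lambda>p. m p u) ` M" using ab u M(4) by blast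
    qed
  qed (use M u in auto)
  then obtain p where p: "p \<in> M" "m p u = u" using u by (metis imageE)
  have "{p \<in> M. m p u = u} = M"
  proof (rule min)
    show "closed {p \<in> M. m p u = u}"
      using closed_Int[OF M(2) closed_right_stabilizer[of u u]] by (simp add: Collect_conj_eq)
    show "?P {p \<in> M. m p u = u}" using M(4) by (auto simp: assoc)
  qed (use p in auto)
  then show ?thesis using that u M by blast
qed

text \<open>An idempotent \<open>u\<close> of a minimal closed left ideal \<open>M\<close>. The last property is the
only trace of minimality that is needed later: an idempotent \<open>v\<close> with
\<open>v u = v\<close> lies in \<open>M\<close>, hence \<open>S v = M\<close> contains \<open>u\<close>, and
\<open>u = r v\<close> gives \<open>u v = u\<close>.\<close>

lemma minimal_idempotent_exists:
  obtains u where "u \<in> S" "m u u = u"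
    "\<And>v. \<lbrakk>v \<in> S; m v v = v; m v u = v\<rbrakk> \<Longrightarrow> m u v = u"
proof -
  let ?P = "\<lambda>B. \<forall>p\<in>S. \<forall>q\<in>B. m p q \<in> B"
  obtain M where M: "M \<subseteq> S" "closed M" "M \<noteq> {}" "?P M"
    and min: "\<And>B. \<lbrakk>B \<subseteq> M; closed B; B \<noteq> {}; ?P B\<rbrakk> \<Longrightarrow> B = M"
  proof (rule minimal_closed_subset[of S ?P])
    fix C assume "\<And>B. B \<in> C \<Longrightarrow> B \<subseteq> S \<and> closed B \<and> ?P B"
    then show "?P (\<Inter>C)" by blast
  qed (use compact closed_S nonempty mult_closed in auto)
  obtain u where u: "u \<in> M" "m u u = u"
    by (rule idempotent_exists[of M]) (use M in auto)
  show ?thesis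
  proof (rule that[of u])
    fix v assume v: "v \<in> S" "m v v = v" "m v u = v"
    have vM: "v \<in> M" using M(4) u v by metis
    have "(\<lambda>p. m p v) ` S = M"
    proof (rule min)
      show "(\<lambda>p. m p v) ` S \<subseteq> M" using M(4) vM by auto
      show "closed ((\<lambda>p. m p v) ` S)" using closed_right_translate closed_S by auto
      show "?P ((\<lambda>p. m p v) ` S)" by (auto simp: assoc[symmetric] intro!: imageI mult_closed)
    qed (use nonempty in auto)
    then obtain r where "r \<in> S" "u = m r v" using u by (metis imageE)
    then show "m u v = u" using v by (simp add: assoc)
  qed (use u M in auto)
qed

end

text \<open>Left multiplication is continuous only for the transformations in \<open>G\<close> themselves, so the
closure is reached in two steps: first the right factor is moved into the closure, then the left
one.\<close>

lemma closure_mult_closed: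
  fixes m :: "'a::topological_space \<Rightarrow> 'a \<Rightarrow> 'a"
  assumes right_cont: "\<And>q. continuous_on UNIV (\<lambda>p. m p q)"
    and left_cont: "\<And>g. g \<in> G \<Longrightarrow> continuous_on (closure G) (m g)"
    and G: "\<And>g h. g \<in> G \<Longrightarrow> h \<in> G \<Longrightarrow> m g h \<in> G"
    and p: "p \<in> closure G" and q: "q \<in> closure G"
  shows "m p q \<in> closure G"
proof -
  have "m g q \<in> closure G" if "g \<in> G" for g
  proof -
    have "m g ` closure G \<subseteq> closure G"
      by (rule image_closure_subset[OF left_cont[OF that]])
        (use G that closure_subset[of G] in auto)
    then show ?thesis using q by blast
  qed
  then have "(\<lambda>p. m p q) ` closure G \<subseteq> closure G"
    by (intro image_closure_subset continuous_on_subset[OF right_cont]) auto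
  then show ?thesis using p by blast
qed

section \<open>Enveloping semigroups of shifts and of their cubes\<close>

lemma Hausdorff_space_hc_maps:
  "Hausdorff_space (euclidean :: (hc \<Rightarrow> hc) topology)"
  "Hausdorff_space (euclidean :: ('v \<Rightarrow> hc \<Rightarrow> hc) topology)"
  by (intro Hausdorff_space_fun Hausdorff_space_euclidean)+

lemma continuous_on_eval [continuous_intros]:
  "continuous_on A (\<lambda>p::'i \<Rightarrow> 'b::topological_space. p i)"
  by (rule continuous_on_subset[OF continuous_on_product_coordinates]) auto

lemma continuous_on_eval2 [continuous_intros]:
  "continuous_on A (\<lambda>p::'i \<Rightarrow> 'j \<Rightarrow> 'b::topological_space. p i j)"
  by (rule continuous_on_product_then_coordinatewise[OF continuous_on_eval])

lemma continuous_on_eval3 [continuous_intros]: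
  "continuous_on A (\<lambda>p::'i \<Rightarrow> 'j \<Rightarrow> 'k \<Rightarrow> 'b::topological_space. p i j k)"
  by (rule continuous_on_product_then_coordinatewise[OF continuous_on_eval2])

lemma continuous_on_reindex [continuous_intros]:
  "continuous_on A (\<lambda>f::'i \<Rightarrow> 'b::topological_space. f \<circ> r)"
  by (intro continuous_on_coordinatewise_then_product) (auto intro: continuous_intros)

lemma vdot_add: "vdot d (\<lambda>i. n i + n' i) e = vdot d n e + vdot d n' e"
  by (simp add: vdot_def distrib_right sum.distrib)

lemma vdot_single:
  "j \<in> {1..d} \<Longrightarrow> vdot d (\<lambda>i. if i = j then t else 0) e = t * e j"
  by (simp add: vdot_def if_distrib[of "\<lambda>x. x * _"] cong: if_cong)

lemma finite_vertices: "finite (vertices d)"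
  unfolding vertices_def by (intro finite_PiE) auto

lemma zero_vertex_in: "zero_vertex d \<in> vertices d"
  by (simp add: zero_vertex_def vertices_def)

lemma vdot_zero_vertex [simp]: "vdot d n (zero_vertex d) = 0"
  by (simp add: vdot_def zero_vertex_def)

lemma compact_closed_subset:
  assumes "compact K" "closed A" "A \<subseteq> K" shows "compact A"
  using compact_Int_closed[OF assms(1,2)] assms(3) by (simp add: Int_absorb1)

text \<open>The integers act on indices by \<open>s\<close> and hence on bounded sequences by reindexing. All
systems of the proof are realised inside this one compact system, for a number \<open>d\<close> that is
the dimension of the cubes.\<close>

locale shift_system =
  fixes s :: "int \<Rightarrow> nat \<Rightarrow> nat" and B :: real and d :: nat
  assumes s_0: "s 0 = id" and s_add: "s (m + n) = s m \<circ> s n" and B_nonneg: "0 \<le> B"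
begin

text \<open>The transformation \<open>\<tau> n\<close> is the identity off \<open>W\<close>: this makes the closure
\<open>E\<close> of all \<open>\<tau> n\<close> in the space of all maps compact, so that \<open>E\<close> is the
enveloping semigroup of the system on \<open>W\<close>. Likewise \<open>\<Gamma>\<close> is the enveloping
semigroup of the group generated by the face transformations and the diagonal transformation,
recorded coordinatewise as a family of elements of \<open>E\<close> that is indexed by the vertices of
the cube.\<close>

definition W :: "hc set" where "W = {f. \<forall>k. 0 \<le> f k \<and> f k \<le> B}"

definition \<tau> :: "int \<Rightarrow> hc \<Rightarrow> hc" where "\<tau> n f = (if f \<in> W then f \<circ> s n else f)"

definition E :: "(hc \<Rightarrow> hc) set" where "E = closure (range \<tau>)"

definition \<gamma> :: "int \<Rightarrow> (nat \<Rightarrow> int) \<Rightarrow> (nat \<Rightarrow> int) \<Rightarrow> hc \<Rightarrow> hc" where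
  "\<gamma> m n = (\<lambda>e. if e \<in> vertices d then \<tau> (m + vdot d n e) else id)"

definition \<Gamma> :: "((nat \<Rightarrow> int) \<Rightarrow> hc \<Rightarrow> hc) set" where "\<Gamma> = closure (range (case_prod \<gamma>))"

abbreviation cmult (infixl "\<star>" 70) where "cmult p q \<equiv> (\<lambda>e::nat \<Rightarrow> int. (p e :: hc \<Rightarrow> hc) \<circ> q e)"

lemma compact_W: "compact W"
proof -
  have "W = {f. \<forall>k. f k \<in> {0..B}}" by (auto simp: W_def)
  then show ?thesis using compact_Pi[of "\<lambda>_. {0..B}"] by simp
qed

lemma closed_W: "closed W" using compact_W by (rule compact_imp_closed)

lemma W_reindex: "f \<in> W \<Longrightarrow> f \<circ> r \<in> W" by (simp add: W_def)

lemma \<tau>_W: "f \<in> W \<Longrightarrow> \<tau> n f \<in> W" by (simp add: \<tau>_def W_reindex)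

lemma \<tau>_apply: "f \<in> W \<Longrightarrow> \<tau> n f k = f (s n k)" by (simp add: \<tau>_def)

lemma \<tau>_0 [simp]: "\<tau> 0 = id" by (auto simp: \<tau>_def s_0)

lemma \<tau>_add: "\<tau> m (\<tau> n f) = \<tau> (m + n) f"
  using s_add[of n m] by (auto simp: \<tau>_def W_reindex comp_assoc add.commute)

lemma \<tau>_comp: "\<tau> m \<circ> \<tau> n = \<tau> (m + n)" by (auto simp: \<tau>_add)

lemma continuous_on_\<tau>: "continuous_on W (\<tau> n)"
  by (rule continuous_on_cong[THEN iffD1, OF refl _ continuous_on_reindex[of W "s n"]])
    (simp add: \<tau>_def)

lemma \<gamma>_mult: "\<gamma> m n \<star> \<gamma> m' n' = \<gamma> (m + m') (\<lambda>i. n i + n' i)"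
  by (auto simp: \<gamma>_def \<tau>_comp vdot_add algebra_simps)

lemma \<tau>_in_E: "\<tau> n \<in> E" 
  unfolding E_def by (rule subsetD[OF closure_subset rangeI])

lemma \<gamma>_in_\<Gamma>: "\<gamma> m n \<in> \<Gamma>"
proof -
  have "\<gamma> m n \<in> range (case_prod \<gamma>)" by (rule image_eqI[of _ _ "(m, n)"]) auto
  then show ?thesis unfolding \<Gamma>_def by (rule subsetD[OF closure_subset])
qed

lemma id_in_E: "id \<in> E" using \<tau>_in_E[of 0] by simp

lemma E_in_closed: assumes "p \<in> E" "closed C" "\<And>n. \<tau> n \<in> C" shows "p \<in> C"
  using closure_minimal[of "range \<tau>" C] assms by (auto simp: E_def)

lemma \<Gamma>_in_closed: assumes "p \<in> \<Gamma>" "closed C" "\<And>m n. \<gamma> m n \<in> C" shows "p \<in> C"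
proof -
  have "range (case_prod \<gamma>) \<subseteq> C" using assms(3) by auto
  then have "closure (range (case_prod \<gamma>)) \<subseteq> C" using assms(2) by (rule closure_minimal)
  then show ?thesis using assms(1) unfolding \<Gamma>_def by (rule subsetD)
qed

lemma E_meets_open: assumes "p \<in> E" "open U" "p \<in> U" obtains n where "\<tau> n \<in> U"
proof -
  have "range \<tau> \<inter> U \<noteq> {}"
    using assms open_Int_closure_eq_empty[OF assms(2), of "range \<tau>"] unfolding E_def by blast
  then show ?thesis using that by auto
qed

lemma \<Gamma>_meets_open: assumes "p \<in> \<Gamma>" "open U" "p \<in> U" obtains m n where "\<gamma> m n \<in> U"
proof -
  have "range (case_prod \<gamma>) \<inter> U \<noteq> {}"
    using assms open_Int_closure_eq_empty[OF assms(2), of "range (case_prod \<gamma>)"]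
    unfolding \<Gamma>_def by blast
  then show ?thesis using that by auto
qed

lemma \<Gamma>_coord: assumes "p \<in> \<Gamma>" shows "p e \<in> E"
proof -
  have "p \<in> (\<lambda>p. p e) -` E"
  proof (rule \<Gamma>_in_closed[OF assms])
    show "closed ((\<lambda>p::(nat\<Rightarrow>int) \<Rightarrow> hc \<Rightarrow> hc. p e) -` E)"
      by (rule closed_vimage[OF _ continuous_on_eval]) (simp add: E_def)
    show "\<gamma> m n \<in> (\<lambda>p. p e) -` E" for m n by (simp add: \<gamma>_def \<tau>_in_E id_in_E)
  qed
  then show ?thesis by simp
qed

lemma E_W: assumes "p \<in> E" "f \<in> W" shows "p f \<in> W"
proof -
  have "p \<in> (\<lambda>p. p f) -` W"
    by (rule E_in_closed[OF assms(1)])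
      (auto intro!: closed_vimage closed_W continuous_on_eval \<tau>_W assms)
  then show ?thesis by simp
qed

lemma E_out: assumes "p \<in> E" "f \<notin> W" shows "p f = f"
proof -
  have "p \<in> (\<lambda>p. p f) -` {f}"
    by (rule E_in_closed[OF assms(1)])
      (use assms in \<open>auto intro!: closed_vimage continuous_on_eval simp: \<tau>_def\<close>)
  then show ?thesis by simp
qed

lemma compact_maps: "compact {p. \<forall>f. p f \<in> (if f \<in> W then W else {f})}"
  by (rule compact_Pi) (simp add: compact_W)

lemma compact_E: "compact E"
proof -
  have "E \<subseteq> {p. \<forall>f. p f \<in> (if f \<in> W then W else {f})}" using E_W E_out by auto
  then show ?thesis by (rule compact_closed_subset[OF compact_maps, rotated]) (simp add: E_def)
qed

lemma compact_\<Gamma>: "compact \<Gamma>"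
proof -
  have "\<Gamma> \<subseteq> {p. \<forall>e. p e \<in> E}" using \<Gamma>_coord by auto
  moreover have "compact {p::(nat\<Rightarrow>int) \<Rightarrow> hc \<Rightarrow> hc. \<forall>e. p e \<in> E}"
    by (rule compact_Pi) (rule compact_E)
  moreover have "closed \<Gamma>" by (simp add: \<Gamma>_def)
  ultimately show ?thesis using compact_closed_subset by blast
qed

lemma continuous_on_\<tau>_comp:
  assumes h: "continuous_on A h" "\<And>p. p \<in> A \<Longrightarrow> h p \<in> E"
  shows "continuous_on A (\<lambda>p. \<tau> n \<circ> h p)"
proof (rule continuous_on_coordinatewise_then_product)
  fix f
  show "continuous_on A (\<lambda>p. (\<tau> n \<circ> h p) f)"
  proof (cases "f \<in> W")
    case True
    have "continuous_on A (\<lambda>p. h p f)" by (rule continuous_on_product_then_coordinatewise[OF h(1)])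
    then show ?thesis
      unfolding comp_def using continuous_on_compose2[OF continuous_on_\<tau>[of n]] E_W[OF h(2) True]
      by (metis image_subsetI)
  next
    case False
    show ?thesis
      by (rule continuous_on_cong[THEN iffD1, OF refl _ continuous_on_const[of _ f]])
        (use False E_out[OF h(2) False] in \<open>simp add: \<tau>_def\<close>)
  qed
qed

lemma right_cont_E: "continuous_on A (\<lambda>p::hc \<Rightarrow> hc. p \<circ> q)"
  by (rule continuous_on_reindex)

lemma right_cont_\<Gamma>: "continuous_on A (\<lambda>p. p \<star> q)"
  unfolding comp_def
  by (intro continuous_on_coordinatewise_then_product continuous_on_eval3)

lemma E_mult: assumes "p \<in> E" "q \<in> E" shows "p \<circ> q \<in> E"
  unfolding E_def
proof (rule closure_mult_closed[where m = "(\<circ>)"])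
  show "continuous_on (closure (range \<tau>)) ((\<circ>) g)" if "g \<in> range \<tau>" for g
    using that continuous_on_\<tau>_comp[of E "\<lambda>p. p"] by (auto simp: E_def)
qed (use assms right_cont_E in \<open>auto simp: \<tau>_comp E_def\<close>)

lemma \<Gamma>_mult: assumes "p \<in> \<Gamma>" "q \<in> \<Gamma>" shows "p \<star> q \<in> \<Gamma>"
  unfolding \<Gamma>_def
proof (rule closure_mult_closed[where m = cmult])
  fix g assume "g \<in> range (case_prod \<gamma>)"
  then obtain m n where g: "g = \<gamma> m n" by auto
  show "continuous_on (closure (range (case_prod \<gamma>))) (\<lambda>q. g \<star> q)"
  proof (rule continuous_on_coordinatewise_then_product)
    fix e
    show "continuous_on (closure (range (case_prod \<gamma>))) (\<lambda>q. g e \<circ> q e)"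
    proof (cases "e \<in> vertices d")
      case True
      have "continuous_on \<Gamma> (\<lambda>q. \<tau> (m + vdot d n e) \<circ> q e)"
        by (rule continuous_on_\<tau>_comp[OF continuous_on_eval \<Gamma>_coord])
      then show ?thesis using True by (simp add: g \<gamma>_def \<Gamma>_def)
    next
      case False
      then show ?thesis by (simp add: g \<gamma>_def continuous_on_eval)
    qed
  qed
next
  fix g h assume "g \<in> range (case_prod \<gamma>)" "h \<in> range (case_prod \<gamma>)"
  then obtain m n m' n' where "g = \<gamma> m n" "h = \<gamma> m' n'" by auto
  then have "g \<star> h = case_prod \<gamma> (m + m', \<lambda>i. n i + n' i)" using \<gamma>_mult by simp
  then show "g \<star> h \<in> range (case_prod \<gamma>)" by (metis rangeI)
qed (use assms right_cont_\<Gamma> in \<open>auto simp: \<Gamma>_def\<close>)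

sublocale E: compact_semigroup E "(\<circ>)"
proof
  show "E \<noteq> {}" using id_in_E by auto
qed (use Hausdorff_space_hc_maps(1) compact_E E_mult right_cont_E in \<open>auto simp: comp_assoc\<close>)

sublocale \<Gamma>: compact_semigroup \<Gamma> cmult
proof
  show "\<Gamma> \<noteq> {}" using \<gamma>_in_\<Gamma> by auto
qed (use Hausdorff_space_hc_maps(2) compact_\<Gamma> \<Gamma>_mult right_cont_\<Gamma> in \<open>auto simp: comp_assoc\<close>)

lemma E_mono: assumes "p \<in> E" "f \<in> W" "g \<in> W" "f \<le> g" shows "p f \<le> p g"
proof (rule le_funI)
  fix k
  have "p \<in> {p. p f k \<le> p g k}"
    by (rule E_in_closed[OF assms(1)])
      (use assms in \<open>auto intro!: closed_Collect_le continuous_intros simp: \<tau>_apply le_funD\<close>)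
  then show "p f k \<le> p g k" by simp
qed

lemma E_reindex:
  assumes "p \<in> E" "f \<in> W" "\<And>n. s n \<circ> r = r \<circ> s n"
  shows "p (f \<circ> r) = p f \<circ> r"
proof
  fix k
  have sr: "s n (r k) = r (s n k)" for n k using assms(3)[of n] by (metis comp_apply)
  have "p \<in> {p. p (f \<circ> r) k = p f (r k)}"
    by (rule E_in_closed[OF assms(1)])
      (use assms in \<open>auto intro!: closed_Collect_eq continuous_intros simp: \<tau>_apply W_reindex sr\<close>)
  then show "p (f \<circ> r) k = (p f \<circ> r) k" by simp
qed

lemma E_preserves:
  assumes "p \<in> E" "closed C" "\<And>n. \<tau> n f \<in> C" shows "p f \<in> C"
proof -
  have "p \<in> (\<lambda>p. p f) -` C"
    by (rule E_in_closed[OF assms(1)]) (use assms in \<open>auto intro!: closed_vimage continuous_on_eval\<close>)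
  then show ?thesis by simp
qed

text \<open>A map \<open>\<phi>\<close> of the vertices that turns integer affine forms into integer affine forms maps
the generating group of \<open>\<Gamma>\<close> into itself, hence also its closure. This covers
reflections of the cube and the duplication of a face.\<close>

lemma \<Gamma>_reindex:
  assumes p: "p \<in> \<Gamma>"
    and aff: "\<And>m n. \<exists>m' n'. \<forall>e\<in>vertices d. \<phi> e \<in> vertices d \<and> m + vdot d n (\<phi> e) = m' + vdot d n' e"
  shows "(\<lambda>e. if e \<in> vertices d then p (\<phi> e) else id) \<in> \<Gamma>"
proof -
  let ?F = "\<lambda>p::(nat\<Rightarrow>int) \<Rightarrow> hc \<Rightarrow> hc. \<lambda>e. if e \<in> vertices d then p (\<phi> e) else id"
  have "continuous_on UNIV (\<lambda>p. ?F p e)" for e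
    by (cases "e \<in> vertices d") (auto intro: continuous_intros)
  then have "continuous_on UNIV ?F" by (rule continuous_on_coordinatewise_then_product)
  then have "?F ` \<Gamma> \<subseteq> \<Gamma>"
    unfolding \<Gamma>_def
  proof (intro image_closure_subset[OF continuous_on_subset])
    show "?F ` range (case_prod \<gamma>) \<subseteq> closure (range (case_prod \<gamma>))"
    proof clarsimp
      fix m n
      obtain m' n' where *: "\<forall>e\<in>vertices d. \<phi> e \<in> vertices d \<and> m + vdot d n (\<phi> e) = m' + vdot d n' e"
        using aff by blast
      have "?F (\<gamma> m n) = \<gamma> m' n'" using * by (auto simp: \<gamma>_def)
      then show "?F (\<gamma> m n) \<in> closure (range (case_prod \<gamma>))" using \<gamma>_in_\<Gamma> by (simp add: \<Gamma>_def)
    qed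
  qed auto
  then show ?thesis using p by blast
qed

text \<open>If the indicator function of a set of vertices is an affine form, then the copy of the integers
that acts on the vertices in that set alone lies in \<open>\<Gamma>\<close>, hence also the copy of its
closure \<open>E\<close>.\<close>

lemma \<Gamma>_pattern:
  assumes r: "r \<in> E"
    and aff: "\<And>t. \<exists>m n. \<forall>e\<in>vertices d. (if c e then t else 0) = m + vdot d n e"
  shows "(\<lambda>e. if e \<in> vertices d \<and> c e then r else id) \<in> \<Gamma>"
proof -
  let ?F = "\<lambda>r::hc \<Rightarrow> hc. \<lambda>e. if e \<in> vertices d \<and> c e then r else id"
  have "continuous_on UNIV (\<lambda>p. ?F p e)" for e
    by (cases "e \<in> vertices d \<and> c e") (auto intro: continuous_intros)
  then have "continuous_on UNIV ?F" by (rule continuous_on_coordinatewise_then_product)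
  then have "?F ` E \<subseteq> \<Gamma>"
    unfolding E_def
  proof (intro image_closure_subset[OF continuous_on_subset])
    show "?F ` range \<tau> \<subseteq> \<Gamma>"
    proof clarsimp
      fix t
      obtain m n where *: "\<forall>e\<in>vertices d. (if c e then t else 0) = m + vdot d n e"
        using aff by blast
      have "?F (\<tau> t) = \<gamma> m n" using * by (force simp: \<gamma>_def)
      then show "?F (\<tau> t) \<in> \<Gamma>" using \<gamma>_in_\<Gamma> by simp
    qed
  qed (auto simp: \<Gamma>_def)
  then show ?thesis using r by blast
qed

definition diag :: "(hc \<Rightarrow> hc) \<Rightarrow> (nat \<Rightarrow> int) \<Rightarrow> hc \<Rightarrow> hc" where
  "diag r = (\<lambda>e. if e \<in> vertices d then r else id)"

lemma diag_in_\<Gamma>: assumes "r \<in> E" shows "diag r \<in> \<Gamma>"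
proof -
  have "(\<lambda>e. if e \<in> vertices d \<and> True then r else id) \<in> \<Gamma>"
    by (rule \<Gamma>_pattern[OF assms]) (auto intro!: exI[of _ "\<lambda>_. 0"] simp: vdot_def)
  then show ?thesis by (simp add: diag_def)
qed

lemma vertex_01: "e \<in> vertices d \<Longrightarrow> j \<in> {1..d} \<Longrightarrow> e j = 0 \<or> e j = 1"
  by (auto simp: vertices_def PiE_def Pi_def)

lemma upper_face_in_\<Gamma>: assumes "r \<in> E" "j \<in> {1..d}"
  shows "(\<lambda>e. if e \<in> vertices d \<and> e j = 1 then r else id) \<in> \<Gamma>"
proof (rule \<Gamma>_pattern[OF assms(1)])
  fix t
  have "\<forall>e\<in>vertices d. (if e j = 1 then t else 0) = 0 + vdot d (\<lambda>i. if i = j then t else 0) e"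
    using vertex_01[OF _ assms(2)] by (fastforce simp: vdot_single[OF assms(2)])
  then show "\<exists>m n. \<forall>e\<in>vertices d. (if e j = 1 then t else 0) = m + vdot d n e" by blast
qed

lemma lower_face_in_\<Gamma>: assumes "r \<in> E" "j \<in> {1..d}"
  shows "(\<lambda>e. if e \<in> vertices d \<and> e j = 0 then r else id) \<in> \<Gamma>"
proof (rule \<Gamma>_pattern[OF assms(1)])
  fix t
  have "\<forall>e\<in>vertices d. (if e j = 0 then t else 0) = t + vdot d (\<lambda>i. if i = j then - t else 0) e"
    using vertex_01[OF _ assms(2)] by (fastforce simp: vdot_single[OF assms(2)])
  then show "\<exists>m n. \<forall>e\<in>vertices d. (if e j = 0 then t else 0) = m + vdot d n e" by blast
qed

text \<open>The punctured cube \<open>e \<noteq> 0\<close> is not given by an affine form, but an idempotent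
\<open>v\<close> can still act there: in the product of the \<open>d\<close> copies of \<open>v\<close> on the
upper faces, a nonzero vertex receives a positive power of \<open>v\<close>, which is
\<open>v\<close>. Transitivity of regional proximality rests on this.\<close>

lemma punctured_idempotent_in_\<Gamma>: assumes "v \<in> E" "v \<circ> v = v"
  shows "(\<lambda>e. if e \<in> vertices d \<and> e \<noteq> zero_vertex d then v else id) \<in> \<Gamma>"
proof -
  have *: "j \<le> d \<Longrightarrow> (\<lambda>e. if e \<in> vertices d \<and> (\<exists>i\<in>{1..j}. e i = 1) then v else id) \<in> \<Gamma>" for j
  proof (induction j)
    case 0
    have "(\<lambda>e. if e \<in> vertices d \<and> (\<exists>i\<in>{1..0}. e i = 1) then v else id) = diag id"
      by (auto simp: diag_def)
    then show ?case using diag_in_\<Gamma>[OF id_in_E] by (simp only:)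
  next
    case (Suc j)
    then have "(\<lambda>e. if e \<in> vertices d \<and> (\<exists>i\<in>{1..j}. e i = 1) then v else id) \<star>
        (\<lambda>e. if e \<in> vertices d \<and> e (Suc j) = 1 then v else id) \<in> \<Gamma>" (is "?p \<in> _")
      by (intro \<Gamma>_mult upper_face_in_\<Gamma> assms) auto
    moreover have "?p = (\<lambda>e. if e \<in> vertices d \<and> (\<exists>i\<in>{1..Suc j}. e i = 1) then v else id)"
      using assms(2) by (rule_tac ext) (auto simp: atLeastAtMostSuc_conv)
    ultimately show ?case by simp
  qed
  have "(\<exists>i\<in>{1..d}. e i = 1) \<longleftrightarrow> e \<noteq> zero_vertex d" if "e \<in> vertices d" for e
  proof -
    have "e = zero_vertex d" if "\<forall>i\<in>{1..d}. e i \<noteq> 1"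
    proof
      fix i show "e i = zero_vertex d i"
        using \<open>e \<in> vertices d\<close> that vertex_01[of e i]
        by (cases "i \<in> {1..d}") (auto simp: zero_vertex_def vertices_def PiE_def extensional_def)
    qed
    then show ?thesis by (auto simp: zero_vertex_def)
  qed
  then have "(\<lambda>e. if e \<in> vertices d \<and> (\<exists>i\<in>{1..d}. e i = 1) then v else id) =
    (\<lambda>e. if e \<in> vertices d \<and> e \<noteq> zero_vertex d then v else id)"
    by (intro ext if_cong conj_cong) auto
  then show ?thesis using *[of d] by simp
qed

text \<open>\<open>\<Gamma>\<close> is compact but not metrizable, so a sequence need not have a convergent
subsequence. A filter finer than \<open>sequentially\<close> along which the sequence converges
coordinatewise serves the same purpose.\<close>

lemma \<Gamma>_cluster:
  assumes "\<And>k::nat. p k \<in> \<Gamma>"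
  obtains q F where "q \<in> \<Gamma>" "F \<noteq> bot" "F \<le> sequentially" "\<And>e f. ((\<lambda>k. p k e f) \<longlongrightarrow> q e f) F"
proof -
  obtain q where q: "q \<in> \<Gamma>" "inf (nhds q) (filtermap p sequentially) \<noteq> bot"
    using compact_\<Gamma> assms unfolding compact_filter
    by (metis (no_types, lifting) eventually_filtermap always_eventually filtermap_bot_iff sequentially_bot)
  define F where "F = inf (filtercomap p (nhds q)) sequentially"
  have F: "F \<noteq> bot"
  proof
    assume "F = bot"
    then have "eventually (\<lambda>_. False) F" by simp
    then obtain P Q where PQ: "eventually P (filtercomap p (nhds q))" "eventually Q sequentially"
      "\<And>x. P x \<and> Q x \<Longrightarrow> False"
      unfolding F_def eventually_inf by blast
    obtain P' where P': "eventually P' (nhds q)" "\<And>x. P' (p x) \<Longrightarrow> P x"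
      using PQ(1) by (auto simp: eventually_filtercomap)
    have "eventually (\<lambda>y. \<not> P' y) (filtermap p sequentially)"
      using PQ(2) unfolding eventually_filtermap by eventually_elim (use PQ(3) P'(2) in blast)
    then have "eventually (\<lambda>_. False) (inf (nhds q) (filtermap p sequentially))"
      using P'(1) unfolding eventually_inf by blast
    then show False using q(2) by (simp add: trivial_limit_def)
  qed
  have lim: "(p \<longlongrightarrow> q) F"
    unfolding F_def filterlim_iff_le_filtercomap by simp
  have "((\<lambda>k. p k e f) \<longlongrightarrow> q e f) F" for e f
    using continuous_on_tendsto_compose[OF continuous_on_eval2[of UNIV e f] lim] by simp
  then show ?thesis using that[of q F] q(1) F by (simp add: F_def)
qed

end

section \<open>Minimal idempotents and their groups\<close>

text \<open>The assumptions on \<open>u\<close> are those provided by \<open>minimal_idempotent_exists\<close>.\<close>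

locale idempotent_shift = shift_system +
  fixes u :: "hc \<Rightarrow> hc"
  assumes u_E: "u \<in> E" and u_idem: "u \<circ> u = u"
    and u_min: "\<And>v. \<lbrakk>v \<in> E; v \<circ> v = v; v \<circ> u = v\<rbrakk> \<Longrightarrow> u \<circ> v = u"
begin

lemma u_u [simp]: "u (u f) = u f" using u_idem by (metis comp_apply)

text \<open>The reason for minimality of cube systems: the diagonal element with all coordinates \<open>u\<close>
behaves like a minimal idempotent of \<open>\<Gamma>\<close>, because minimality can be tested in each
coordinate separately.\<close>

lemma cube_inverse:
  assumes p: "p \<in> \<Gamma>"
  obtains q where "q \<in> \<Gamma>" "\<And>e f. e \<in> vertices d \<Longrightarrow> u (q e (p e (u f))) = u f"
proof -
  let ?pu = "p \<star> diag u"
  have pu: "?pu \<in> \<Gamma>" by (rule \<Gamma>_mult[OF p diag_in_\<Gamma>[OF u_E]])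
  let ?A = "(\<lambda>r. r \<star> ?pu) ` \<Gamma>"
  have A: "?A \<subseteq> \<Gamma>" using \<Gamma>_mult[OF _ pu] by auto
  have A4: "x \<star> y \<in> ?A" if xy: "x \<in> ?A" "y \<in> ?A" for x y
  proof -
    obtain r where r: "r \<in> \<Gamma>" "y = r \<star> ?pu" using xy(2) by auto
    have "x \<star> y = (x \<star> r) \<star> ?pu" unfolding r(2) by (simp add: comp_assoc)
    moreover have "x \<star> r \<in> \<Gamma>" by (rule \<Gamma>_mult[OF _ r(1)]) (use A xy(1) in auto)
    ultimately show ?thesis by (rule image_eqI)
  qed
  have Acl: "closed ?A" by (rule \<Gamma>.closed_right_translate[OF order.refl \<Gamma>.closed_S])
  \<comment> \<open>An idempotent of the left ideal generated by the product of p with the diagonal element u.\<close>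
  obtain w where w: "w \<in> ?A" "w \<star> w = w"
    by (rule \<Gamma>.idempotent_exists[OF A Acl _ A4]) (use \<Gamma>.nonempty in auto)
  obtain q where q: "q \<in> \<Gamma>" "w = q \<star> ?pu" using w(1) by auto
  show ?thesis
  proof (rule that[OF q(1)])
    fix e f assume e: "e \<in> vertices d"
    have we: "w e = q e \<circ> (p e \<circ> u)" using e by (simp add: q(2) diag_def)
    \<comment> \<open>Each coordinate w e is an idempotent absorbing u on its right, so minimality of u applies to it.\<close>
    have "u \<circ> w e = u"
    proof (rule u_min)
      show "w e \<in> E" using \<Gamma>_coord A w(1) by blast
      show "w e \<circ> w e = w e" using fun_cong[OF w(2), of e] .
      show "w e \<circ> u = w e" by (simp add: we comp_assoc u_idem)
    qed
    then show "u (q e (p e (u f))) = u f" unfolding we by (metis comp_apply)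
  qed
qed

text \<open>The elements \<open>u a u\<close> form a group: \<open>cube_inverse\<close> provides left inverses, and
in a monoid in which all elements have left inverses these are two-sided.\<close>

lemma cube_group:
  assumes a: "a \<in> \<Gamma>" "\<And>e f. e \<in> vertices d \<Longrightarrow> u (a e (u f)) = a e f"
  obtains b where "b \<in> \<Gamma>" "\<And>e f. e \<in> vertices d \<Longrightarrow> u (b e (u f)) = b e f"
    "\<And>e f. e \<in> vertices d \<Longrightarrow> b e (a e f) = u f" "\<And>e f. e \<in> vertices d \<Longrightarrow> a e (b e f) = u f"
proof -
  have left: "\<exists>b\<in>\<Gamma>. \<forall>e\<in>vertices d. \<forall>f. u (b e (u f)) = b e f \<and> b e (a e f) = u f"
    if a: "a \<in> \<Gamma>" "\<And>e f. e \<in> vertices d \<Longrightarrow> u (a e (u f)) = a e f" for a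
  proof -
    obtain q where q: "q \<in> \<Gamma>" "\<And>e f. e \<in> vertices d \<Longrightarrow> u (q e (a e (u f))) = u f"
      using cube_inverse[OF a(1)] by metis
    let ?b = "diag u \<star> (q \<star> diag u)"
    have "?b \<in> \<Gamma>" by (intro \<Gamma>_mult q diag_in_\<Gamma> u_E)
    moreover have "u (?b e (u f)) = ?b e f \<and> ?b e (a e f) = u f" if e: "e \<in> vertices d" for e f
    proof -
      have b: "?b e g = u (q e (u g))" for g using e by (simp add: diag_def)
      have "u (a e f) = a e f" "a e f = a e (u f)"
        using a(2)[OF e, of f] a(2)[OF e, of "u f"] u_u by metis+
      then show ?thesis unfolding b using q(2)[OF e, of f] by simp
    qed
 ultimately show ?thesis by (intro bexI[of _ ?b] ballI allI)
  qed
  obtain b where b: "b \<in> \<Gamma>" "\<And>e f. e \<in> vertices d \<Longrightarrow> u (b e (u f)) = b e f"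
    "\<And>e f. e \<in> vertices d \<Longrightarrow> b e (a e f) = u f"
    using left[OF a] by auto
  obtain c where c: "c \<in> \<Gamma>" "\<And>e f. e \<in> vertices d \<Longrightarrow> u (c e (u f)) = c e f"
    "\<And>e f. e \<in> vertices d \<Longrightarrow> c e (b e f) = u f"
    using left[OF b(1,2)] by auto
  have "a e (b e f) = u f" if e: "e \<in> vertices d" for e f
  proof -
    have "a e g = c e g" for g
    proof -
      have "a e g = u (a e g)" using a(2)[OF e, of g] u_u by metis
      also have "\<dots> = c e (b e (a e g))" using c(3)[OF e] by simp
      also have "\<dots> = c e (u g)" using b(3)[OF e] by simp
      also have "\<dots> = c e g" using c(2)[OF e, of g] c(2)[OF e, of "u g"] u_u by metis
      finally show ?thesis .
    qed
    then show ?thesis using c(3)[OF e] by simp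
  qed
  then show ?thesis using that b by blast
qed

lemma E_inverse:
  assumes p: "p \<in> E" obtains q where "q \<in> E" "\<And>f. u (q (p (u f))) = u f"
proof -
  obtain q where q: "q \<in> \<Gamma>" "\<And>e f. e \<in> vertices d \<Longrightarrow> u (q e (diag p e (u f))) = u f"
    using cube_inverse[OF diag_in_\<Gamma>[OF p]] by metis
  show ?thesis
    by (rule that[OF \<Gamma>_coord[OF q(1), of "zero_vertex d"]])
      (use q(2)[OF zero_vertex_in] in \<open>simp add: diag_def zero_vertex_in\<close>)
qed

lemma E_group:
  assumes a: "a \<in> E" "\<And>f. u (a (u f)) = a f"
  obtains b where "b \<in> E" "\<And>f. u (b (u f)) = b f" "\<And>f. b (a f) = u f" "\<And>f. a (b f) = u f"
proof -
  obtain b where b: "b \<in> \<Gamma>" "\<And>e f. e \<in> vertices d \<Longrightarrow> u (b e (u f)) = b e f"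
    "\<And>e f. e \<in> vertices d \<Longrightarrow> b e (diag a e f) = u f"
    "\<And>e f. e \<in> vertices d \<Longrightarrow> diag a e (b e f) = u f"
    by (rule cube_group[OF diag_in_\<Gamma>[OF a(1)]]) (use a(2) in \<open>auto simp: diag_def\<close>)
  show ?thesis
    by (rule that[OF \<Gamma>_coord[OF b(1), of "zero_vertex d"]])
      (use b(2-)[OF zero_vertex_in] in \<open>simp_all add: diag_def zero_vertex_in\<close>)
qed

text \<open>The points of the cube system generated by the diagonal point \<open>(f, \<dots>, f)\<close>, described
by the semigroup instead of a closure; only the coordinates at vertices matter.\<close>

definition cube :: "hc \<Rightarrow> ((nat \<Rightarrow> int) \<Rightarrow> hc) \<Rightarrow> bool" where
  "cube f z \<longleftrightarrow> (\<exists>p\<in>\<Gamma>. \<forall>e\<in>vertices d. z e = p e f)"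

lemma cube_cong: "cube f z \<Longrightarrow> (\<And>e. e \<in> vertices d \<Longrightarrow> z e = z' e) \<Longrightarrow> cube f z'"
  by (auto simp: cube_def)

lemma cube_mult: assumes "p \<in> \<Gamma>" "cube f z" shows "cube f (\<lambda>e. p e (z e))"
proof -
  obtain q where "q \<in> \<Gamma>" "\<forall>e\<in>vertices d. z e = q e f" using assms(2) by (auto simp: cube_def)
  then show ?thesis
    unfolding cube_def by (intro bexI[OF _ \<Gamma>_mult[OF assms(1)]]) auto
qed

lemma cube_limit:
  assumes "\<And>\<delta>. \<delta> > 0 \<Longrightarrow> \<exists>y. cube f y \<and> (\<forall>e\<in>vertices d. dist (z e) (y e) < \<delta>)"
  shows "cube f z"
proof -
  have "\<exists>p. p \<in> \<Gamma> \<and> (\<forall>e\<in>vertices d. dist (z e) (p e f) < inverse (real (Suc j)))" for j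
    using assms[of "inverse (real (Suc j))"] by (force simp: cube_def)
  then obtain p where p: "\<And>j. p j \<in> \<Gamma>"
    "\<And>j e. e \<in> vertices d \<Longrightarrow> dist (z e) (p j e f) < inverse (real (Suc j))"
    by metis
  obtain q F where q: "q \<in> \<Gamma>" "F \<noteq> bot" "F \<le> sequentially" "\<And>e f. ((\<lambda>k. p k e f) \<longlongrightarrow> q e f) F"
    using \<Gamma>_cluster[of p] p(1) by metis
  have "z e = q e f" if e: "e \<in> vertices d" for e
  proof -
    have "(\<lambda>j. p j e f) \<longlonglongrightarrow> z e"
    proof (rule metric_tendsto_imp_tendsto[OF LIMSEQ_inverse_real_of_nat])
      show "\<forall>\<^sub>F x in sequentially. dist (p x e f) (z e) \<le> dist (inverse (real (Suc x))) 0"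
        using p(2)[OF e] by (intro always_eventually allI) (simp add: dist_commute less_imp_le)
    qed
    then have "((\<lambda>j. p j e f) \<longlongrightarrow> z e) F" using q(3) by (rule tendsto_mono[rotated])
    then show ?thesis using q(2,4) tendsto_unique by blast
  qed
  then show ?thesis using q(1) by (auto simp: cube_def)
qed

end

section \<open>Regional proximality and cubes in a minimal shift\<close>

text \<open>Now \<open>X\<close> is a minimal subsystem of \<open>W\<close> with a point \<open>x0\<close> fixed by
\<open>u\<close>. Cubes have dimension \<open>k + 1\<close>, regional proximality has order
\<open>k\<close>.\<close>

locale minimal_shift = idempotent_shift +
  fixes X :: "hc set" and x0 :: hc and k :: nat
  assumes d_Suc: "d = Suc k"
    and X_W: "X \<subseteq> W" and closed_X: "closed X" and X_\<tau>: "\<And>n f. f \<in> X \<Longrightarrow> \<tau> n f \<in> X"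
    and X_minimal: "\<And>f. f \<in> X \<Longrightarrow> X \<subseteq> closure (range (\<lambda>n. \<tau> n f))"
    and x0_X: "x0 \<in> X" and u_x0: "u x0 = x0"
begin

lemma compact_X: "compact X" using compact_closed_subset[OF compact_W closed_X X_W] .

lemma E_X: "p \<in> E \<Longrightarrow> f \<in> X \<Longrightarrow> p f \<in> X" by (rule E_preserves[OF _ closed_X]) (auto intro: X_\<tau>)

lemma X_orbit: assumes "f \<in> X" "g \<in> X" obtains p where "p \<in> E" "p f = g"
proof -
  have "compact ((\<lambda>p. p f) ` E)"
    by (rule compact_continuous_image[OF continuous_on_eval compact_E])
  then have "closed ((\<lambda>p. p f) ` E)" by (rule compact_imp_closed)
  moreover have "range (\<lambda>n. \<tau> n f) \<subseteq> (\<lambda>p. p f) ` E" using \<tau>_in_E by auto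
  ultimately have "closure (range (\<lambda>n. \<tau> n f)) \<subseteq> (\<lambda>p. p f) ` E" by (rule closure_minimal[rotated])
  then show ?thesis using X_minimal[OF assms(1)] assms(2) that by blast
qed

text \<open>Every point \<open>w\<close> is fixed by an idempotent that generates the same left ideal as
\<open>u\<close>: the
elements \<open>p = p u\<close> of \<open>E\<close> that fix \<open>w\<close> form a closed subsemigroup,
nonempty since \<open>w\<close> lies in the orbit closure of \<open>u w\<close>.\<close>

lemma fixing_idempotent: assumes "w \<in> X"
  obtains v where "v \<in> E" "v \<circ> v = v" "v \<circ> u = v" "u \<circ> v = u" "v w = w"
proof -
  let ?A = "E \<inter> ({p. p \<circ> u = p} \<inter> {p. p w = w})"
  obtain r where r: "r \<in> E" "r (u w) = w" using X_orbit[of "u w" w] E_X u_E assms by metis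
  have "{p::hc\<Rightarrow>hc. p \<circ> u = p} = (\<Inter>f. {p. p (u f) = p f})"
    by (auto simp: fun_eq_iff)
  also have "closed \<dots>" by (intro closed_INT ballI closed_Collect_eq continuous_on_eval)
  finally have cl: "closed ?A"
    by (intro closed_Int E.closed_S closed_Collect_eq continuous_on_eval continuous_on_const)
  obtain v where v: "v \<in> ?A" "v \<circ> v = v"
  proof (rule E.idempotent_exists[of ?A])
    have "r \<circ> u \<in> ?A" using r E_mult[OF r(1) u_E] by (simp add: comp_assoc u_idem)
    then show "?A \<noteq> {}" by blast
    show "p \<circ> q \<in> ?A" if "p \<in> ?A" "q \<in> ?A" for p q
      using that E_mult by (auto simp: comp_assoc)
  qed (use cl in auto)
  then show ?thesis using that u_min by auto
qed

text \<open>Regional proximality of order \<open>k\<close> on \<open>X\<close>, with the metric of \<open>hc\<close>.\<close>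

definition R :: "hc \<Rightarrow> hc \<Rightarrow> bool" where
  "R x y \<longleftrightarrow> x \<in> X \<and> y \<in> X \<and> (\<forall>\<delta>>0. \<exists>x'\<in>X. \<exists>y'\<in>X. \<exists>n :: nat \<Rightarrow> int.
     dist x x' < \<delta> \<and> dist y y' < \<delta> \<and>
     (\<forall>e\<in>vertices k - {zero_vertex k}. dist (\<tau> (vdot k n e) x') (\<tau> (vdot k n e) y') < \<delta>))"

lemma R_X: "R x y \<Longrightarrow> x \<in> X" "R x y \<Longrightarrow> y \<in> X" by (auto simp: R_def)

lemma R_refl: "x \<in> X \<Longrightarrow> R x x"
  unfolding R_def by (auto intro!: bexI[of _ x])

lemma R_sym: "R x y \<Longrightarrow> R y x"
  unfolding R_def by (metis dist_commute)

lemma R_limit: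
  assumes "x \<in> X" "y \<in> X" "\<And>\<delta>. \<delta> > 0 \<Longrightarrow> \<exists>x' y'. R x' y' \<and> dist x x' < \<delta> \<and> dist y y' < \<delta>"
  shows "R x y"
  unfolding R_def
proof (intro conjI allI impI assms)
  fix \<delta> :: real assume "\<delta> > 0"
  then have d2: "\<delta> / 2 > 0" by simp
  obtain x1 y1 where 1: "R x1 y1" "dist x x1 < \<delta> / 2" "dist y y1 < \<delta> / 2" using assms(3)[OF d2] by blast
  obtain x' y' n where 2: "x' \<in> X" "y' \<in> X" "dist x1 x' < \<delta> / 2" "dist y1 y' < \<delta> / 2"
     "\<forall>e\<in>vertices k - {zero_vertex k}. dist (\<tau> (vdot k n e) x') (\<tau> (vdot k n e) y') < \<delta> / 2"
    using 1(1) d2 unfolding R_def by blast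
  have "dist x x' < \<delta>" "dist y y' < \<delta>"
    using 1 2 dist_triangle_half_r[of x1 x \<delta> x'] dist_triangle_half_r[of y1 y \<delta> y']
    by (auto simp: dist_commute)
  moreover have "\<forall>e\<in>vertices k - {zero_vertex k}. dist (\<tau> (vdot k n e) x') (\<tau> (vdot k n e) y') < \<delta>"
    by (rule ballI, drule bspec[OF 2(5)]) (use \<open>\<delta> > 0\<close> in linarith)
  ultimately show "\<exists>x'\<in>X. \<exists>y'\<in>X. \<exists>n. dist x x' < \<delta> \<and> dist y y' < \<delta> \<and>
     (\<forall>e\<in>vertices k - {zero_vertex k}. dist (\<tau> (vdot k n e) x') (\<tau> (vdot k n e) y') < \<delta>)"
    using 2(1,2) by blast
qed

lemma R_\<tau>: assumes "R x y" shows "R (\<tau> m x) (\<tau> m y)"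
  unfolding R_def
proof (intro conjI allI impI X_\<tau>)
  fix \<delta> :: real assume "\<delta> > 0"
  have "uniformly_continuous_on X (\<tau> m)"
    by (rule compact_uniformly_continuous[OF continuous_on_subset[OF continuous_on_\<tau> X_W] compact_X])
  then obtain \<eta> where \<eta>: "\<eta> > 0" "\<And>a b. a \<in> X \<Longrightarrow> b \<in> X \<Longrightarrow> dist a b < \<eta> \<Longrightarrow> dist (\<tau> m a) (\<tau> m b) < \<delta>"
    using \<open>\<delta> > 0\<close> unfolding uniformly_continuous_on_def by (metis dist_commute)
  obtain x' y' n where 2: "x' \<in> X" "y' \<in> X" "dist x x' < \<eta>" "dist y y' < \<eta>"
     "\<forall>e\<in>vertices k - {zero_vertex k}. dist (\<tau> (vdot k n e) x') (\<tau> (vdot k n e) y') < \<eta>"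
    using assms \<eta>(1) unfolding R_def by blast
  have "dist (\<tau> (vdot k n e) (\<tau> m x')) (\<tau> (vdot k n e) (\<tau> m y')) < \<delta>"
    if "e \<in> vertices k - {zero_vertex k}" for e
    using \<eta>(2)[of "\<tau> (vdot k n e) x'" "\<tau> (vdot k n e) y'"] 2 that X_\<tau>
    by (simp add: \<tau>_add add.commute)
  then show "\<exists>x'\<in>X. \<exists>y'\<in>X. \<exists>n. dist (\<tau> m x) x' < \<delta> \<and> dist (\<tau> m y) y' < \<delta> \<and>
     (\<forall>e\<in>vertices k - {zero_vertex k}. dist (\<tau> (vdot k n e) x') (\<tau> (vdot k n e) y') < \<delta>)"
    using \<eta>(2) 2 X_\<tau> assms by (intro bexI[of _ "\<tau> m x'"] bexI[of _ "\<tau> m y'"] exI[of _ n]) (auto simp: R_def)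
qed (use assms in \<open>auto simp: R_def\<close>)

lemma R_E: assumes "p \<in> E" "R x y" shows "R (p x) (p y)"
proof (rule R_limit)
  fix \<delta> :: real assume "\<delta> > 0"
  let ?U = "{q. dist (p x) (q x) < \<delta>} \<inter> {q. dist (p y) (q y) < \<delta>}"
  have "open ?U" by (intro open_Int open_Collect_less continuous_intros)
  moreover have "p \<in> ?U" using \<open>\<delta> > 0\<close> by simp
  ultimately obtain n where "\<tau> n \<in> ?U" using E_meets_open[OF assms(1)] by metis
  then show "\<exists>x' y'. R x' y' \<and> dist (p x) x' < \<delta> \<and> dist (p y) y' < \<delta>"
    using R_\<tau>[OF assms(2), of n] by blast
qed (use assms E_X R_X in auto)

text \<open>The vertex \<open>(0, \<dots>, 0, 1)\<close>, which differs from the zero vertex in the last coordinate.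
That coordinate splits a cube of dimension \<open>k + 1\<close> into two cubes of dimension
\<open>k\<close>.\<close>

definition e1 :: "nat \<Rightarrow> int" where "e1 = (zero_vertex d)(d := 1)"

lemma d_pos: "d \<in> {1..d}" using d_Suc by simp

lemma vertex_upd: "e \<in> vertices d \<Longrightarrow> a \<in> {0, 1} \<Longrightarrow> e(d := a) \<in> vertices d"
  using d_pos by (auto simp: vertices_def PiE_def Pi_def extensional_def)

lemma e1_in: "e1 \<in> vertices d" unfolding e1_def by (rule vertex_upd[OF zero_vertex_in]) simp

lemma e1_d: "e1 d = 1" by (simp add: e1_def)

lemma zero_d: "zero_vertex d d = 0" using d_pos by (simp add: zero_vertex_def)

lemma vdot_upd: "vdot d n (e(d := a)) = vdot k n e + n d * a"
  unfolding vdot_def d_Suc by (simp add: sum.cl_ivl_Suc)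

lemma vdot_split: "vdot d n e = vdot k n e + n d * e d"
  unfolding vdot_def d_Suc by (simp add: sum.cl_ivl_Suc)

lemma vdot_restrict: "vdot k n (restrict e {1..k}) = vdot k n e"
  unfolding vdot_def by (intro sum.cong) auto

lemma vdot_cong_k: "vdot k (n(d := a)) e = vdot k n e"
  unfolding vdot_def using d_Suc by (intro sum.cong) auto

lemma vdot_k_upd: "vdot k n (e(d := a)) = vdot k n e"
  unfolding vdot_def using d_Suc by (intro sum.cong) auto

lemma vdot_k_zero: "vdot k n (zero_vertex d) = 0"
  unfolding vdot_def using d_Suc by (intro sum.neutral) (auto simp: zero_vertex_def)

lemma vdot_e1: "vdot k n e1 = 0" "vdot d n e1 = n d"
  by (simp_all add: vdot_split e1_d) (simp_all add: e1_def vdot_k_upd vdot_k_zero)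

lemma restrict_vertex:
  assumes "e \<in> vertices d" shows "restrict e {1..k} \<in> vertices k"
  using assms d_Suc by (auto simp: vertices_def PiE_def Pi_def)

lemma restrict_nonzero:
  assumes "e \<in> vertices d" "e d = 0" "e \<noteq> zero_vertex d"
  shows "restrict e {1..k} \<noteq> zero_vertex k"
proof
  assume *: "restrict e {1..k} = zero_vertex k"
  have "e = zero_vertex d"
  proof
    fix i
    consider "i \<in> {1..k}" | "i = d" | "i \<notin> {1..d}" using d_Suc by force
    then show "e i = zero_vertex d i"
    proof cases
      case 1 then show ?thesis using fun_cong[OF *, of i] d_Suc by (simp add: zero_vertex_def)
    next
      case 2 then show ?thesis using assms(2) zero_d by simp
    next
      case 3 then show ?thesis using assms(1) PiE_arb[of e "{1..d}" "\<lambda>_. {0,1}" i]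
        by (auto simp: zero_vertex_def vertices_def)
    qed
  qed
  then show False using assms(3) by simp
qed

lemma lift_vertex:
  assumes "e \<in> vertices k" "a \<in> {0, 1}" shows "e(d := a) \<in> vertices d"
  using assms d_Suc by (auto simp: vertices_def PiE_def Pi_def extensional_def le_Suc_eq)

lemma lift_nonzero:
  assumes "e \<in> vertices k" "e \<noteq> zero_vertex k" shows "e(d := a) \<noteq> zero_vertex d"
proof
  assume *: "e(d := a) = zero_vertex d"
  have "e = zero_vertex k"
  proof
    fix i show "e i = zero_vertex k i"
    proof (cases "i \<in> {1..k}")
      case True then show ?thesis using fun_cong[OF *, of i] d_Suc by (simp add: zero_vertex_def)
    next
      case False then show ?thesis using assms(1) PiE_arb[of e "{1..k}" "\<lambda>_. {0,1}" i]
        by (auto simp: zero_vertex_def vertices_def)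
    qed
  qed
  then show False using assms(2) by simp
qed

text \<open>The definition of regional proximality says that the two faces \<open>(T\<^sup>n\<^sup>\<cdot>\<^sup>e x')\<close>
and \<open>(T\<^sup>n\<^sup>\<cdot>\<^sup>e y')\<close> of a cube nearly agree except at their first vertices;
a cluster point of such cubes has two faces that agree there exactly.\<close>

lemma R_imp_face_cube:
  assumes "R x y"
  obtains z where "cube x0 z" "z (zero_vertex d) = x" "z e1 = y"
    "\<And>e. e \<in> vertices d \<Longrightarrow> e d = 1 \<Longrightarrow> e \<noteq> e1 \<Longrightarrow> z e = z (e(d := 0))"
proof -
  have "\<exists>p. p \<in> \<Gamma> \<and> dist x (p (zero_vertex d) x0) < inverse (real (Suc j)) \<and>
      dist y (p e1 x0) < inverse (real (Suc j)) \<and>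
      (\<forall>e\<in>vertices d. e d = 1 \<longrightarrow> e \<noteq> e1 \<longrightarrow> dist (p e x0) (p (e(d := 0)) x0) < inverse (real (Suc j)))" for j
  proof -
    let ?\<delta> = "inverse (real (Suc j))"
    have "?\<delta> > 0" by simp
    then obtain x' y' n where 2: "x' \<in> X" "y' \<in> X" "dist x x' < ?\<delta>" "dist y y' < ?\<delta>"
       "\<And>e. e\<in>vertices k \<Longrightarrow> e \<noteq> zero_vertex k \<Longrightarrow> dist (\<tau> (vdot k n e) x') (\<tau> (vdot k n e) y') < ?\<delta>"
      using assms unfolding R_def by blast
    obtain r1 r2 where r: "r1 \<in> E" "r1 x0 = x'" "r2 \<in> E" "r2 x0 = y'"
      using X_orbit[OF x0_X] 2(1,2) by metis
    \<comment> \<open>This cube element carries x0 to x' on the lower face and to y' on the upper face, both moved by n.\<close>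
    define p where "p = \<gamma> 0 (n(d := 0)) \<star> ((\<lambda>e. if e \<in> vertices d \<and> e d = 0 then r1 else id) \<star>
      (\<lambda>e. if e \<in> vertices d \<and> e d = 1 then r2 else id))"
    have p: "p \<in> \<Gamma>" unfolding p_def
      by (intro \<Gamma>_mult \<gamma>_in_\<Gamma> lower_face_in_\<Gamma> upper_face_in_\<Gamma> r d_pos)
    have p0: "p e x0 = \<tau> (vdot k n e) x'" if "e \<in> vertices d" "e d = 0" for e
      using that r by (simp add: p_def \<gamma>_def vdot_split vdot_cong_k)
    have p1: "p e x0 = \<tau> (vdot k n e) y'" if "e \<in> vertices d" "e d = 1" for e
      using that r by (simp add: p_def \<gamma>_def vdot_split vdot_cong_k)
    have "dist x (p (zero_vertex d) x0) < ?\<delta>"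
      using 2(3) p0[OF zero_vertex_in zero_d] by (simp add: vdot_k_zero)
    moreover have "dist y (p e1 x0) < ?\<delta>"
      using 2(4) p1[OF e1_in e1_d] by (simp add: vdot_e1)
    moreover have "dist (p e x0) (p (e(d := 0)) x0) < ?\<delta>"
      if e: "e \<in> vertices d" "e d = 1" "e \<noteq> e1" for e
    proof -
      let ?e = "e(d := 0)"
      have e': "?e \<in> vertices d" "?e d = 0" using vertex_upd[OF e(1)] by auto
      have nz: "?e \<noteq> zero_vertex d"
      proof
        assume "?e = zero_vertex d"
        then have "e = (zero_vertex d)(d := 1)" using e(2) by (metis fun_upd_triv fun_upd_upd)
        then show False using e(3) by (simp add: e1_def)
      qed
      have "dist (\<tau> (vdot k n ?e) x') (\<tau> (vdot k n ?e) y') < ?\<delta>"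
        using 2(5)[OF restrict_vertex[OF e'(1)] restrict_nonzero[OF e' nz]] by (simp only: vdot_restrict)
      then show ?thesis unfolding p0[OF e'] p1[OF e(1,2)] by (simp add: vdot_k_upd dist_commute)
    qed
    ultimately show ?thesis using p by blast
  qed
  then obtain p where p: "\<And>j. p j \<in> \<Gamma>" "\<And>j. dist x (p j (zero_vertex d) x0) < inverse (real (Suc j))"
    "\<And>j. dist y (p j e1 x0) < inverse (real (Suc j))"
    "\<And>j e. e\<in>vertices d \<Longrightarrow> e d = 1 \<Longrightarrow> e \<noteq> e1 \<Longrightarrow> dist (p j e x0) (p j (e(d := 0)) x0) < inverse (real (Suc j))"
    by metis
  obtain q F where q: "q \<in> \<Gamma>" "F \<noteq> bot" "F \<le> sequentially" "\<And>e f. ((\<lambda>k. p k e f) \<longlongrightarrow> q e f) F"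
    using \<Gamma>_cluster[of p] p(1) by metis
  have lim: "a = b" if "(f \<longlongrightarrow> a) F" "(g \<longlongrightarrow> b) F" "\<And>j. dist (f j) (g j) < inverse (real (Suc j))" for f g :: "nat \<Rightarrow> hc" and a b
  proof -
    have "((\<lambda>j. dist (f j) (g j)) \<longlongrightarrow> dist a b) F" by (intro tendsto_intros that)
    moreover have "(\<lambda>j. dist (f j) (g j)) \<longlonglongrightarrow> 0"
      by (rule metric_tendsto_imp_tendsto[OF LIMSEQ_inverse_real_of_nat])
        (use that(3) in \<open>auto intro!: always_eventually less_imp_le\<close>)
    then have "((\<lambda>j. dist (f j) (g j)) \<longlongrightarrow> 0) F" using q(3) by (rule tendsto_mono[rotated])
    ultimately have "dist a b = 0" using tendsto_unique[OF q(2)] by blast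
    then show ?thesis by simp
  qed
  show ?thesis
  proof (rule that[of "\<lambda>e. q e x0"])
    show "cube x0 (\<lambda>e. q e x0)" using q(1) by (auto simp: cube_def)
    show "q (zero_vertex d) x0 = x" using lim[OF tendsto_const q(4) p(2)] by simp
    show "q e1 x0 = y" using lim[OF tendsto_const q(4) p(3)] by simp
    show "q e x0 = q (e(d := 0)) x0" if "e \<in> vertices d" "e d = 1" "e \<noteq> e1" for e
      using lim[OF q(4) q(4) p(4)[OF that]] by simp
  qed
qed

text \<open>The converse reading: in a cube near \<open>z\<close>, the lower and the upper face start near
\<open>x\<close> and \<open>y\<close>, and at the other vertices both are near \<open>y\<close>.\<close>

lemma cube_imp_R:
  assumes z: "cube x0 z" "z (zero_vertex d) = x" "\<And>e. e \<in> vertices d \<Longrightarrow> e \<noteq> zero_vertex d \<Longrightarrow> z e = y"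
  shows "R x y"
  unfolding R_def
proof (intro conjI allI impI)
  obtain p where p: "p \<in> \<Gamma>" "\<And>e. e \<in> vertices d \<Longrightarrow> z e = p e x0" using z(1) by (auto simp: cube_def)
  have zX: "z e \<in> X" if "e \<in> vertices d" for e
    using p(2)[OF that] E_X[OF \<Gamma>_coord[OF p(1)] x0_X] by simp
  have e1z: "e1 \<noteq> zero_vertex d" using e1_d zero_d by auto
  show "x \<in> X" using zX[OF zero_vertex_in] z(2) by simp
  show "y \<in> X" using zX[OF e1_in] z(3)[OF e1_in e1z] by simp
  fix \<delta> :: real assume "\<delta> > 0"
  let ?U = "\<Inter>e\<in>vertices d. {q. dist (q e x0) (z e) < \<delta> / 2}"
  have oU: "open ?U"
    by (intro open_INT ballI finite_vertices open_Collect_less continuous_on_dist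
      continuous_on_eval2 continuous_on_const)
  have pU: "p \<in> ?U" using \<open>\<delta> > 0\<close> p(2) by simp
  obtain m n where mn: "\<gamma> m n \<in> ?U" by (rule \<Gamma>_meets_open[OF p(1) oU pU])
  have g: "dist (\<tau> (m + vdot d n e) x0) (z e) < \<delta> / 2" if "e \<in> vertices d" for e
    using INT_D[OF mn that] that by (simp add: \<gamma>_def)
  have "dist x (\<tau> m x0) < \<delta>" using g[OF zero_vertex_in] z(2) \<open>\<delta> > 0\<close> by (simp add: dist_commute)
  moreover have "dist y (\<tau> (m + n d) x0) < \<delta>"
    using vdot_e1 g[OF e1_in] z(3)[OF e1_in e1z] \<open>\<delta> > 0\<close> by (simp add: dist_commute)
  moreover have "dist (\<tau> (vdot k n e) (\<tau> m x0)) (\<tau> (vdot k n e) (\<tau> (m + n d) x0)) < \<delta>"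
    if e: "e \<in> vertices k - {zero_vertex k}" for e
  proof -
    have e': "e \<in> vertices k" "e \<noteq> zero_vertex k" using e by auto
    have l: "e(d := 0) \<in> vertices d" "e(d := 1) \<in> vertices d" using lift_vertex[OF e'(1)] by auto
    have "dist (\<tau> (vdot k n e) (\<tau> m x0)) y < \<delta> / 2"
      using g[OF l(1)] z(3)[OF l(1) lift_nonzero[OF e']] by (simp add: vdot_upd \<tau>_add add.commute)
    moreover have "dist (\<tau> (vdot k n e) (\<tau> (m + n d) x0)) y < \<delta> / 2"
      using g[OF l(2)] z(3)[OF l(2) lift_nonzero[OF e']] by (simp add: vdot_upd \<tau>_add ac_simps)
    ultimately show ?thesis by (rule dist_triangle_half_l)
  qed
  ultimately show "\<exists>x'\<in>X. \<exists>y'\<in>X. \<exists>n. dist x x' < \<delta> \<and> dist y y' < \<delta> \<and>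
     (\<forall>e\<in>vertices k - {zero_vertex k}. dist (\<tau> (vdot k n e) x') (\<tau> (vdot k n e) y') < \<delta>)"
    using X_\<tau>[OF x0_X] by blast
qed

text \<open>Take the cube of \<open>R_imp_face_cube\<close>, with all coordinates made \<open>u\<close>-fixed. Its lower
face is itself a cube point, so by \<open>cube_inverse\<close> some element brings that face back to the
constant \<open>x0\<close>. The same element applied to both faces makes all coordinates equal to
\<open>x0\<close> except the one at \<open>e1\<close>. A diagonal element finally carries the pair that is
left over back to \<open>(x, x')\<close>.\<close>

lemma cube_single_e1:
  assumes R: "R x x'" and fixd: "u x = x" "u x' = x'"
  shows "cube x0 (\<lambda>e. if e = e1 then x' else x)"
proof -
  obtain z0 where z0: "cube x0 z0" "z0 (zero_vertex d) = x" "z0 e1 = x'"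
    "\<And>e. e \<in> vertices d \<Longrightarrow> e d = 1 \<Longrightarrow> e \<noteq> e1 \<Longrightarrow> z0 e = z0 (e(d := 0))"
    using R_imp_face_cube[OF R] by metis
  define z where "z e = u (z0 e)" for e
  have "cube x0 (\<lambda>e. diag u e (z0 e))" by (rule cube_mult[OF diag_in_\<Gamma>[OF u_E] z0(1)])
  then have "cube x0 z" by (rule cube_cong) (simp add: diag_def z_def)
  then obtain q where q: "q \<in> \<Gamma>" "\<And>e. e \<in> vertices d \<Longrightarrow> z e = q e x0" by (auto simp: cube_def)
  have zs: "z (zero_vertex d) = x" "z e1 = x'"
    "\<And>e. e \<in> vertices d \<Longrightarrow> e d = 1 \<Longrightarrow> e \<noteq> e1 \<Longrightarrow> z e = z (e(d := 0))"
    using z0 fixd by (auto simp: z_def)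
  obtain p where p: "p \<in> \<Gamma>" "\<And>e f. e \<in> vertices d \<Longrightarrow> u (p e (q e (u f))) = u f"
    using cube_inverse[OF q(1)] by metis
  \<comment> \<open>The action of p on the lower face, copied to the upper face.\<close>
  define p' where "p' = (\<lambda>e. if e \<in> vertices d then p (e(d := 0)) else id)"
  have "p' \<in> \<Gamma>" unfolding p'_def
  proof (rule \<Gamma>_reindex[OF p(1)])
    fix m n
    show "\<exists>m' n'. \<forall>e\<in>vertices d. e(d := 0) \<in> vertices d \<and> m + vdot d n (e(d := 0)) = m' + vdot d n' e"
      by (rule exI[of _ m], rule exI[of _ "n(d := 0)"])
        (simp add: vertex_upd vdot_upd vdot_split[of "n(d := 0)"] vdot_cong_k)
  qed
  have low: "u (p e (z e)) = x0" if "e \<in> vertices d" for e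
    using p(2)[OF that, of x0] q(2)[OF that] u_x0 by simp
  define r where "r = u \<circ> p (zero_vertex d)"
  have rE: "r \<in> E" unfolding r_def by (intro E_mult u_E \<Gamma>_coord p)
  have rx: "r x = x0" using low[OF zero_vertex_in] zs(1) by (simp add: r_def)
  have "cube x0 (\<lambda>e. (diag u \<star> p') e (z e))"
    by (rule cube_mult[OF \<Gamma>_mult[OF diag_in_\<Gamma>[OF u_E] \<open>p' \<in> \<Gamma>\<close>] \<open>cube x0 z\<close>])
  then have c1: "cube x0 (\<lambda>e. if e = e1 then r x' else x0)"
  proof (rule cube_cong)
    fix e assume e: "e \<in> vertices d"
    have eq: "(diag u \<star> p') e (z e) = u (p (e(d := 0)) (z e))" using e by (simp add: diag_def p'_def)
    consider "e = e1" | "e d = 0" | "e d = 1" "e \<noteq> e1" using vertex_01[OF e d_pos] by blast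
    then show "(diag u \<star> p') e (z e) = (if e = e1 then r x' else x0)"
    proof cases
      case 1
      have "e1(d := 0) = zero_vertex d" using zero_d by (metis e1_def fun_upd_triv fun_upd_upd)
      then show ?thesis using 1 eq zs(2) by (simp add: r_def)
    next
      case 2
      then have "e(d := 0) = e" "e \<noteq> e1" using e1_d by (auto simp: fun_upd_idem)
      then show ?thesis using eq low[OF e] by simp
    next
      case 3
      then show ?thesis using eq low[OF vertex_upd[OF e, of 0]] zs(3)[OF e] by simp
    qed
  qed
  obtain q2 where q2: "q2 \<in> E" "\<And>f. u (q2 (r (u f))) = u f" using E_inverse[OF rE] by metis
  have "cube x0 (\<lambda>e. diag (u \<circ> q2) e (if e = e1 then r x' else x0))"
    by (rule cube_mult[OF diag_in_\<Gamma>[OF E_mult[OF u_E q2(1)]] c1])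
  then show ?thesis
  proof (rule cube_cong)
    fix e assume e: "e \<in> vertices d"
    show "diag (u \<circ> q2) e (if e = e1 then r x' else x0) = (if e = e1 then x' else x)"
      using e q2(2)[of x] q2(2)[of x'] fixd rx by (simp add: diag_def)
  qed
qed

text \<open>Reflections in the coordinate directions in which \<open>c\<close> and \<open>e0\<close> differ preserve
cubes and carry \<open>c\<close> to \<open>e0\<close>.\<close>

lemma cube_move_vertex:
  assumes c: "cube f (\<lambda>e. if e = c then a else b)" and "c \<in> vertices d" and e0: "e0 \<in> vertices d"
  shows "cube f (\<lambda>e. if e = e0 then a else b)"
proof -
  define \<phi> where "\<phi> e = (\<lambda>i\<in>{1..d}. if e0 i = c i then e i else 1 - e i)" for e :: "nat \<Rightarrow> int"
  have \<phi>: "\<phi> e \<in> vertices d" if "e \<in> vertices d" for e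
    using vertex_01[OF that] by (fastforce simp: \<phi>_def vertices_def)
  have \<phi>c: "\<phi> e = c \<longleftrightarrow> e = e0" if e: "e \<in> vertices d" for e
  proof -
    have "\<phi> e = c \<longleftrightarrow> (\<forall>i\<in>{1..d}. \<phi> e i = c i)"
      using \<phi>[OF e] assms(2) unfolding vertices_def by (metis PiE_ext)
    also have "\<dots> \<longleftrightarrow> (\<forall>i\<in>{1..d}. e i = e0 i)"
    proof (intro ball_cong refl)
      fix i assume i: "i \<in> {1..d}"
      show "\<phi> e i = c i \<longleftrightarrow> e i = e0 i"
        using vertex_01[OF e i] vertex_01[OF e0 i] vertex_01[OF assms(2) i] i by (auto simp: \<phi>_def)
    qed
    also have "\<dots> \<longleftrightarrow> e = e0"
      using e e0 unfolding vertices_def by (metis PiE_ext)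
    finally show ?thesis .
  qed
  obtain p where p: "p \<in> \<Gamma>" "\<And>e. e \<in> vertices d \<Longrightarrow> (if e = c then a else b) = p e f"
    using c by (auto simp: cube_def)
  have "(\<lambda>e. if e \<in> vertices d then p (\<phi> e) else id) \<in> \<Gamma>"
  proof (rule \<Gamma>_reindex[OF p(1)])
    fix m n
    have "m + vdot d n (\<phi> e) = (m + (\<Sum>i=1..d. if e0 i = c i then 0 else n i)) +
        vdot d (\<lambda>i. if e0 i = c i then n i else - n i) e" for e
      unfolding vdot_def by (simp add: sum.distrib[symmetric] \<phi>_def)
        (rule sum.cong, auto simp: algebra_simps)
    then show "\<exists>m' n'. \<forall>e\<in>vertices d. \<phi> e \<in> vertices d \<and> m + vdot d n (\<phi> e) = m' + vdot d n' e"
      using \<phi> by blast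
  qed
  then show ?thesis
    unfolding cube_def by (rule bexI[rotated]) (use p(2)[OF \<phi>] \<phi>c in auto)
qed

text \<open>A coordinate of a \<open>u\<close>-fixed cube may be replaced by any related \<open>u\<close>-fixed point:
the cube is carried to the constant cube \<open>x0\<close> by an invertible element, where the claim
is \<open>cube_single_e1\<close>, and back again.\<close>

lemma cube_change_coordinate:
  assumes z: "cube x0 z" "\<And>e. e \<in> vertices d \<Longrightarrow> u (z e) = z e"
    and e0: "e0 \<in> vertices d" and R: "R (z e0) x'" and fixd: "u x' = x'"
  shows "cube x0 (z(e0 := x'))"
proof -
  obtain q where q: "q \<in> \<Gamma>" "\<And>e. e \<in> vertices d \<Longrightarrow> z e = q e x0" using z(1) by (auto simp: cube_def)
  define a where "a = diag u \<star> (q \<star> diag u)"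
  have a: "a \<in> \<Gamma>" unfolding a_def by (intro \<Gamma>_mult q diag_in_\<Gamma> u_E)
  have ae: "a e f = u (q e (u f))" if "e \<in> vertices d" for e f using that by (simp add: a_def diag_def)
  have az: "a e x0 = z e" if "e \<in> vertices d" for e
    using ae[OF that] u_x0 q(2)[OF that] z(2)[OF that] by simp
  obtain b where b: "b \<in> \<Gamma>" "\<And>e f. e \<in> vertices d \<Longrightarrow> u (b e (u f)) = b e f"
    "\<And>e f. e \<in> vertices d \<Longrightarrow> b e (a e f) = u f" "\<And>e f. e \<in> vertices d \<Longrightarrow> a e (b e f) = u f"
    by (rule cube_group[OF a]) (use ae in auto)
  \<comment> \<open>The inverse b carries the cube z to the constant x0 and the new coordinate x' to b e0 x'.\<close>
  let ?y = "b e0 x'"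
  have "R x0 ?y" using R_E[OF \<Gamma>_coord[OF b(1)] R] b(3)[OF e0, of x0] az[OF e0] u_x0 by metis
  moreover have "u ?y = ?y" using b(2)[OF e0] u_u by metis
  ultimately have "cube x0 (\<lambda>e. if e = e1 then ?y else x0)" using cube_single_e1 u_x0 by blast
  then have "cube x0 (\<lambda>e. if e = e0 then ?y else x0)" by (rule cube_move_vertex[OF _ e1_in e0])
  then have "cube x0 (\<lambda>e. a e (if e = e0 then ?y else x0))" by (rule cube_mult[OF a])
  then show ?thesis
    by (rule cube_cong) (use az b(4)[OF e0] fixd in auto)
qed

lemma cube_const: assumes "x \<in> X" shows "cube x0 (\<lambda>_. x)"
proof -
  obtain r where "r \<in> E" "r x0 = x" using X_orbit[OF x0_X assms] by metis
  then show ?thesis unfolding cube_def by (intro bexI[OF _ diag_in_\<Gamma>]) (auto simp: diag_def)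
qed

text \<open>The key description of cubes: \<open>u\<close>-fixed points that are related to one common point can be
placed at the vertices in any way, changing one coordinate of a constant cube at a time. Each change
replaces \<open>x\<close> itself, so each step uses a given relation; transitivity of \<open>R\<close> is a
consequence (\<open>R_trans\<close>).\<close>

lemma cube_of_related:
  assumes x: "u x = x" "x \<in> X" and z: "\<And>e. e \<in> vertices d \<Longrightarrow> R x (z e)" "\<And>e. e \<in> vertices d \<Longrightarrow> u (z e) = z e"
  shows "cube x0 z"
proof -
  have "S \<subseteq> vertices d \<Longrightarrow> cube x0 (\<lambda>e. if e \<in> S then z e else x)" if "finite S" for S
    using that
  proof (induction S rule: finite_induct)
    case empty
    show ?case using cube_const[OF x(2)] by simp
  next
    case (insert c S)
    have "cube x0 ((\<lambda>e. if e \<in> S then z e else x)(c := z c))"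
      by (rule cube_change_coordinate) (use insert x z in auto)
    then show ?case by (rule cube_cong) auto
  qed
  from this[OF finite_vertices order.refl] show ?thesis by (rule cube_cong) auto
qed

text \<open>After applying \<open>u\<close>, the three points may be placed on a cube with \<open>u x\<close> at the zero
vertex and \<open>u w\<close> elsewhere. The idempotent fixing \<open>x\<close> restores \<open>x\<close>, and the
idempotent fixing \<open>w\<close>, acting on the nonzero vertices only, restores \<open>w\<close>.\<close>

lemma R_trans: assumes "R x y" "R y w" shows "R x w"
proof -
  have X: "x \<in> X" "y \<in> X" "w \<in> X" using assms R_X by blast+
  let ?z = "\<lambda>e. if e = zero_vertex d then u x else u w"
  have c: "cube x0 ?z"
  proof (rule cube_of_related[of "u y"])
    show "R (u y) (?z e)" for e using R_E[OF u_E assms(2)] R_sym[OF R_E[OF u_E assms(1)]] by simp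
  qed (use E_X[OF u_E X(2)] in auto)
  obtain v where v: "v \<in> E" "v \<circ> v = v" "v \<circ> u = v" "u \<circ> v = u" "v x = x" using fixing_idempotent[OF X(1)] .
  obtain v' where v': "v' \<in> E" "v' \<circ> v' = v'" "v' \<circ> u = v'" "u \<circ> v' = u" "v' w = w" using fixing_idempotent[OF X(3)] .
  have "v' \<circ> v = v'" using v'(3) v(4) by (metis comp_assoc)
  then have v'vu: "v' (v (u w)) = w" using v'(3,5) v(3) by (metis comp_apply)
  have vu: "v (u x) = x" using v(3,5) by (metis comp_apply)
  let ?q = "\<lambda>e. if e \<in> vertices d \<and> e \<noteq> zero_vertex d then v' else id"
  have "cube x0 (\<lambda>e. ?q e (diag v e (?z e)))"
    by (rule cube_mult[OF punctured_idempotent_in_\<Gamma>[OF v'(1,2)] cube_mult[OF diag_in_\<Gamma>[OF v(1)] c]])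
  then show ?thesis
    by (rule cube_imp_R) (use vu v'vu zero_vertex_in in \<open>auto simp: diag_def\<close>)
qed

end

section \<open>A quasifactor over the pro-nilfactor\<close>

lemma dist_hc_terms_summable:
  "summable (\<lambda>n. (1/2)^n * min (dist (f (from_nat n)) (g (from_nat n))) 1 :: real)"
  by (rule summable_comparison_test'[of "\<lambda>n. (1/2)^n"]) (auto simp: summable_geometric_iff)

text \<open>Terms of the series defining the metric of \<open>hc\<close> for two interleaved sequences are terms of
one of the two original series.\<close>

lemma dist_if_le:
  fixes f g f' g' :: hc
  shows "dist (\<lambda>j. if t j then f j else g j) (\<lambda>j. if t j then f' j else g' j) \<le> dist f f' + dist g g'"
proof -
  have "dist (\<lambda>j. if t j then f j else g j) (\<lambda>j. if t j then f' j else g' j) \<le>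
    (\<Sum>n. (1/2)^n * min (dist (f (from_nat n)) (f' (from_nat n))) 1 + (1/2)^n * min (dist (g (from_nat n)) (g' (from_nat n))) 1)"
    unfolding dist_fun_def
    by (intro suminf_le summable_add dist_hc_terms_summable) auto
  also have "\<dots> = dist f f' + dist g g'"
    unfolding dist_fun_def by (intro suminf_add[symmetric] dist_hc_terms_summable)
  finally show ?thesis .
qed

text \<open>Two further properties of the realisation of \<open>X\<close> in \<open>W\<close>. First, small values of a
single coordinate localise a point (assumption \<open>peak\<close>); this holds when coordinates are
distances to the points of a dense sequence. Secondly, indices carry a Boolean tag that the action
preserves and points of \<open>X\<close> ignore, so that a pair of tag-independent sequences can be stored
in one sequence; \<open>lm\<close> and \<open>rm\<close> read off the two members of the pair.\<close>

locale tagged_minimal_shift = minimal_shift +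
  fixes tag :: "nat \<Rightarrow> bool" and lm rm :: "nat \<Rightarrow> nat"
  assumes peak: "\<And>x \<delta>. x \<in> X \<Longrightarrow> \<delta> > 0 \<Longrightarrow> \<exists>K \<eta>. x K < \<eta> \<and> (\<forall>y\<in>X. y K < \<eta> \<longrightarrow> dist x y < \<delta>)"
    and tag_s: "\<And>n j. tag (s n j) = tag j"
    and rm_s: "\<And>n. s n \<circ> rm = rm \<circ> s n"
    and tag_lm: "\<And>j. tag (lm j)" and tag_rm: "\<And>j. \<not> tag (rm j)"
    and X_lm: "\<And>f. f \<in> X \<Longrightarrow> f \<circ> lm = f" and X_rm: "\<And>f. f \<in> X \<Longrightarrow> f \<circ> rm = f"
begin

text \<open>\<open>D\<close> consists of the \<open>u\<close>-fixed points in the class of \<open>x0\<close>. A set of points is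
represented by the pointwise infimum of its elements: when the coordinates of a point \<open>w\<close>
are its distances to a dense sequence and the same distances along its orbit, the infimum records
the distance functions of the set and of its translates, so it determines the closure of the set,
and convergence of infima is convergence of sets in the hyperspace. Thus \<open>\<psi>\<close> stands for
\<open>D\<close>, and \<open>\<psi>0 = u \<psi>\<close> stands for the set \<open>u \<circ> D\<close> of the circle
operation. A point \<open>x\<close> belongs to the set represented by \<open>f\<close> when
\<open>f \<le> x\<close> pointwise.\<close>

definition D :: "hc set" where "D = {w \<in> X. u w = w \<and> R x0 w}"

definition \<psi> :: hc where "\<psi> = (\<lambda>j. INF w\<in>D. w j)"

definition \<psi>0 :: hc where "\<psi>0 = u \<psi>"

definition mix :: "hc \<Rightarrow> hc \<Rightarrow> hc" where "mix f g = (\<lambda>j. if tag j then f j else g j)"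

definition \<xi>0 :: hc where "\<xi>0 = mix x0 \<psi>0"

lemma x0_D: "x0 \<in> D" using x0_X u_x0 R_refl by (simp add: D_def)

lemma D_X: "w \<in> D \<Longrightarrow> w \<in> X" by (simp add: D_def)

lemma D_W: "w \<in> D \<Longrightarrow> w \<in> W" using D_X X_W by blast

lemma D_bdd: "bdd_below ((\<lambda>w. w j) ` D)"
  by (rule bdd_belowI[of _ 0]) (use D_W in \<open>auto simp: W_def\<close>)

lemma \<psi>_le: "w \<in> D \<Longrightarrow> \<psi> \<le> w"
  unfolding \<psi>_def by (intro le_funI cINF_lower D_bdd)

lemma \<psi>_greatest: "(\<And>w. w \<in> D \<Longrightarrow> f \<le> w) \<Longrightarrow> f \<le> \<psi>"
  unfolding \<psi>_def by (intro le_funI cINF_greatest) (use x0_D in \<open>auto dest: le_funD\<close>)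

lemma \<psi>_W: "\<psi> \<in> W"
proof -
  have "(\<lambda>_. 0) \<le> \<psi>" by (rule \<psi>_greatest) (use D_W in \<open>auto simp: W_def le_fun_def\<close>)
  moreover have "\<psi> \<le> x0" by (rule \<psi>_le[OF x0_D])
  ultimately show ?thesis using D_W[OF x0_D] unfolding W_def le_fun_def by (auto intro: order_trans)
qed

lemma \<psi>0_W: "\<psi>0 \<in> W" unfolding \<psi>0_def by (rule E_W[OF u_E \<psi>_W])

lemma u_\<psi>0: "u \<psi>0 = \<psi>0" by (simp add: \<psi>0_def)

lemma \<psi>0_le: "\<psi>0 \<le> x0"
  using E_mono[OF u_E \<psi>_W D_W[OF x0_D] \<psi>_le[OF x0_D]] u_x0 by (simp add: \<psi>0_def)

text \<open>The group of all \<open>a = u a u\<close> that keep \<open>x0\<close> in its class permutes \<open>D\<close>. Since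
the elements of \<open>E\<close> are monotone, \<open>a \<psi>\<close> lies below every
\<open>a (a\<^sup>-\<^sup>1 w) = w\<close> with \<open>w \<in> D\<close>, hence below \<open>\<psi>\<close>; so
\<open>a \<psi>0 \<le> \<psi>0\<close>, and the same for the inverse of \<open>a\<close> gives equality.\<close>

lemma stabilizer_fixes_\<psi>0:
  assumes a: "a \<in> E" "\<And>f. u (a (u f)) = a f" and R: "R x0 (a x0)"
  shows "a \<psi>0 = \<psi>0"
proof -
  obtain b where b: "b \<in> E" "\<And>f. u (b (u f)) = b f" "\<And>f. b (a f) = u f" "\<And>f. a (b f) = u f"
    using E_group[OF a] by metis
  \<comment> \<open>Stated for a pair of mutually inverse elements, so that it applies both to a and to its inverse.\<close>
  have le: "c \<psi>0 \<le> \<psi>0"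
    if c: "c \<in> E" "\<And>f. u (c (u f)) = c f" and c': "c' \<in> E" "\<And>f. u (c' (u f)) = c' f" "\<And>f. c (c' f) = u f"
      and Rc: "R x0 (c' x0)" for c c'
  proof -
    have uc: "u (c f) = c f" for f using c(2)[of f] u_u by metis
    have cu: "c (u f) = c f" for f using c(2)[of f] c(2)[of "u f"] by simp
    have uc': "u (c' f) = c' f" for f using c'(2)[of f] u_u by metis
    have "c \<psi> \<le> \<psi>"
    proof (rule \<psi>_greatest)
      fix w assume w: "w \<in> D"
      then have wX: "w \<in> X" and uw: "u w = w" and Rw: "R x0 w" by (auto simp: D_def)
      have "R x0 (c' w)" by (rule R_trans[OF Rc R_E[OF c'(1) Rw]])
      then have D: "c' w \<in> D" using E_X[OF c'(1) wX] uc' by (simp add: D_def)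
      have "c \<psi> \<le> c (c' w)" by (rule E_mono[OF c(1) \<psi>_W D_W[OF D] \<psi>_le[OF D]])
      then show "c \<psi> \<le> w" using c'(3) uw by simp
    qed
    then have "u (c \<psi>) \<le> u \<psi>" by (rule E_mono[OF u_E E_W[OF c(1) \<psi>_W] \<psi>_W])
    then show ?thesis using uc cu by (simp add: \<psi>0_def)
  qed
  have Rb: "R x0 (b x0)"
    using R_sym[OF R_E[OF b(1) R]] b(3)[of x0] u_x0 by simp
  have 1: "a \<psi>0 \<le> \<psi>0" by (rule le[OF a b(1,2,4) Rb])
  have "b \<psi>0 \<le> \<psi>0" by (rule le[OF b(1,2) a b(3) R])
  then have "a (b \<psi>0) \<le> a \<psi>0" by (rule E_mono[OF a(1) E_W[OF b(1) \<psi>0_W] \<psi>0_W])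
  then show ?thesis using 1 b(4)[of \<psi>0] u_\<psi>0 by simp
qed

text \<open>If \<open>x e\<close> belongs to the set represented by \<open>p e \<psi>\<close> for each vertex, then each
\<open>x e\<close> is a limit of translates of points of \<open>D\<close>, and the translations can be chosen
for all vertices together, along group elements converging to \<open>p\<close>.\<close>

lemma approximation_from_D:
  assumes p: "p \<in> \<Gamma>" and x: "\<And>e. e \<in> vertices d \<Longrightarrow> x e \<in> X" "\<And>e. e \<in> vertices d \<Longrightarrow> p e \<psi> \<le> x e"
    and U: "open U" "p \<in> U" and \<delta>: "\<delta> > 0"
  obtains m n w where "\<gamma> m n \<in> U" "\<And>e. e \<in> vertices d \<Longrightarrow> w e \<in> D"
    "\<And>e. e \<in> vertices d \<Longrightarrow> dist (x e) (\<tau> (m + vdot d n e) (w e)) < \<delta>"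
proof -
  have "\<exists>K \<eta>. e \<in> vertices d \<longrightarrow> x e K < \<eta> \<and> (\<forall>y\<in>X. y K < \<eta> \<longrightarrow> dist (x e) y < \<delta>)" for e
    using peak[OF x(1) \<delta>] by blast
  then obtain K \<eta> where K: "\<And>e. e \<in> vertices d \<Longrightarrow> x e (K e) < \<eta> e"
    "\<And>e y. e \<in> vertices d \<Longrightarrow> y \<in> X \<Longrightarrow> y (K e) < \<eta> e \<Longrightarrow> dist (x e) y < \<delta>"
    by metis
  \<comment> \<open>Near p, the infimum defining psi stays below the threshold, so some element of D does.\<close>
  let ?V = "\<Inter>e\<in>vertices d. {q. q e \<psi> (K e) < \<eta> e}"
  have oV: "open (U \<inter> ?V)"
    by (intro open_Int U open_INT ballI finite_vertices open_Collect_less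
      continuous_on_eval3 continuous_on_const)
  have "p e \<psi> (K e) < \<eta> e" if "e \<in> vertices d" for e
    using le_funD[OF x(2)[OF that], of "K e"] K(1)[OF that] by simp
  then have pV: "p \<in> U \<inter> ?V" using U(2) by simp
  obtain m n where mn: "\<gamma> m n \<in> U \<inter> ?V" by (rule \<Gamma>_meets_open[OF p oV pV])
  have "\<exists>w. w \<in> D \<and> dist (x e) (\<tau> (m + vdot d n e) w) < \<delta>" if e: "e \<in> vertices d" for e
  proof -
    have "\<gamma> m n e \<psi> (K e) < \<eta> e" using INT_D[OF IntD2[OF mn] e] by simp
    then have "(INF w\<in>D. w (s (m + vdot d n e) (K e))) < \<eta> e"
      using e by (simp add: \<gamma>_def \<tau>_apply[OF \<psi>_W]) (simp add: \<psi>_def)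
    then obtain w where w: "w \<in> D" "w (s (m + vdot d n e) (K e)) < \<eta> e"
      using cINF_less_iff[OF _ D_bdd] x0_D by blast
    have "dist (x e) (\<tau> (m + vdot d n e) w) < \<delta>"
      by (rule K(2)[OF e X_\<tau>[OF D_X[OF w(1)]]]) (use w in \<open>simp add: \<tau>_apply[OF D_W]\<close>)
    then show ?thesis using w(1) by blast
  qed
  then obtain w where "\<And>e. e \<in> vertices d \<Longrightarrow> w e \<in> D"
    "\<And>e. e \<in> vertices d \<Longrightarrow> dist (x e) (\<tau> (m + vdot d n e) (w e)) < \<delta>"
    by metis
  then show ?thesis using that[of m n w] mn by blast
qed

text \<open>This makes the map from \<open>Y'\<close> to the pro-nilfactor well defined: \<open>q x0\<close> lies in the
set represented by \<open>q \<psi>0 = p \<psi>0\<close>, and all points of that set are related to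
\<open>p x0\<close>.\<close>

lemma R_of_\<psi>0_eq:
  assumes p: "p \<in> E" and q: "q \<in> E" and eq: "p \<psi>0 = q \<psi>0"
  shows "R (p x0) (q x0)"
proof (rule R_limit)
  show "p x0 \<in> X" "q x0 \<in> X" using E_X x0_X p q by auto
  fix \<delta> :: real assume \<delta>: "\<delta> > 0"
  let ?g = "diag (p \<circ> u)"
  let ?U = "{r. dist (p x0) (r (zero_vertex d) x0) < \<delta>}"
  have le: "?g e \<psi> \<le> q x0" if "e \<in> vertices d" for e
    using E_mono[OF q \<psi>0_W D_W[OF x0_D] \<psi>0_le] eq that by (simp add: diag_def \<psi>0_def)
  have g: "?g \<in> \<Gamma>" by (intro diag_in_\<Gamma> E_mult p u_E)
  have oU: "open ?U" by (intro open_Collect_less continuous_on_dist continuous_on_eval2 continuous_on_const)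
  have gU: "?g \<in> ?U" using \<delta> u_x0 by (simp add: diag_def zero_vertex_in)
  obtain m n w where w: "\<gamma> m n \<in> ?U" "\<And>e. e \<in> vertices d \<Longrightarrow> w e \<in> D"
    "\<And>e. e \<in> vertices d \<Longrightarrow> dist (q x0) (\<tau> (m + vdot d n e) (w e)) < \<delta>"
    by (rule approximation_from_D[OF g _ le oU gU \<delta>]) (use E_X[OF q x0_X] in auto)
  have "R (\<tau> m x0) (\<tau> m (w (zero_vertex d)))"
    by (rule R_\<tau>) (use w(2)[OF zero_vertex_in] in \<open>simp add: D_def\<close>)
  moreover have "dist (p x0) (\<tau> m x0) < \<delta>" using w(1) by (simp add: \<gamma>_def zero_vertex_in)
  moreover have "dist (q x0) (\<tau> m (w (zero_vertex d))) < \<delta>" using w(3)[OF zero_vertex_in] by simp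
  ultimately show "\<exists>x' y'. R x' y' \<and> dist (p x0) x' < \<delta> \<and> dist (q x0) y' < \<delta>" by blast
qed

text \<open>The reason for proximality: two translates of \<open>\<psi>0\<close> over the same point of the factor
differ by an element of the stabiliser once \<open>u\<close> has been applied.\<close>

lemma u_\<psi>0_eq_of_R:
  assumes p: "p \<in> E" and q: "q \<in> E" and R: "R (p x0) (q x0)"
  shows "u (p \<psi>0) = u (q \<psi>0)"
proof -
  let ?a = "u \<circ> (p \<circ> u)"
  have a: "?a \<in> E" by (intro E_mult p u_E)
  obtain c where c: "c \<in> E" "\<And>f. u (c (u f)) = c f" "\<And>f. c (?a f) = u f" "\<And>f. ?a (c f) = u f"
    by (rule E_group[OF a]) auto
  have uc: "u (c f) = c f" for f using c(2)[of f] u_u by metis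
  have cu: "c (u f) = c f" for f using c(2)[of f] c(2)[of "u f"] by simp
  have cp: "c (p x0) = x0" using c(3)[of x0] cu u_x0 by simp
  let ?g = "c \<circ> (q \<circ> u)"
  have "?g \<psi>0 = \<psi>0"
  proof (rule stabilizer_fixes_\<psi>0)
    show "?g \<in> E" by (intro E_mult c q u_E)
    show "u (?g (u f)) = ?g f" for f using uc by simp
    show "R x0 (?g x0)" using R_E[OF c(1) R] cp u_x0 by simp
  qed
  then have "c (q \<psi>0) = \<psi>0" using u_\<psi>0 by simp
  then have "u (q \<psi>0) = ?a \<psi>0" using c(4)[of "q \<psi>0"] by simp
  then show ?thesis using u_\<psi>0 by simp
qed

lemma mix_W: "f \<in> W \<Longrightarrow> g \<in> W \<Longrightarrow> mix f g \<in> W" by (simp add: mix_def W_def)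

lemma E_mix: assumes "p \<in> E" "f \<in> W" "g \<in> W" shows "p (mix f g) = mix (p f) (p g)"
proof
  fix j
  have "closed {p. p (mix f g) j = mix (p f) (p g) j}"
    by (cases "tag j") (auto simp: mix_def[of "_ f"] intro!: closed_Collect_eq continuous_on_eval2)
  then have "p \<in> {p. p (mix f g) j = mix (p f) (p g) j}"
    by (rule E_in_closed[OF assms(1)])
      (simp add: \<tau>_apply mix_W assms, simp add: mix_def \<tau>_apply assms tag_s)
  then show "p (mix f g) j = mix (p f) (p g) j" by simp
qed

lemma mix_lm: "mix f g \<circ> lm = f \<circ> lm" using tag_lm by (auto simp: mix_def)

lemma mix_rm: "mix f g \<circ> rm = g \<circ> rm" using tag_rm by (auto simp: mix_def)

lemma \<psi>_rm: "\<psi> \<circ> rm = \<psi>"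
proof
  fix j
  have "(\<lambda>w. w (rm j)) ` D = (\<lambda>w. w j) ` D"
    by (rule image_cong) (use X_rm[OF D_X] in \<open>auto simp: fun_eq_iff\<close>)
  then show "(\<psi> \<circ> rm) j = \<psi> j" by (simp add: \<psi>_def)
qed

lemma \<psi>0_rm: "\<psi>0 \<circ> rm = \<psi>0"
  using E_reindex[OF u_E \<psi>_W rm_s] \<psi>_rm by (simp add: \<psi>0_def)

lemma \<xi>0_W: "\<xi>0 \<in> W" unfolding \<xi>0_def by (rule mix_W[OF D_W[OF x0_D] \<psi>0_W])

lemma E_\<xi>0: "p \<in> E \<Longrightarrow> p \<xi>0 = mix (p x0) (p \<psi>0)"
  unfolding \<xi>0_def by (rule E_mix[OF _ D_W[OF x0_D] \<psi>0_W])

lemma u_\<xi>0: "u \<xi>0 = \<xi>0" using E_\<xi>0[OF u_E] u_x0 u_\<psi>0 by (simp add: \<xi>0_def)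

lemma E_\<xi>0_lm: assumes "p \<in> E" shows "p \<xi>0 \<circ> lm = p x0"
  using X_lm[OF E_X[OF assms x0_X]] by (simp add: E_\<xi>0[OF assms] mix_lm)

lemma E_\<xi>0_rm: assumes "p \<in> E" shows "p \<xi>0 \<circ> rm = p \<psi>0"
  using E_reindex[OF assms \<psi>0_W rm_s] \<psi>0_rm by (simp add: E_\<xi>0[OF assms] mix_rm)

text \<open>Cubes over \<open>X'\<close> are saturated over \<open>Y'\<close>. A point of \<open>X'\<close> in the fibre of
\<open>p e \<psi>0\<close> has its first component in the set represented by \<open>p e \<psi>0\<close>, so it is
a limit of translates of points \<open>w e \<in> D\<close>. These form a cube by
\<open>cube_of_related\<close>, reached from \<open>x0\<close> by elements that fix \<open>\<psi>0\<close>; hence the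
pairs \<open>(w e, \<psi>0)\<close> form a cube over \<open>X'\<close>, and so do the limits of its
translates.\<close>

lemma cube_saturated:
  assumes z: "cube \<xi>0 z" and z': "\<And>e. e \<in> vertices d \<Longrightarrow> \<exists>q\<in>E. z' e = q \<xi>0"
    and eq: "\<And>e. e \<in> vertices d \<Longrightarrow> z' e \<circ> rm = z e \<circ> rm"
  shows "cube \<xi>0 z'"
proof (rule cube_limit)
  fix \<delta> :: real assume \<delta>: "\<delta> > 0"
  then have \<delta>2: "\<delta> / 2 > 0" by simp
  obtain p where p: "p \<in> \<Gamma>" "\<And>e. e \<in> vertices d \<Longrightarrow> z e = p e \<xi>0" using z by (auto simp: cube_def)
  obtain q where q: "\<And>e. e \<in> vertices d \<Longrightarrow> q e \<in> E" "\<And>e. e \<in> vertices d \<Longrightarrow> z' e = q e \<xi>0"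
    using z' by metis
  have qp: "q e \<psi>0 = p e \<psi>0" if "e \<in> vertices d" for e
    using eq[OF that] E_\<xi>0_rm[OF q(1)[OF that]] E_\<xi>0_rm[OF \<Gamma>_coord[OF p(1), of e]] that
    by (simp add: p(2) q(2))
  let ?g = "p \<star> diag u"
  let ?U = "\<Inter>e\<in>vertices d. {r. dist (p e \<psi>0) (r e \<psi>0) < \<delta> / 2}"
  have g: "?g \<in> \<Gamma>" by (intro \<Gamma>_mult p diag_in_\<Gamma> u_E)
  have le: "?g e \<psi> \<le> q e x0" if "e \<in> vertices d" for e
    using E_mono[OF q(1)[OF that] \<psi>0_W D_W[OF x0_D] \<psi>0_le] qp[OF that] that
    by (simp add: diag_def \<psi>0_def)
  have oU: "open ?U"
    by (intro open_INT ballI finite_vertices open_Collect_less continuous_on_dist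
      continuous_on_eval2 continuous_on_const)
  have gU: "?g \<in> ?U" using \<delta> u_\<psi>0 by (simp add: diag_def)
  obtain m n w where w: "\<gamma> m n \<in> ?U" "\<And>e. e \<in> vertices d \<Longrightarrow> w e \<in> D"
    "\<And>e. e \<in> vertices d \<Longrightarrow> dist (q e x0) (\<tau> (m + vdot d n e) (w e)) < \<delta> / 2"
    by (rule approximation_from_D[OF g _ le oU gU \<delta>2]) (use E_X[OF q(1) x0_X] in auto)
  \<comment> \<open>The points w e form a cube, and u r u carries x0 to w e without moving psi0.\<close>
  have "cube x0 w"
    by (rule cube_of_related[OF u_x0 x0_X]) (use w(2) in \<open>auto simp: D_def\<close>)
  then obtain r where r: "r \<in> \<Gamma>" "\<And>e. e \<in> vertices d \<Longrightarrow> w e = r e x0" by (auto simp: cube_def)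
  let ?a = "diag u \<star> (r \<star> diag u)"
  have a: "?a \<in> \<Gamma>" by (intro \<Gamma>_mult r diag_in_\<Gamma> u_E)
  have "?a e \<xi>0 = mix (w e) \<psi>0" if e: "e \<in> vertices d" for e
  proof -
    have aE: "?a e \<in> E" by (rule \<Gamma>_coord[OF a])
    have ax: "?a e x0 = w e" using e w(2)[OF e] r(2)[OF e] u_x0 by (simp add: diag_def D_def)
    have "?a e \<psi>0 = \<psi>0"
    proof (rule stabilizer_fixes_\<psi>0[OF aE])
      show "u (?a e (u f)) = ?a e f" for f using e by (simp add: diag_def)
      show "R x0 (?a e x0)" unfolding ax using w(2)[OF e] by (simp add: D_def)
    qed
    then show ?thesis unfolding E_\<xi>0[OF aE] ax by simp
  qed
  then have "cube \<xi>0 (\<lambda>e. mix (w e) \<psi>0)"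
    unfolding cube_def by (intro bexI[OF _ a]) simp
  then have c: "cube \<xi>0 (\<lambda>e. \<gamma> m n e (mix (w e) \<psi>0))" by (rule cube_mult[OF \<gamma>_in_\<Gamma>])
  have "dist (z' e) (\<gamma> m n e (mix (w e) \<psi>0)) < \<delta>" if e: "e \<in> vertices d" for e
  proof -
    let ?t = "\<tau> (m + vdot d n e)"
    have "z' e = mix (q e x0) (p e \<psi>0)" using E_\<xi>0[OF q(1)[OF e]] q(2)[OF e] qp[OF e] by simp
    moreover have "\<gamma> m n e (mix (w e) \<psi>0) = mix (?t (w e)) (?t \<psi>0)"
      using e E_mix[OF \<tau>_in_E D_W[OF w(2)[OF e]] \<psi>0_W] by (simp add: \<gamma>_def)
    ultimately have "dist (z' e) (\<gamma> m n e (mix (w e) \<psi>0)) \<le> dist (q e x0) (?t (w e)) + dist (p e \<psi>0) (?t \<psi>0)"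
      unfolding mix_def using dist_if_le by simp
    also have "dist (p e \<psi>0) (?t \<psi>0) < \<delta> / 2"
      using INT_D[OF w(1) e] e by (simp add: \<gamma>_def)
    finally show ?thesis using w(3)[OF e] by simp
  qed
  then show "\<exists>y. cube \<xi>0 y \<and> (\<forall>e\<in>vertices d. dist (z' e) (y e) < \<delta>)" using c by blast
qed

end

section \<open>Integer iterates and face orbits\<close>

lemma tds_bij: "tds X T \<Longrightarrow> bij_betw T (mspace X) (mspace X)"
  using homeomorphic_imp_injective_map homeomorphic_imp_surjective_map
  unfolding tds_def bij_betw_def by fastforce

text \<open>Iterates are handled through this characterisation, which hides the case distinction on the sign
in the definition of \<open>ziter\<close>.\<close>

lemma ziter_unique:
  assumes T: "bij_betw T (mspace X) (mspace X)"
    and g: "\<And>n. g n \<in> mspace X" "\<And>n. g (n + 1) = T (g n)" and "g 0 = x"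
  shows "ziter X T n x = g n"
proof -
  have pos: "(T ^^ j) x = g (int j)" for j
  proof (induction j)
    case (Suc j)
    have "int (Suc j) = int j + 1" by simp
    then show ?case using Suc g(2)[of "int j"] by (simp only: funpow.simps comp_apply)
  qed (use assms in auto)
  have inv: "inv_into (mspace X) T (g n) = g (n - 1)" for n
    using g(2)[of "n - 1"] g(1) bij_betw_imp_inj_on[OF T] by (simp add: inv_into_f_eq)
  have neg: "(inv_into (mspace X) T ^^ j) x = g (- int j)" for j
  proof (induction j)
    case (Suc j)
    have "- int j - 1 = - int (Suc j)" by simp
    then show ?case using Suc inv[of "- int j"] by (simp only: funpow.simps comp_apply)
  qed (use assms in auto)
  show ?thesis
    using pos[of "nat n"] neg[of "nat (- n)"] by (auto simp: ziter_def)
qed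

lemma funpow_in: "(\<And>y. y \<in> A \<Longrightarrow> f y \<in> A) \<Longrightarrow> x \<in> A \<Longrightarrow> (f ^^ j) x \<in> A"
  by (induction j) auto

lemma ziter_in:
  assumes "bij_betw T (mspace X) (mspace X)" "x \<in> mspace X" shows "ziter X T n x \<in> mspace X"
  unfolding ziter_def using assms(2) bij_betw_apply[OF assms(1)]
    bij_betw_apply[OF bij_betw_inv_into[OF assms(1)]]
  by (auto intro!: funpow_in)

lemma ziter_0 [simp]: "ziter X T 0 x = x" by (simp add: ziter_def)

lemma ziter_1 [simp]: "ziter X T 1 x = T x" by (simp add: ziter_def)

lemma ziter_Suc:
  assumes T: "bij_betw T (mspace X) (mspace X)" and x: "x \<in> mspace X"
  shows "ziter X T (n + 1) x = T (ziter X T n x)"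
proof (cases "0 \<le> n")
  case True
  then show ?thesis by (simp add: ziter_def nat_add_distrib)
next
  case False
  define j where "j = nat (- n - 1)"
  have n: "n = - int j - 1" using False by (simp add: j_def)
  have "T (ziter X T n x) = T (inv_into (mspace X) T ((inv_into (mspace X) T ^^ j) x))"
    by (simp add: ziter_def n nat_add_distrib)
  also have "\<dots> = (inv_into (mspace X) T ^^ j) x"
  proof (rule bij_betw_inv_into_right[OF T])
    show "(inv_into (mspace X) T ^^ j) x \<in> mspace X"
      using x bij_betw_apply[OF bij_betw_inv_into[OF T]] by (rule funpow_in[rotated])
  qed
  also have "\<dots> = ziter X T (n + 1) x" by (auto simp: ziter_def n)
  finally show ?thesis by simp
qed

lemma ziter_add:
  assumes T: "bij_betw T (mspace X) (mspace X)" and x: "x \<in> mspace X"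
  shows "ziter X T m (ziter X T n x) = ziter X T (m + n) x"
proof (rule ziter_unique[OF T, of "\<lambda>m. ziter X T (m + n) x"])
  show "ziter X T (m + 1 + n) x = T (ziter X T (m + n) x)" for m
    using ziter_Suc[OF T x, of "m + n"] by (simp add: add.assoc add.commute[of n 1])
qed (use ziter_in[OF T x] in auto)

text \<open>The element of the face group with exponent vector \<open>n\<close>.\<close>

definition translation ::
  "nat \<Rightarrow> 'a metric \<Rightarrow> ('a \<Rightarrow> 'a) \<Rightarrow> (nat \<Rightarrow> int) \<Rightarrow> ((nat \<Rightarrow> int) \<Rightarrow> 'a) \<Rightarrow> (nat \<Rightarrow> int) \<Rightarrow> 'a" where
  "translation d X T n =
     (\<lambda>z\<in>topspace (cube_space d X). \<lambda>e\<in>vertices d. ziter X T (vdot d n e) (z e))"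

lemma topspace_cube_space: "topspace (cube_space d X) = vertices d \<rightarrow>\<^sub>E mspace X"
  by (simp add: cube_space_def)

context
  fixes d :: nat and X :: "'a metric" and T :: "'a \<Rightarrow> 'a"
  assumes T: "bij_betw T (mspace X) (mspace X)"
begin

private abbreviation "S \<equiv> topspace (cube_space d X)"

lemma translation_in: "z \<in> S \<Longrightarrow> translation d X T n z \<in> S"
  unfolding translation_def topspace_cube_space using ziter_in[OF T] by (auto simp: PiE_iff)

lemma translation_translation:
  assumes "z \<in> S"
  shows "translation d X T n (translation d X T m z) = translation d X T (\<lambda>i. n i + m i) z"
proof
  fix e
  show "translation d X T n (translation d X T m z) e = translation d X T (\<lambda>i. n i + m i) z e"
    using assms translation_in[OF assms, of m] ziter_add[OF T]
    by (auto simp: translation_def vdot_add topspace_cube_space PiE_iff)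
qed

lemma translation_0: assumes "z \<in> S" shows "translation d X T (\<lambda>_. 0) z = z"
proof
  fix e show "translation d X T (\<lambda>_. 0) z e = z e"
    using assms by (auto simp: translation_def vdot_def topspace_cube_space PiE_iff extensional_def)
qed

lemma translation_Bij: "translation d X T n \<in> Bij S"
proof -
  have "bij_betw (translation d X T n) S S"
    by (rule bij_betwI[of _ _ _ "translation d X T (\<lambda>i. - n i)"])
      (auto simp: translation_in translation_translation translation_0)
  then show ?thesis by (simp add: Bij_def translation_def)
qed

lemma translation_mult:
  "translation d X T n \<otimes>\<^bsub>BijGroup S\<^esub> translation d X T m = translation d X T (\<lambda>i. n i + m i)"
proof -
  have "compose S (translation d X T n) (translation d X T m) = translation d X T (\<lambda>i. n i + m i)"
  proof
    fix z show "compose S (translation d X T n) (translation d X T m) z = translation d X T (\<lambda>i. n i + m i) z"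
      by (cases "z \<in> S") (simp_all add: compose_def translation_translation, simp add: translation_def)
  qed
  then show ?thesis by (simp add: BijGroup_def translation_Bij)
qed

lemma translation_one: "translation d X T (\<lambda>_. 0) = \<one>\<^bsub>BijGroup S\<^esub>"
proof
  fix z show "translation d X T (\<lambda>_. 0) z = \<one>\<^bsub>BijGroup S\<^esub> z"
    by (cases "z \<in> S") (simp_all add: translation_0 BijGroup_def, simp add: translation_def)
qed

lemma translation_inv: "inv\<^bsub>BijGroup S\<^esub> (translation d X T n) = translation d X T (\<lambda>i. - n i)"
  by (rule group.inv_equality[OF group_BijGroup])
    (simp_all add: translation_mult translation_one, simp_all add: BijGroup_def translation_Bij)

lemma face_transformation_translation:
  assumes "j \<in> {1..d}"
  shows "face_transformation d X T j = translation d X T (\<lambda>i. if i = j then 1 else 0)"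
proof (rule ext)
  fix z
  have "(if e j = 1 then T (z e) else z e) = ziter X T (vdot d (\<lambda>i. if i = j then 1 else 0) e) (z e)"
    if "e \<in> vertices d" for e
    using that assms unfolding vdot_single[OF assms] by (auto simp: vertices_def PiE_def Pi_def)
  then show "face_transformation d X T j z = translation d X T (\<lambda>i. if i = j then 1 else 0) z"
    unfolding face_transformation_def translation_def by (intro restrict_cong ext) (auto intro!: restrict_ext)
qed

lemma face_group_eq: "face_group d X T = range (translation d X T)"
proof
  show "face_group d X T \<subseteq> range (translation d X T)"
  proof
    fix g assume "g \<in> face_group d X T"
    then have "g \<in> generate (BijGroup S) (face_transformation d X T ` {1..d})"
      by (simp add: face_group_def)
    then show "g \<in> range (translation d X T)"
    proof induction
      case one
      then show ?case by (metis translation_one rangeI)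
    next
      case (incl h)
      then show ?case using face_transformation_translation by auto
    next
      case (inv h)
      then show ?case using face_transformation_translation translation_inv by auto
    next
      case (eng h1 h2)
      then show ?case using translation_mult by auto
    qed
  qed
next
  let ?G = "face_group d X T"
  have one: "translation d X T (\<lambda>_. 0) \<in> ?G"
    unfolding translation_one face_group_def by (rule generate.one)
  have mult: "translation d X T (\<lambda>i. n i + m i) \<in> ?G"
    if "translation d X T n \<in> ?G" "translation d X T m \<in> ?G" for n m
    using that unfolding translation_mult[symmetric] face_group_def by (rule generate.eng)
  have unit: "translation d X T (\<lambda>i. if i = j then 1 else 0) \<in> ?G" if "j \<in> {1..d}" for j
    unfolding face_transformation_translation[OF that, symmetric] face_group_def
    using that by (intro generate.incl) auto
  have unit_inv: "translation d X T (\<lambda>i. - (if i = j then 1 else 0)) \<in> ?G" if "j \<in> {1..d}" for j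
    unfolding translation_inv[symmetric] face_transformation_translation[OF that, symmetric] face_group_def
    using that by (intro generate.inv) auto
  have single: "translation d X T (\<lambda>i. if i = j then t else 0) \<in> ?G" if j: "j \<in> {1..d}" for j t
  proof (induction t rule: int_induct[of _ 0])
    case base
    show ?case using one by simp
  next
    case (step1 t)
    have "(\<lambda>i. (if i = j then t else 0) + (if i = j then 1 else 0)) = (\<lambda>i. if i = j then t + 1 else 0)"
      by auto
    then show ?case using mult[OF step1(2) unit[OF j]] by simp
  next
    case (step2 t)
    have "(\<lambda>i. (if i = j then t else 0) + - (if i = j then 1 else 0)) = (\<lambda>i. if i = j then t - 1 else 0)"
      by auto
    then show ?case using mult[OF step2(2) unit_inv[OF j]] by simp
  qed
  have prefix: "j \<le> d \<Longrightarrow> translation d X T (\<lambda>i. if i \<in> {1..j} then n i else 0) \<in> ?G" for n j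
  proof (induction j)
    case 0
    then show ?case using one by simp
  next
    case (Suc j)
    have "(\<lambda>i. (if i \<in> {1..j} then n i else 0) + (if i = Suc j then n (Suc j) else 0)) =
      (\<lambda>i. if i \<in> {1..Suc j} then n i else 0)" by auto
    then show ?case using mult[of "\<lambda>i. if i \<in> {1..j} then n i else 0", OF _ single[of "Suc j" "n (Suc j)"]] Suc
      by simp
  qed
  have "translation d X T n = translation d X T (\<lambda>i. if i \<in> {1..d} then n i else 0)" for n
  proof -
    have "vdot d n e = vdot d (\<lambda>i. if i \<in> {1..d} then n i else 0) e" for e
      unfolding vdot_def by (intro sum.cong) auto
    then show ?thesis by (simp add: translation_def)
  qed
  then show "range (translation d X T) \<subseteq> ?G" using prefix[OF order.refl] by auto
qed

lemma face_orbit: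
  assumes x: "x \<in> mspace X"
  shows "{g (diagonal_point d x) |g. g \<in> face_group d X T} =
    range (\<lambda>n. \<lambda>e\<in>vertices d. ziter X T (vdot d n e) x)"
proof -
  have dS: "diagonal_point d x \<in> S" using x by (simp add: topspace_cube_space diagonal_point_def)
  have "translation d X T n (diagonal_point d x) = (\<lambda>e\<in>vertices d. ziter X T (vdot d n e) x)" for n
    using dS by (auto simp: translation_def diagonal_point_def intro!: restrict_ext)
  moreover have "{g (diagonal_point d x) |g. g \<in> range (translation d X T)} =
    range (\<lambda>n. translation d X T n (diagonal_point d x))" by blast
  ultimately show ?thesis unfolding face_group_eq by simp
qed

end

lemma mdist_refl: "a \<in> mspace X \<Longrightarrow> mdist X a a = 0"
  using mdist_zero[of a X a] by simp

lemma cube_closure_iff: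
  assumes A: "A \<subseteq> vertices d \<rightarrow>\<^sub>E mspace X"
  shows "z \<in> cube_space d X closure_of A \<longleftrightarrow> z \<in> vertices d \<rightarrow>\<^sub>E mspace X \<and>
    (\<forall>\<delta>>0. \<exists>y\<in>A. \<forall>e\<in>vertices d. mdist X (z e) (y e) < \<delta>)" (is "?L \<longleftrightarrow> ?R")
proof
  assume L: ?L
  then have zS: "z \<in> vertices d \<rightarrow>\<^sub>E mspace X"
    using subsetD[OF closure_of_subset_topspace L] by (simp add: topspace_cube_space)
  have "\<exists>y\<in>A. \<forall>e\<in>vertices d. mdist X (z e) (y e) < \<delta>" if \<delta>: "\<delta> > 0" for \<delta>
  proof -
    have "openin (cube_space d X) (PiE (vertices d) (\<lambda>e. mball_of X (z e) \<delta>))"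
      unfolding cube_space_def openin_PiE_gen using finite_vertices
      by (auto simp: mtopology_of_def mball_of_def Metric_space.openin_mball[OF Metric_space_mspace_mdist])
    moreover have "z \<in> PiE (vertices d) (\<lambda>e. mball_of X (z e) \<delta>)"
      using zS \<delta> by (auto simp: PiE_iff mdist_refl)
    ultimately obtain y where "y \<in> A" "y \<in> PiE (vertices d) (\<lambda>e. mball_of X (z e) \<delta>)"
      using L by (meson in_closure_of)
    then show ?thesis by (intro bexI[of _ y]) (auto simp: PiE_iff)
  qed
  then show ?R using zS by blast
next
  assume R: ?R
  show ?L
    unfolding in_closure_of topspace_cube_space
  proof (intro conjI allI impI)
    show "z \<in> vertices d \<rightarrow>\<^sub>E mspace X" using R by blast
    fix U assume U: "z \<in> U \<and> openin (cube_space d X) U"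
    then obtain V where V: "\<forall>e\<in>vertices d. openin (mtopology_of X) (V e)"
      "z \<in> PiE (vertices d) V" "PiE (vertices d) V \<subseteq> U"
      unfolding cube_space_def openin_product_topology_alt by metis
    have "\<exists>r>0. mball_of X (z e) r \<subseteq> V e" if "e \<in> vertices d" for e
      using V(1,2) that Metric_space.openin_mtopology[OF Metric_space_mspace_mdist, of X]
      unfolding mtopology_of_def mball_of_def by (auto simp: PiE_iff)
    then obtain r where r: "\<And>e. e \<in> vertices d \<Longrightarrow> r e > 0 \<and> mball_of X (z e) (r e) \<subseteq> V e" by metis
    let ?\<delta> = "Min (r ` vertices d)"
    have ne: "vertices d \<noteq> {}" using zero_vertex_in by blast
    have "?\<delta> > 0" using finite_vertices ne r by (subst Min_gr_iff) auto
    then obtain y where y: "y \<in> A" "\<And>e. e \<in> vertices d \<Longrightarrow> mdist X (z e) (y e) < ?\<delta>" using R by blast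
    have "y e \<in> V e" if e: "e \<in> vertices d" for e
    proof -
      have "mdist X (z e) (y e) < r e"
        using y(2)[OF e] Min_le[of "r ` vertices d" "r e"] finite_vertices e by fastforce
      moreover have "z e \<in> mspace X" "y e \<in> mspace X" using R y(1) A e by (auto simp: PiE_iff)
      ultimately show ?thesis using r[OF e] by (auto simp: in_mball_of)
    qed
    moreover have "y \<in> extensional (vertices d)" using y(1) A by (auto simp: PiE_iff)
    ultimately have "y \<in> PiE (vertices d) V" by (simp add: PiE_iff)
    then have "y \<in> U" using V(3) by (rule subsetD[rotated])
    then show "\<exists>y. y \<in> A \<and> y \<in> U" using y(1) by blast
  qed
qed

lemma face_orbit_closure_iff:
  assumes T: "bij_betw T (mspace X) (mspace X)" and x: "x \<in> mspace X"
  shows "z \<in> face_orbit_closure d X T x \<longleftrightarrow> z \<in> vertices d \<rightarrow>\<^sub>E mspace X \<and>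
    (\<forall>\<delta>>0. \<exists>n. \<forall>e\<in>vertices d. mdist X (z e) (ziter X T (vdot d n e) x) < \<delta>)"
  unfolding face_orbit_closure_def face_orbit[OF T x]
  by (subst cube_closure_iff) (use ziter_in[OF T x] in auto)

section \<open>Minimal subsystems of a shift and generic face orbits\<close>

definition hc_subspace :: "hc set \<Rightarrow> hc metric" where "hc_subspace A = submetric euclidean_metric A"

lemma hc_subspace_simps [simp]:
  "mspace (hc_subspace A) = A" "mdist (hc_subspace A) = dist" "mtopology_of (hc_subspace A) = top_of_set A"
  by (simp_all add: hc_subspace_def mtopology_of_submetric)

context idempotent_shift
begin

text \<open>The orbit closure of \<open>f\<close>.\<close>

definition orb :: "hc \<Rightarrow> hc set" where "orb f = (\<lambda>p. p f) ` E"

lemma compact_orb: "compact (orb f)"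
  unfolding orb_def by (rule compact_continuous_image[OF continuous_on_eval compact_E])

lemma orb_W: "f \<in> W \<Longrightarrow> orb f \<subseteq> W" unfolding orb_def using E_W by auto

lemma E_orb: "p \<in> E \<Longrightarrow> g \<in> orb f \<Longrightarrow> p g \<in> orb f"
proof -
  assume p: "p \<in> E" and "g \<in> orb f"
  then obtain q where "q \<in> E" "g = q f" by (auto simp: orb_def)
  then show ?thesis unfolding orb_def by (intro image_eqI[of _ _ "p \<circ> q"] E_mult p) auto
qed

lemma orb_self: "f \<in> orb f" unfolding orb_def by (rule image_eqI[OF _ id_in_E]) simp

lemma \<tau>_bij: "(\<And>n f. f \<in> A \<Longrightarrow> \<tau> n f \<in> A) \<Longrightarrow> bij_betw (\<tau> 1) A A"
  by (rule bij_betwI[of _ _ _ "\<tau> (-1)"]) (auto simp: \<tau>_add)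

lemma ziter_\<tau>:
  assumes "\<And>n f. f \<in> A \<Longrightarrow> \<tau> n f \<in> A" "f \<in> A" shows "ziter (hc_subspace A) (\<tau> 1) n f = \<tau> n f"
  by (rule ziter_unique) (use assms \<tau>_bij[OF assms(1)] in \<open>auto simp: \<tau>_add add.commute\<close>)

lemma tds_hc_subspace:
  assumes "A \<subseteq> W" "compact A" "A \<noteq> {}" "\<And>n f. f \<in> A \<Longrightarrow> \<tau> n f \<in> A"
  shows "tds (hc_subspace A) (\<tau> 1)"
proof -
  have "continuous_on A (\<tau> n)" for n by (rule continuous_on_subset[OF continuous_on_\<tau> assms(1)])
  then have "homeomorphic_maps (top_of_set A) (top_of_set A) (\<tau> 1) (\<tau> (-1))"
    using assms(4) by (auto simp: homeomorphic_maps_def \<tau>_add)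
  then have "homeomorphic_map (top_of_set A) (top_of_set A) (\<tau> 1)"
    using homeomorphic_map_maps by blast
  then show ?thesis using assms by (simp add: tds_def compact_space_subtopology)
qed

text \<open>If \<open>u\<close> fixes \<open>f\<close>, then every point of the orbit closure of \<open>f\<close> can be brought
back to \<open>f\<close>.\<close>

lemma minimal_orb:
  assumes f: "f \<in> W" "u f = f"
  shows "minimal_tds (hc_subspace (orb f)) (\<tau> 1)"
  unfolding minimal_tds_def
proof (intro conjI ballI)
  have \<tau>o: "\<tau> n g \<in> orb f" if "g \<in> orb f" for n g by (rule E_orb[OF \<tau>_in_E that])
  show "tds (hc_subspace (orb f)) (\<tau> 1)"
  proof (rule tds_hc_subspace)
    show "orb f \<noteq> {}" using orb_self[of f] by blast
  qed (use orb_W f compact_orb \<tau>o in auto)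
  fix g assume "g \<in> mspace (hc_subspace (orb f))"
  then have g: "g \<in> orb f" by simp
  then obtain p where p: "p \<in> E" "g = p f" by (auto simp: orb_def)
  obtain q where q: "q \<in> E" "u (q (p (u f))) = u f" using E_inverse[OF p(1)] by metis
  have "h \<in> closure (range (\<lambda>n. \<tau> n g))" if h: "h \<in> orb f" for h
  proof -
    obtain r where r: "r \<in> E" "h = r f" using h by (auto simp: orb_def)
    let ?r = "r \<circ> (u \<circ> q)"
    have "?r \<in> E" by (intro E_mult r q u_E)
    moreover have "\<tau> n g \<in> closure (range (\<lambda>n. \<tau> n g))" for n
      by (rule subsetD[OF closure_subset]) simp
    ultimately have "?r g \<in> closure (range (\<lambda>n. \<tau> n g))" by (rule E_preserves[OF _ closed_closure])
    then show ?thesis using q(2) f(2) by (simp add: p(2) r(2))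
  qed
  moreover have "{ziter (hc_subspace (orb f)) (\<tau> 1) n g |n. True} = range (\<lambda>n. \<tau> n g)"
    using ziter_\<tau>[OF \<tau>o g] by auto
  moreover have "range (\<lambda>n. \<tau> n g) \<subseteq> orb f" using \<tau>o[OF g] by auto
  ultimately show "mtopology_of (hc_subspace (orb f)) closure_of {ziter (hc_subspace (orb f)) (\<tau> 1) n g |n. True} = mspace (hc_subspace (orb f))"
    by (auto simp: closure_of_subtopology Int_absorb1)
qed

lemma proximal_of_u_eq:
  assumes A: "\<And>n f. f \<in> A \<Longrightarrow> \<tau> n f \<in> A" and "f \<in> A" "g \<in> A" and eq: "u f = u g"
  shows "proximal (hc_subspace A) (\<tau> 1) f g"
proof -
  let ?h = "\<lambda>n. dist (\<tau> n f) (\<tau> n g)"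
  have bdd: "bdd_below (range ?h)" by (rule bdd_belowI[of _ 0]) auto
  have "(INF n. ?h n) \<le> \<delta>" if \<delta>: "\<delta> > 0" for \<delta>
  proof -
    let ?U = "{q. dist (q f) (q g) < \<delta>}"
    have oU: "open ?U" by (intro open_Collect_less continuous_on_dist continuous_on_eval continuous_on_const)
    have uU: "u \<in> ?U" using eq \<delta> by simp
    obtain n where "\<tau> n \<in> ?U" by (rule E_meets_open[OF u_E oU uU])
    then have "?h n < \<delta>" by simp
    then show ?thesis using cINF_lower[OF bdd, of n] by simp
  qed
  moreover have "0 \<le> (INF n. ?h n)" by (rule cINF_greatest) auto
  ultimately have "(INF n. ?h n) = 0" by (meson dense_ge order_antisym)
  then show ?thesis using ziter_\<tau>[OF A assms(2)] ziter_\<tau>[OF A assms(3)] by (simp add: proximal_def)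
qed

lemma face_orbit_closure_cube:
  assumes f: "f \<in> W" and g: "g \<in> orb f" and z: "z \<in> face_orbit_closure d (hc_subspace (orb f)) (\<tau> 1) g"
  shows "z \<in> vertices d \<rightarrow>\<^sub>E orb f" "cube f z" "z (zero_vertex d) = g"
proof -
  have \<tau>o: "\<tau> n g \<in> orb f" if "g \<in> orb f" for n g by (rule E_orb[OF \<tau>_in_E that])
  have T: "bij_betw (\<tau> 1) (mspace (hc_subspace (orb f))) (mspace (hc_subspace (orb f)))" using \<tau>_bij[OF \<tau>o] by simp
  have z': "z \<in> vertices d \<rightarrow>\<^sub>E orb f"
    "\<And>\<delta>. \<delta> > 0 \<Longrightarrow> \<exists>n. \<forall>e\<in>vertices d. dist (z e) (\<tau> (vdot d n e) g) < \<delta>"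
    using z face_orbit_closure_iff[OF T, of g z d] g ziter_\<tau>[OF \<tau>o g] by auto
  show "z \<in> vertices d \<rightarrow>\<^sub>E orb f" by (rule z'(1))
  obtain r where r: "r \<in> E" "g = r f" using g by (auto simp: orb_def)
  show "cube f z"
  proof (rule cube_limit)
    fix \<delta> :: real assume "\<delta> > 0"
    then obtain n where n: "\<forall>e\<in>vertices d. dist (z e) (\<tau> (vdot d n e) g) < \<delta>" using z'(2) by blast
    have "cube f (\<lambda>e. (\<gamma> 0 n \<star> diag r) e f)"
      unfolding cube_def
      by (intro bexI[of _ "\<gamma> 0 n \<star> diag r"] \<Gamma>_mult \<gamma>_in_\<Gamma> diag_in_\<Gamma> r(1)) simp
    moreover have "(\<gamma> 0 n \<star> diag r) e f = \<tau> (vdot d n e) g" if "e \<in> vertices d" for e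
      using that by (simp add: \<gamma>_def diag_def r(2))
    ultimately show "\<exists>y. cube f y \<and> (\<forall>e\<in>vertices d. dist (z e) (y e) < \<delta>)"
      using n by (intro exI[of _ "\<lambda>e. (\<gamma> 0 n \<star> diag r) e f"]) simp
  qed
  have "dist (z (zero_vertex d)) g < \<delta>" if "\<delta> > 0" for \<delta>
    using z'(2)[OF that] zero_vertex_in[of d] by fastforce
  then have "dist (z (zero_vertex d)) g \<le> 0" by (meson dense_ge less_imp_le)
  then show "z (zero_vertex d) = g" by simp
qed

text \<open>For a generic point \<open>g\<close>, the orbit closure of \<open>(g, \<dots>, g)\<close> under the face group
alone contains every cube whose first coordinate is \<open>g\<close>. Such a cube is a limit of face
translates of diagonal points \<open>(g', \<dots>, g')\<close> with \<open>g'\<close> close to \<open>g\<close>.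
For a basic open box \<open>b\<close>, the set \<open>A b\<close> of points whose face orbit meets
\<open>b\<close> is open, and a point outside the boundaries of all these countably many open sets
belongs to \<open>A b\<close> as soon as it is a limit of points of \<open>A b\<close>.\<close>

lemma generic_face_orbit_closure:
  assumes f: "f \<in> W"
  obtains X0 where "gdelta_in (top_of_set (orb f)) X0" "top_of_set (orb f) closure_of X0 = orb f"
    "\<And>g z. \<lbrakk>g \<in> X0; z \<in> vertices d \<rightarrow>\<^sub>E orb f; cube f z; z (zero_vertex d) = g\<rbrakk> \<Longrightarrow>
       z \<in> face_orbit_closure d (hc_subspace (orb f)) (\<tau> 1) g"
proof -
  let ?O = "orb f" and ?T = "top_of_set (orb f)"
  have \<tau>o: "\<tau> n g \<in> orb f" if "g \<in> orb f" for n g by (rule E_orb[OF \<tau>_in_E that])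
  have T: "bij_betw (\<tau> 1) (mspace (hc_subspace ?O)) (mspace (hc_subspace ?O))" using \<tau>_bij[OF \<tau>o] by simp
  obtain \<B> :: "hc set set" where \<B>: "countable \<B>" "topological_basis \<B>"
    using ex_countable_basis by blast
  define P where "P = vertices d \<rightarrow>\<^sub>E \<B>"
  have cP: "countable P" unfolding P_def by (rule countable_PiE[OF finite_vertices]) (rule \<B>(1))
  define A where "A b = (\<Union>n. \<Inter>e\<in>vertices d. {g \<in> ?O. \<tau> (vdot d n e) g \<in> b e})" for b :: "(nat \<Rightarrow> int) \<Rightarrow> hc set"
  have ne: "vertices d \<noteq> {}" using zero_vertex_in by blast
  have oA: "openin ?T (A b)" if b: "b \<in> P" for b
    unfolding A_def
  proof (rule openin_Union, clarify)
    fix n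
    have "openin ?T {g \<in> ?O. \<tau> (vdot d n e) g \<in> b e}" if "e \<in> vertices d" for e
    proof -
      have "open (b e)" using b that \<B>(2) topological_basis_open unfolding P_def by blast
      moreover have "continuous_on ?O (\<tau> (vdot d n e))"
        by (rule continuous_on_subset[OF continuous_on_\<tau> orb_W[OF f]])
      ultimately have "openin ?T (?O \<inter> \<tau> (vdot d n e) -` b e)" using continuous_openin_preimage_gen by blast
      then show ?thesis by (simp add: vimage_def Int_def)
    qed
    then show "openin ?T (\<Inter>e\<in>vertices d. {g \<in> ?O. \<tau> (vdot d n e) g \<in> b e})"
      using finite_vertices ne by (intro openin_INT2) auto
  qed
  \<comment> \<open>The complement of the boundary of the open set A b, hence open and dense.\<close>
  define G where "G b = A b \<union> (?O - ?T closure_of A b)" for b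
  have oG: "openin ?T (G b)" if "b \<in> P" for b
    unfolding G_def using oA[OF that] by (intro openin_Un openin_diff closedin_closure_of) auto
  have dG: "?T closure_of G b = topspace ?T" if b: "b \<in> P" for b
  proof -
    have "?O \<subseteq> ?T closure_of G b"
    proof
      fix g assume g: "g \<in> ?O"
      show "g \<in> ?T closure_of G b"
      proof (cases "g \<in> ?T closure_of A b")
        case True
        then show ?thesis using closure_of_mono[of "A b" "G b" ?T] by (auto simp: G_def)
      next
        case False
        then have "g \<in> G b" using g by (simp add: G_def)
        then show ?thesis using closure_of_subset[of "G b" ?T] openin_subset[OF oG[OF b]] by blast
      qed
    qed
    then show ?thesis using closure_of_subset_topspace[of ?T "G b"] by auto
  qed
  define X0 where "X0 = ?O \<inter> \<Inter>(G ` P)"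
  have "?T closure_of \<Inter>(insert ?O (G ` P)) = topspace ?T"
  proof (rule Baire_category)
    have "compact_space ?T" using compact_orb by (simp add: compact_space_subtopology)
    moreover have "Hausdorff_space ?T" by (simp add: Hausdorff_space_subtopology)
    ultimately show "completely_metrizable_space ?T \<or> locally_compact_space ?T \<and> regular_space ?T"
      using compact_imp_locally_compact_space compact_Hausdorff_or_regular_imp_normal_space
        compact_Hausdorff_imp_regular_space by blast
    show "openin ?T S \<and> ?T closure_of S = topspace ?T" if "S \<in> insert ?O (G ` P)" for S
    proof (cases "S = ?O")
      case True
      then show ?thesis using closure_of_topspace[of ?T] by simp
    next
      case False
      then show ?thesis using that oG dG by auto
    qed
  qed (use cP in simp)
  then have dense: "?T closure_of X0 = ?O" by (simp add: X0_def)
  have gd: "gdelta_in ?T X0"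
  proof -
    have "gdelta_in ?T (\<Inter>(insert ?O (G ` P)))"
    proof (rule gdelta_in_Inter)
      show "gdelta_in ?T S" if "S \<in> insert ?O (G ` P)" for S
        using that oG by (intro open_imp_gdelta_in) auto
    qed (use cP in auto)
    then show ?thesis by (simp add: X0_def)
  qed
  have "z \<in> face_orbit_closure d (hc_subspace ?O) (\<tau> 1) g"
    if g: "g \<in> X0" and z: "z \<in> vertices d \<rightarrow>\<^sub>E ?O" "cube f z" "z (zero_vertex d) = g" for g z
  proof -
    have gO: "g \<in> ?O" using g by (simp add: X0_def)
    obtain p where p: "p \<in> \<Gamma>" "\<And>e. e \<in> vertices d \<Longrightarrow> z e = p e f" using z(2) by (auto simp: cube_def)
    have "\<exists>n. \<forall>e\<in>vertices d. dist (z e) (\<tau> (vdot d n e) g) < \<delta>" if \<delta>: "\<delta> > 0" for \<delta>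
    proof -
      have "\<exists>C. C \<in> \<B> \<and> z e \<in> C \<and> C \<subseteq> ball (z e) \<delta>" for e
        using topological_basisE[OF \<B>(2) open_ball[of "z e" \<delta>], of "z e"] \<delta> by (metis centre_in_ball)
      then obtain C where C: "\<And>e. C e \<in> \<B>" "\<And>e. z e \<in> C e" "\<And>e. C e \<subseteq> ball (z e) \<delta>" by metis
      let ?b = "restrict C (vertices d)"
      have bP: "?b \<in> P" using C(1) by (simp add: P_def)
      have oC: "open (C e)" for e using C(1) \<B>(2) topological_basis_open by blast
      have "g \<in> ?T closure_of A ?b"
        unfolding in_closure_of
      proof (intro conjI allI impI)
        show "g \<in> topspace ?T" using gO by simp
        fix V assume V: "g \<in> V \<and> openin ?T V"
        then obtain V' where V': "open V'" "V = ?O \<inter> V'" by (auto simp: openin_open)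
        let ?U = "{q. q (zero_vertex d) f \<in> V'} \<inter> (\<Inter>e\<in>vertices d. {q. q e f \<in> C e})"
        have o: "open {q::(nat \<Rightarrow> int) \<Rightarrow> hc \<Rightarrow> hc. q e f \<in> H}" if "open H" for e H
          using open_vimage[OF that continuous_on_eval2, of e f] by (simp add: vimage_def)
        have oU: "open ?U" by (intro open_Int open_INT ballI finite_vertices o V'(1) oC)
        have pU: "p \<in> ?U" using V V'(2) C(2) p(2)[symmetric] z(3) zero_vertex_in by auto
        obtain m n where mn: "\<gamma> m n \<in> ?U" by (rule \<Gamma>_meets_open[OF p(1) oU pU])
        have mV: "\<tau> m f \<in> V'" using IntD1[OF mn] by (simp add: \<gamma>_def zero_vertex_in)
        have mC: "\<tau> (vdot d n e) (\<tau> m f) \<in> C e" if "e \<in> vertices d" for e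
          using INT_D[OF IntD2[OF mn] that] that by (simp add: \<gamma>_def \<tau>_add add.commute)
        have mO: "\<tau> m f \<in> ?O" by (rule \<tau>o[OF orb_self])
        have "\<tau> m f \<in> A ?b" unfolding A_def using mC mO by auto
        then show "\<exists>y. y \<in> A ?b \<and> y \<in> V" using mV mO V'(2) by blast
      qed
      moreover have "g \<in> G ?b" using g bP by (auto simp: X0_def)
      ultimately have "g \<in> A ?b" by (simp add: G_def)
      then obtain n where "\<And>e. e \<in> vertices d \<Longrightarrow> \<tau> (vdot d n e) g \<in> C e" unfolding A_def by auto
      then show ?thesis using C(3) by (intro exI[of _ n]) (auto simp: subset_iff)
    qed
    then show ?thesis
      using face_orbit_closure_iff[OF T, of g z d] gO z(1) ziter_\<tau>[OF \<tau>o gO] by auto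
  qed
  then show ?thesis using that gd dense by blast
qed

end

section \<open>Coding a minimal system as a shift\<close>

text \<open>An index codes a time \<open>n\<close>, the number \<open>i\<close> of a point of a dense sequence and a
tag.\<close>

definition enc :: "int \<times> nat \<times> bool \<Rightarrow> nat" where "enc = to_nat_on UNIV"

definition dec :: "nat \<Rightarrow> int \<times> nat \<times> bool" where "dec = from_nat_into UNIV"

lemma infinite_codes: "infinite (UNIV :: (int \<times> nat \<times> bool) set)"
  by (simp add: finite_prod infinite_UNIV_int)

lemma dec_enc [simp]: "dec (enc x) = x"
  by (simp add: enc_def dec_def)

lemma enc_dec [simp]: "enc (dec j) = j"
  unfolding enc_def dec_def by (rule to_nat_on_from_nat_into_infinite[OF _ infinite_codes]) simp

definition shift :: "int \<Rightarrow> nat \<Rightarrow> nat" where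
  "shift m j = (case dec j of (n, i, b) \<Rightarrow> enc (n + m, i, b))"

definition code_tag :: "nat \<Rightarrow> bool" where "code_tag j = snd (snd (dec j))"

text \<open>Reading a sequence along \<open>retag c\<close> extracts the member with tag \<open>c\<close> of a stored
pair.\<close>

definition retag :: "bool \<Rightarrow> nat \<Rightarrow> nat" where
  "retag c j = (case dec j of (n, i, b) \<Rightarrow> enc (n, i, c))"

lemma shift_0: "shift 0 = id"
  by (rule ext) (simp add: shift_def split_beta)

lemma shift_add: "shift (m + n) = shift m \<circ> shift n"
  by (rule ext) (simp add: shift_def split_beta add_ac)

lemma shift_retag: "shift n \<circ> retag c = retag c \<circ> shift n"
  by (rule ext) (simp add: shift_def retag_def split_beta)

locale coded_system =
  fixes X :: "'a metric" and T :: "'a \<Rightarrow> 'a" and a :: "nat \<Rightarrow> 'a" and B :: real and k :: nat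
  assumes minimal: "minimal_tds X T"
    and a_in: "\<And>i. a i \<in> mspace X"
    and a_dense: "\<And>x \<delta>. x \<in> mspace X \<Longrightarrow> \<delta> > 0 \<Longrightarrow> \<exists>i. mdist X (a i) x < \<delta>"
    and B_bound: "\<And>x y. x \<in> mspace X \<Longrightarrow> y \<in> mspace X \<Longrightarrow> mdist X x y \<le> B"
begin

sublocale shift_system shift B "Suc k"
proof
  show "0 \<le> B" using B_bound[OF a_in a_in, of 0 0] mdist_refl[OF a_in] by metis
qed (simp_all add: shift_0 shift_add)

text \<open>A point is coded by the distances of all its iterates to a dense sequence. Shifting the time then
represents \<open>T\<close>, and the coordinates at time 0 have the peak property.\<close>

definition \<iota> :: "'a \<Rightarrow> hc" where
  "\<iota> x = (\<lambda>j. case dec j of (n, i, b) \<Rightarrow> mdist X (a i) (ziter X T n x))"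

abbreviation X_coded :: "hc set" where "X_coded \<equiv> \<iota> ` mspace X"

definition \<kappa> :: "hc \<Rightarrow> 'a" where "\<kappa> = inv_into (mspace X) \<iota>"

lemma tds: "tds X T" using minimal by (simp add: minimal_tds_def)

lemma T_bij: "bij_betw T (mspace X) (mspace X)" using tds by (rule tds_bij)

lemma compact_space_X: "compact_space (mtopology_of X)" using tds by (simp add: tds_def)

lemma \<iota>_W: "x \<in> mspace X \<Longrightarrow> \<iota> x \<in> W"
  using B_bound[OF a_in ziter_in[OF T_bij]] by (auto simp: W_def \<iota>_def split_beta)

lemma \<tau>_\<iota>: assumes "x \<in> mspace X" shows "\<tau> m (\<iota> x) = \<iota> (ziter X T m x)"
proof
  fix j show "\<tau> m (\<iota> x) j = \<iota> (ziter X T m x) j"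
    by (simp add: \<tau>_apply[OF \<iota>_W[OF assms]]) (simp add: \<iota>_def shift_def split_beta ziter_add[OF T_bij assms])
qed

lemma \<iota>_value: "\<iota> x (enc (0, i, b)) = mdist X (a i) x" by (simp add: \<iota>_def)

lemma \<iota>_inj: "inj_on \<iota> (mspace X)"
proof (rule inj_onI)
  fix x y assume x: "x \<in> mspace X" and y: "y \<in> mspace X" and eq: "\<iota> x = \<iota> y"
  have d: "mdist X (a i) x = mdist X (a i) y" for i using eq \<iota>_value by metis
  have "mdist X x y \<le> \<delta>" if \<delta>: "\<delta> > 0" for \<delta>
  proof -
    have "\<delta> / 2 > 0" using \<delta> by simp
    then obtain i where "mdist X (a i) x < \<delta> / 2" using a_dense[OF x] by blast
    then show ?thesis using mdist_triangle[OF x a_in y, of i] d[of i] mdist_commute[of X x "a i"] by simp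
  qed
  then have "mdist X x y \<le> 0" by (meson dense_ge)
  then have "mdist X x y = 0" using mdist_nonneg[of X x y] by linarith
  then show "x = y" using x y by simp
qed

lemma \<kappa>_\<iota>: "x \<in> mspace X \<Longrightarrow> \<kappa> (\<iota> x) = x" unfolding \<kappa>_def by (rule inv_into_f_f[OF \<iota>_inj])

lemma \<kappa>_in: "f \<in> X_coded \<Longrightarrow> \<kappa> f \<in> mspace X" and \<iota>_\<kappa>: "f \<in> X_coded \<Longrightarrow> \<iota> (\<kappa> f) = f"
  by (auto simp: \<kappa>_\<iota>)

lemma continuous_T_power: "continuous_map (mtopology_of X) (mtopology_of X) (ziter X T n)"
proof -
  have pow: "continuous_map (mtopology_of X) (mtopology_of X) (f ^^ j)"
    if "continuous_map (mtopology_of X) (mtopology_of X) f" for f j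
  proof (induction j)
    case (Suc j)
    show ?case using continuous_map_compose[OF Suc that] by (simp only: funpow.simps)
  qed (simp add: id_def)
  obtain g where g: "homeomorphic_maps (mtopology_of X) (mtopology_of X) T g"
    using tds homeomorphic_map_maps unfolding tds_def by blast
  have gc: "continuous_map (mtopology_of X) (mtopology_of X) g"
    and Tc: "continuous_map (mtopology_of X) (mtopology_of X) T"
    and Tg: "\<And>y. y \<in> mspace X \<Longrightarrow> T (g y) = y"
    using g unfolding homeomorphic_maps_def topspace_mtopology_of by blast+
  have eq: "g y = inv_into (mspace X) T y" if y: "y \<in> mspace X" for y
  proof -
    have "g y \<in> mspace X" using continuous_map_image_subset_topspace[OF gc] y by auto
    then show ?thesis using inv_into_f_f[OF bij_betw_imp_inj_on[OF T_bij], of "g y"] Tg[OF y] by simp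
  qed
  have "continuous_map (mtopology_of X) (mtopology_of X) (inv_into (mspace X) T)"
    by (rule continuous_map_eq[OF gc]) (simp only: topspace_mtopology_of eq)
  then show ?thesis unfolding ziter_def using pow[OF Tc] pow by (cases "0 \<le> n") simp_all
qed

lemma \<iota>_continuous: "continuous_map (mtopology_of X) (top_of_set X_coded) \<iota>"
proof -
  have "continuous_map (mtopology_of X) (product_topology (\<lambda>_. euclidean) UNIV) \<iota>"
    unfolding continuous_map_componentwise_UNIV
  proof
    fix j
    have "continuous_map (mtopology_of X) euclidean
        (\<lambda>x. mdist X (a (fst (snd (dec j)))) (ziter X T (fst (dec j)) x))"
      by (rule continuous_map_mdist) (simp_all add: continuous_T_power a_in)
    then show "continuous_map (mtopology_of X) euclidean (\<lambda>x. \<iota> x j)"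
      by (simp add: \<iota>_def split_beta)
  qed
  then show ?thesis
    unfolding euclidean_product_topology by (simp add: continuous_map_in_subtopology)
qed

lemma \<iota>_homeomorphic: "homeomorphic_map (mtopology_of X) (top_of_set X_coded) \<iota>"
  by (rule continuous_imp_homeomorphic_map[OF \<iota>_continuous compact_space_X])
    (auto simp: \<iota>_inj Hausdorff_space_subtopology)

lemma \<kappa>_continuous: "continuous_map (top_of_set X_coded) (mtopology_of X) \<kappa>"
proof -
  obtain g where g: "homeomorphic_maps (mtopology_of X) (top_of_set X_coded) \<iota> g"
    using \<iota>_homeomorphic homeomorphic_map_maps by blast
  have gc: "continuous_map (top_of_set X_coded) (mtopology_of X) g" and gi: "\<And>x. x \<in> mspace X \<Longrightarrow> g (\<iota> x) = x"
    using g unfolding homeomorphic_maps_def topspace_mtopology_of by blast+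
  show ?thesis
  proof (rule continuous_map_eq[OF gc])
    fix f assume "f \<in> topspace (top_of_set X_coded)"
    then obtain x where x: "x \<in> mspace X" "f = \<iota> x" by auto
    show "g f = \<kappa> f" unfolding x(2) gi[OF x(1)] \<kappa>_\<iota>[OF x(1)] by (rule refl)
  qed
qed

lemma compact_X_coded: "compact X_coded"
proof -
  have "compactin (top_of_set X_coded) (\<iota> ` mspace X)"
    using image_compactin[OF _ \<iota>_continuous, of "mspace X"] compact_space_X
    by (simp only: compact_space_def topspace_mtopology_of)
  then show ?thesis by (simp add: compactin_subtopology)
qed

lemma \<iota>_uniform: assumes "\<delta> > 0"
  obtains \<eta> where "\<eta> > 0" "\<And>x y. x \<in> mspace X \<Longrightarrow> y \<in> mspace X \<Longrightarrow> mdist X x y < \<eta> \<Longrightarrow> dist (\<iota> x) (\<iota> y) < \<delta>"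
proof -
  have "uniformly_continuous_map X (hc_subspace X_coded) \<iota>"
    by (rule continuous_imp_uniformly_continuous_map) (simp add: compact_space_X \<iota>_continuous)
  then show ?thesis using assms that unfolding uniformly_continuous_map_def by (metis hc_subspace_simps(2))
qed

lemma \<kappa>_uniform: assumes "\<delta> > 0"
  obtains \<eta> where "\<eta> > 0" "\<And>x y. x \<in> mspace X \<Longrightarrow> y \<in> mspace X \<Longrightarrow> dist (\<iota> x) (\<iota> y) < \<eta> \<Longrightarrow> mdist X x y < \<delta>"
proof -
  have "uniformly_continuous_map (hc_subspace X_coded) X \<kappa>"
    by (rule continuous_imp_uniformly_continuous_map)
      (simp add: compact_space_subtopology compact_X_coded \<kappa>_continuous)
  then obtain \<eta> where \<eta>: "\<eta> > 0" "\<forall>f\<in>X_coded. \<forall>g\<in>X_coded. dist g f < \<eta> \<longrightarrow> mdist X (\<kappa> g) (\<kappa> f) < \<delta>"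
    using assms unfolding uniformly_continuous_map_def by (metis hc_subspace_simps(1,2))
  then have "mdist X x y < \<delta>" if "x \<in> mspace X" "y \<in> mspace X" "dist (\<iota> x) (\<iota> y) < \<eta>" for x y
    using that \<kappa>_\<iota> by (metis imageI)
  then show ?thesis using that \<eta>(1) by blast
qed

lemma X_coded_minimal: assumes "f \<in> X_coded" shows "X_coded \<subseteq> closure (range (\<lambda>n. \<tau> n f))"
proof -
  obtain x where x: "x \<in> mspace X" "f = \<iota> x" using assms by blast
  have "mtopology_of X closure_of {ziter X T n x |n. True} = mspace X"
    using minimal x(1) by (simp add: minimal_tds_def)
  then have "\<iota> ` mspace X \<subseteq> top_of_set X_coded closure_of (\<iota> ` {ziter X T n x |n. True})"
    using continuous_map_image_closure_subset[OF \<iota>_continuous, of "{ziter X T n x |n. True}"] by simp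
  also have "\<dots> \<subseteq> closure (\<iota> ` {ziter X T n x |n. True})"
    by (auto simp: closure_of_subtopology intro: subsetD[OF closure_mono[OF Int_lower2]])
  also have "\<iota> ` {ziter X T n x |n. True} = range (\<lambda>n. \<tau> n f)"
    using \<tau>_\<iota>[OF x(1)] x(2) by auto
  finally show ?thesis .
qed

lemma \<iota>_peak:
  assumes x: "x \<in> X_coded" and \<delta>: "\<delta> > 0"
  shows "\<exists>K \<eta>. x K < \<eta> \<and> (\<forall>y\<in>X_coded. y K < \<eta> \<longrightarrow> dist x y < \<delta>)"
proof -
  obtain x' where x': "x' \<in> mspace X" "x = \<iota> x'" using x by blast
  obtain \<eta> where \<eta>: "\<eta> > 0" "\<And>x y. x \<in> mspace X \<Longrightarrow> y \<in> mspace X \<Longrightarrow> mdist X x y < \<eta> \<Longrightarrow> dist (\<iota> x) (\<iota> y) < \<delta>"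
    using \<iota>_uniform[OF \<delta>] by metis
  have "\<eta> / 2 > 0" using \<eta>(1) by simp
  then obtain i where i: "mdist X (a i) x' < \<eta> / 2" using a_dense[OF x'(1)] by blast
  have "dist x y < \<delta>" if y: "y \<in> X_coded" "y (enc (0, i, True)) < \<eta> / 2" for y
  proof -
    obtain y' where y': "y' \<in> mspace X" "y = \<iota> y'" using y by blast
    have "mdist X (a i) y' < \<eta> / 2" using y(2) y'(2) \<iota>_value by simp
    then have "mdist X x' y' < \<eta>"
      using mdist_triangle[OF x'(1) a_in y'(1), of i] i mdist_commute[of X x' "a i"] by simp
    then show ?thesis using \<eta>(2) x' y' by blast
  qed
  then show ?thesis using i x'(2) \<iota>_value by (intro exI[of _ "enc (0, i, True)"] exI[of _ "\<eta> / 2"]) auto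
qed

lemma \<iota>_retag: "\<iota> x \<circ> retag c = \<iota> x"
  by (rule ext) (simp add: \<iota>_def retag_def split_beta)

end

locale coded_minimal_system = coded_system + idempotent_shift shift B "Suc k" u for u +
  fixes x0 :: hc
  assumes x0: "x0 \<in> X_coded" "u x0 = x0"
begin

sublocale tagged_minimal_shift shift B "Suc k" u X_coded x0 k code_tag "retag True" "retag False"
proof
  show "closed X_coded" by (rule compact_imp_closed[OF compact_X_coded])
  show "\<tau> n f \<in> X_coded" if "f \<in> X_coded" for n f using that \<tau>_\<iota> ziter_in[OF T_bij] by auto
  show "code_tag (shift n j) = code_tag j" for n j by (simp add: code_tag_def shift_def split_beta)
  show "code_tag (retag True j)" "\<not> code_tag (retag False j)" for j
    by (simp_all add: code_tag_def retag_def split_beta)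
  show "\<exists>K \<eta>. x K < \<eta> \<and> (\<forall>y\<in>X_coded. y K < \<eta> \<longrightarrow> dist x y < \<delta>)" if "x \<in> X_coded" "\<delta> > 0" for x \<delta>
    using \<iota>_peak[OF that] .
  show "X_coded \<subseteq> closure (range (\<lambda>n. \<tau> n f))" if "f \<in> X_coded" for f using X_coded_minimal[OF that] .
qed (use \<iota>_W x0 \<iota>_retag shift_retag in \<open>auto\<close>)

text \<open>Regional proximality does not depend on the choice of the metric, since \<open>\<iota>\<close> and its
inverse are uniformly continuous.\<close>

lemma RP_iff_R: assumes x: "x \<in> mspace X" and y: "y \<in> mspace X"
  shows "(x, y) \<in> RP k X T \<longleftrightarrow> R (\<iota> x) (\<iota> y)"
proof
  assume RP: "(x, y) \<in> RP k X T"
  show "R (\<iota> x) (\<iota> y)"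
    unfolding R_def
  proof (intro conjI allI impI imageI x y)
    fix \<delta> :: real assume "\<delta> > 0"
    then obtain \<eta> where \<eta>: "\<eta> > 0" "\<And>x y. x \<in> mspace X \<Longrightarrow> y \<in> mspace X \<Longrightarrow> mdist X x y < \<eta> \<Longrightarrow> dist (\<iota> x) (\<iota> y) < \<delta>"
      using \<iota>_uniform by metis
    obtain x' y' n where *: "x' \<in> mspace X" "y' \<in> mspace X" "mdist X x x' < \<eta>" "mdist X y y' < \<eta>"
      "\<And>e. e \<in> vertices k - {zero_vertex k} \<Longrightarrow>
         mdist X (ziter X T (vdot k n e) x') (ziter X T (vdot k n e) y') < \<eta>"
      using RP \<eta>(1) unfolding RP_def by blast
    show "\<exists>x'\<in>X_coded. \<exists>y'\<in>X_coded. \<exists>n. dist (\<iota> x) x' < \<delta> \<and> dist (\<iota> y) y' < \<delta> \<and>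
      (\<forall>e\<in>vertices k - {zero_vertex k}. dist (\<tau> (vdot k n e) x') (\<tau> (vdot k n e) y') < \<delta>)"
      using * x y ziter_in[OF T_bij]
      by (intro bexI[of _ "\<iota> x'"] bexI[of _ "\<iota> y'"] exI[of _ n]) (auto simp: \<tau>_\<iota> \<eta>(2))
  qed
next
  assume R: "R (\<iota> x) (\<iota> y)"
  have "\<exists>x'\<in>mspace X. \<exists>y'\<in>mspace X. \<exists>n. mdist X x x' < \<delta> \<and> mdist X y y' < \<delta> \<and>
      (\<forall>e\<in>vertices k - {zero_vertex k}. mdist X (ziter X T (vdot k n e) x') (ziter X T (vdot k n e) y') < \<delta>)"
    if \<delta>: "\<delta> > 0" for \<delta>
  proof -
    obtain \<eta> where \<eta>: "\<eta> > 0" "\<And>x y. x \<in> mspace X \<Longrightarrow> y \<in> mspace X \<Longrightarrow> dist (\<iota> x) (\<iota> y) < \<eta> \<Longrightarrow> mdist X x y < \<delta>"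
      using \<kappa>_uniform[OF \<delta>] by metis
    obtain f g n where fg: "f \<in> X_coded" "g \<in> X_coded" "dist (\<iota> x) f < \<eta>" "dist (\<iota> y) g < \<eta>"
      "\<And>e. e \<in> vertices k - {zero_vertex k} \<Longrightarrow> dist (\<tau> (vdot k n e) f) (\<tau> (vdot k n e) g) < \<eta>"
      using R \<eta>(1) unfolding R_def by blast
    obtain x' y' where *: "x' \<in> mspace X" "y' \<in> mspace X" "f = \<iota> x'" "g = \<iota> y'" using fg(1,2) by blast
    show ?thesis
      using * fg(3-) x y ziter_in[OF T_bij]
      by (intro bexI[of _ x'] bexI[of _ y'] exI[of _ n]) (auto simp: \<tau>_\<iota> \<eta>(2))
  qed
  then show "(x, y) \<in> RP k X T" using x y by (auto simp: RP_def)
qed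

lemma pronil_map_eq_iff:
  assumes x: "x \<in> mspace X" and y: "y \<in> mspace X"
  shows "pronil_map k X T x = pronil_map k X T y \<longleftrightarrow> (x, y) \<in> RP k X T"
proof
  assume "pronil_map k X T x = pronil_map k X T y"
  moreover have "(y, y) \<in> RP k X T" using RP_iff_R[OF y y] R_refl y by blast
  ultimately show "(x, y) \<in> RP k X T" by (auto simp: pronil_map_def)
next
  assume xy: "(x, y) \<in> RP k X T"
  have "(x, z) \<in> RP k X T \<longleftrightarrow> (y, z) \<in> RP k X T" for z
  proof (cases "z \<in> mspace X")
    case True
    then show ?thesis using xy RP_iff_R x y R_trans R_sym by meson
  next
    case False
    then show ?thesis by (auto simp: RP_def)
  qed
  then show "pronil_map k X T x = pronil_map k X T y" by (auto simp: pronil_map_def)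
qed

lemma pronil_action_map:
  assumes x: "x \<in> mspace X"
  shows "pronil_action T (pronil_map k X T x) = pronil_map k X T (T x)"
proof -
  have Tin: "T y \<in> mspace X" if "y \<in> mspace X" for y using bij_betw_apply[OF T_bij that] .
  have iff: "(x, y) \<in> RP k X T \<longleftrightarrow> (T x, T y) \<in> RP k X T" if y: "y \<in> mspace X" for y
  proof -
    have t: "\<iota> (T z) = \<tau> 1 (\<iota> z)" if "z \<in> mspace X" for z using \<tau>_\<iota>[OF that, of 1] by simp
    have "R (\<iota> x) (\<iota> y) \<longleftrightarrow> R (\<tau> 1 (\<iota> x)) (\<tau> 1 (\<iota> y))"
      using R_\<tau>[of "\<iota> x" "\<iota> y" 1] R_\<tau>[of "\<tau> 1 (\<iota> x)" "\<tau> 1 (\<iota> y)" "-1"] by (auto simp: \<tau>_add)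
    then show ?thesis using RP_iff_R x y Tin t by simp
  qed
  show ?thesis
  proof
    show "pronil_action T (pronil_map k X T x) \<subseteq> pronil_map k X T (T x)"
      using iff by (auto simp: pronil_action_def pronil_map_def RP_def)
    show "pronil_map k X T (T x) \<subseteq> pronil_action T (pronil_map k X T x)"
    proof
      fix w assume "w \<in> pronil_map k X T (T x)"
      then have w: "(T x, w) \<in> RP k X T" by (simp add: pronil_map_def)
      then have "w \<in> mspace X" by (auto simp: RP_def)
      then obtain y where y: "y \<in> mspace X" "w = T y" using bij_betw_imp_surj_on[OF T_bij] by blast
      then show "w \<in> pronil_action T (pronil_map k X T x)"
        using iff[OF y(1)] w by (auto simp: pronil_action_def pronil_map_def)
    qed
  qed
qed

section \<open>The extension and its factor maps\<close>

definition to_X :: "hc \<Rightarrow> 'a" where "to_X f = \<kappa> (f \<circ> retag True)"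

definition to_Y :: "hc \<Rightarrow> hc" where "to_Y f = f \<circ> retag False"

text \<open>The chosen \<open>p\<close> is immaterial by \<open>to_Z_\<psi>0\<close>.\<close>

definition to_Z :: "hc \<Rightarrow> 'a set" where
  "to_Z g = pronil_map k X T (\<kappa> ((SOME p. p \<in> E \<and> p \<psi>0 = g) x0))"

lemma E_x0: "p \<in> E \<Longrightarrow> p x0 \<in> X_coded" using E_X x0_X by blast

lemma to_X_\<xi>0: "p \<in> E \<Longrightarrow> to_X (p \<xi>0) = \<kappa> (p x0)" by (simp add: to_X_def E_\<xi>0_lm)

lemma to_Y_\<xi>0: "p \<in> E \<Longrightarrow> to_Y (p \<xi>0) = p \<psi>0" by (simp add: to_Y_def E_\<xi>0_rm)

lemma pronil_\<kappa>_eq_iff: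
  assumes "p \<in> E" "q \<in> E"
  shows "pronil_map k X T (\<kappa> (p x0)) = pronil_map k X T (\<kappa> (q x0)) \<longleftrightarrow> R (p x0) (q x0)"
  using pronil_map_eq_iff[OF \<kappa>_in \<kappa>_in] RP_iff_R[OF \<kappa>_in \<kappa>_in] E_x0[OF assms(1)] E_x0[OF assms(2)]
  by (simp add: \<iota>_\<kappa>)

lemma to_Z_\<psi>0: assumes p: "p \<in> E" shows "to_Z (p \<psi>0) = pronil_map k X T (\<kappa> (p x0))"
proof -
  let ?q = "SOME q. q \<in> E \<and> q \<psi>0 = p \<psi>0"
  have "?q \<in> E \<and> ?q \<psi>0 = p \<psi>0" by (rule someI[of _ p]) (use p in simp)
  then show ?thesis unfolding to_Z_def using pronil_\<kappa>_eq_iff R_of_\<psi>0_eq p by blast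
qed

lemma \<tau>_E: "p \<in> E \<Longrightarrow> \<tau> n \<circ> p \<in> E" by (rule E_mult[OF \<tau>_in_E])

lemma \<kappa>_\<tau>: "f \<in> X_coded \<Longrightarrow> \<kappa> (\<tau> 1 f) = T (\<kappa> f)"
  using \<tau>_\<iota>[of "\<kappa> f" 1] \<kappa>_in[of f] \<iota>_\<kappa>[of f] \<kappa>_\<iota>[of "T (\<kappa> f)"] bij_betw_apply[OF T_bij, of "\<kappa> f"] by simp

lemma orbE: assumes "f \<in> orb g" obtains p where "p \<in> E" "f = p g"
  using assms by (auto simp: orb_def)

lemma orbI: "p \<in> E \<Longrightarrow> p g \<in> orb g" by (simp add: orb_def)

lemma factor_to_X: "factor_map (mtopology_of (hc_subspace (orb \<xi>0))) (\<tau> 1) (mtopology_of X) T to_X"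
  unfolding factor_map_def
proof (intro conjI ballI)
  have "continuous_map (top_of_set (orb \<xi>0)) (top_of_set X_coded) (\<lambda>f. f \<circ> retag True)"
    using E_\<xi>0_lm E_x0 by (auto simp: continuous_on_reindex elim!: orbE)
  then have "continuous_map (top_of_set (orb \<xi>0)) (mtopology_of X) (\<kappa> \<circ> (\<lambda>f. f \<circ> retag True))"
    by (rule continuous_map_compose[OF _ \<kappa>_continuous])
  moreover have "to_X = \<kappa> \<circ> (\<lambda>f. f \<circ> retag True)" by (rule ext) (simp add: to_X_def)
  ultimately show "continuous_map (mtopology_of (hc_subspace (orb \<xi>0))) (mtopology_of X) to_X"
    by (simp only: hc_subspace_simps)
  have "to_X ` orb \<xi>0 = mspace X"
  proof
    show "to_X ` orb \<xi>0 \<subseteq> mspace X" using to_X_\<xi>0 E_x0 \<kappa>_in by (auto elim!: orbE)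
    show "mspace X \<subseteq> to_X ` orb \<xi>0"
    proof
      fix x assume x: "x \<in> mspace X"
      then obtain p where p: "p \<in> E" "p x0 = \<iota> x" using X_orbit[OF x0_X, of "\<iota> x"] by blast
      then have "x = to_X (p \<xi>0)" using to_X_\<xi>0 \<kappa>_\<iota>[OF x] by simp
      then show "x \<in> to_X ` orb \<xi>0" using orbI[OF p(1)] by blast
    qed
  qed
  then show "to_X ` topspace (mtopology_of (hc_subspace (orb \<xi>0))) = topspace (mtopology_of X)" by simp
  fix f assume "f \<in> topspace (mtopology_of (hc_subspace (orb \<xi>0)))"
  then obtain p where p: "p \<in> E" "f = p \<xi>0" by (auto elim!: orbE)
  show "to_X (\<tau> 1 f) = T (to_X f)"
    using to_X_\<xi>0[OF \<tau>_E[OF p(1), of 1]] to_X_\<xi>0[OF p(1)] \<kappa>_\<tau>[OF E_x0[OF p(1)]] by (simp add: p(2))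
qed

lemma factor_to_Y: "factor_map (mtopology_of (hc_subspace (orb \<xi>0))) (\<tau> 1) (mtopology_of (hc_subspace (orb \<psi>0))) (\<tau> 1) to_Y"
  unfolding factor_map_def
proof (intro conjI ballI)
  have im: "to_Y ` orb \<xi>0 = orb \<psi>0"
    unfolding orb_def image_image by (intro image_cong refl) (simp add: to_Y_\<xi>0)
  then show "to_Y ` topspace (mtopology_of (hc_subspace (orb \<xi>0))) = topspace (mtopology_of (hc_subspace (orb \<psi>0)))" by simp
  have "continuous_on (orb \<xi>0) to_Y" unfolding to_Y_def by (rule continuous_on_reindex)
  then show "continuous_map (mtopology_of (hc_subspace (orb \<xi>0))) (mtopology_of (hc_subspace (orb \<psi>0))) to_Y"
    using im by auto
  fix f assume "f \<in> topspace (mtopology_of (hc_subspace (orb \<xi>0)))"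
  then obtain p where p: "p \<in> E" "f = p \<xi>0" by (auto elim!: orbE)
  show "to_Y (\<tau> 1 f) = \<tau> 1 (to_Y f)"
    using to_Y_\<xi>0[OF \<tau>_E[OF p(1), of 1]] to_Y_\<xi>0[OF p(1)] by (simp add: p(2))
qed

lemma diagram: assumes "f \<in> orb \<xi>0" shows "pronil_map k X T (to_X f) = to_Z (to_Y f)"
  using assms by (auto elim!: orbE simp: to_X_\<xi>0 to_Y_\<xi>0 to_Z_\<psi>0)

text \<open>Continuity holds because \<open>to_Y\<close> is a quotient map, and the composition of \<open>to_Z\<close> with
it is the composition of two continuous maps through \<open>X\<close>.\<close>

lemma factor_to_Z:
  "factor_map (mtopology_of (hc_subspace (orb \<psi>0))) (\<tau> 1) (pronil_space k X T) (pronil_action T) to_Z"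
  unfolding factor_map_def
proof (intro conjI ballI)
  have Y: "continuous_map (top_of_set (orb \<xi>0)) (top_of_set (orb \<psi>0)) to_Y"
      "to_Y ` orb \<xi>0 = orb \<psi>0"
    and X: "continuous_map (top_of_set (orb \<xi>0)) (mtopology_of X) to_X" "to_X ` orb \<xi>0 = mspace X"
    using factor_to_Y factor_to_X by (auto simp: factor_map_def)
  have "quotient_map (top_of_set (orb \<xi>0)) (top_of_set (orb \<psi>0)) to_Y"
    by (rule continuous_imp_quotient_map[OF Y(1)])
      (simp_all add: Y(2) compact_space_subtopology compact_orb Hausdorff_space_subtopology)
  moreover have "continuous_map (top_of_set (orb \<xi>0)) (pronil_space k X T) (to_Z \<circ> to_Y)"
    by (rule continuous_map_eq[OF continuous_map_compose[OF X(1) quotient_imp_continuous_map[OF quotient_map_pronil_map]]])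
      (simp add: diagram)
  ultimately show "continuous_map (mtopology_of (hc_subspace (orb \<psi>0))) (pronil_space k X T) to_Z"
    unfolding hc_subspace_simps by (rule continuous_compose_quotient_map)
  have "to_Z ` orb \<psi>0 = to_Z ` (to_Y ` orb \<xi>0)" by (simp only: Y(2))
  also have "\<dots> = (\<lambda>f. to_Z (to_Y f)) ` orb \<xi>0" by (simp only: image_image)
  also have "\<dots> = (\<lambda>f. pronil_map k X T (to_X f)) ` orb \<xi>0"
    by (rule image_cong) (simp_all add: diagram)
  also have "\<dots> = pronil_map k X T ` (to_X ` orb \<xi>0)" by (simp only: image_image)
  also have "\<dots> = pronil_map k X T ` mspace X" by (simp only: X(2))
  also have "\<dots> = topspace (pronil_space k X T)"
    by (auto simp: topspace_pronil_space pronil_map_def quotient_def)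
  finally show "to_Z ` topspace (mtopology_of (hc_subspace (orb \<psi>0))) = topspace (pronil_space k X T)" by simp
  fix g assume "g \<in> topspace (mtopology_of (hc_subspace (orb \<psi>0)))"
  then obtain p where p: "p \<in> E" "g = p \<psi>0" by (auto elim!: orbE)
  show "to_Z (\<tau> 1 g) = pronil_action T (to_Z g)"
    using to_Z_\<psi>0[OF \<tau>_E[OF p(1), of 1]] to_Z_\<psi>0[OF p(1)] \<kappa>_\<tau>[OF E_x0[OF p(1)]]
      pronil_action_map[OF \<kappa>_in[OF E_x0[OF p(1)]]] by (simp add: p(2))
qed

lemma proximal_to_Z:
  "proximal_extension (hc_subspace (orb \<psi>0)) (\<tau> 1) (pronil_space k X T) (pronil_action T) to_Z"
  unfolding proximal_extension_def
proof (intro conjI ballI impI factor_to_Z)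
  fix f g assume fg: "f \<in> mspace (hc_subspace (orb \<psi>0))" "g \<in> mspace (hc_subspace (orb \<psi>0))" "to_Z f = to_Z g"
  obtain p where p: "p \<in> E" "f = p \<psi>0" using fg(1) by (auto elim!: orbE)
  obtain q where q: "q \<in> E" "g = q \<psi>0" using fg(2) by (auto elim!: orbE)
  have "R (p x0) (q x0)" using fg(3) p q to_Z_\<psi>0 pronil_\<kappa>_eq_iff by simp
  then have "u f = u g" using u_\<psi>0_eq_of_R p q by simp
  then show "proximal (hc_subspace (orb \<psi>0)) (\<tau> 1) f g"
    by (intro proximal_of_u_eq) (use fg E_orb[OF \<tau>_in_E] in auto)
qed

lemma proximal_to_X:
  "proximal_extension (hc_subspace (orb \<xi>0)) (\<tau> 1) (mtopology_of X) T to_X"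
  unfolding proximal_extension_def
proof (intro conjI ballI impI factor_to_X)
  fix f g assume fg: "f \<in> mspace (hc_subspace (orb \<xi>0))" "g \<in> mspace (hc_subspace (orb \<xi>0))" "to_X f = to_X g"
  obtain p where p: "p \<in> E" "f = p \<xi>0" using fg(1) by (auto elim!: orbE)
  obtain q where q: "q \<in> E" "g = q \<xi>0" using fg(2) by (auto elim!: orbE)
  have eq: "p x0 = q x0" using fg(3) p q to_X_\<xi>0 \<iota>_\<kappa> E_x0 by metis
  then have "R (p x0) (q x0)" using R_refl E_x0[OF q(1)] by simp
  then have "u (p \<psi>0) = u (q \<psi>0)" by (rule u_\<psi>0_eq_of_R[OF p(1) q(1)])
  moreover have "u (r \<xi>0) = mix (u (r x0)) (u (r \<psi>0))" if "r \<in> E" for r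
    using E_\<xi>0[OF E_mult[OF u_E that]] by simp
  ultimately have "u f = u g" using p q eq by simp
  then show "proximal (hc_subspace (orb \<xi>0)) (\<tau> 1) f g"
    by (intro proximal_of_u_eq) (use fg E_orb[OF \<tau>_in_E] in auto)
qed

text \<open>For generic \<open>g\<close> the face orbit closure is the set of all cubes with first coordinate
\<open>g\<close>. Given a point \<open>z\<close> over the image of such a cube, putting \<open>g\<close> back at the
zero vertex gives a cube by \<open>cube_saturated\<close>.\<close>

lemma characteristic_to_Y:
  "cubic_characteristic_factor (Suc k) (hc_subspace (orb \<xi>0)) (\<tau> 1) (hc_subspace (orb \<psi>0)) (\<tau> 1) to_Y"
proof -
  obtain X0 where X0: "gdelta_in (top_of_set (orb \<xi>0)) X0" "top_of_set (orb \<xi>0) closure_of X0 = orb \<xi>0"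
    "\<And>g z. \<lbrakk>g \<in> X0; z \<in> vertices (Suc k) \<rightarrow>\<^sub>E orb \<xi>0; cube \<xi>0 z; z (zero_vertex (Suc k)) = g\<rbrakk> \<Longrightarrow>
       z \<in> face_orbit_closure (Suc k) (hc_subspace (orb \<xi>0)) (\<tau> 1) g"
    using generic_face_orbit_closure[OF \<xi>0_W] by metis
  have "saturated (Suc k) (hc_subspace (orb \<xi>0)) to_Y (face_fibre (Suc k) (hc_subspace (orb \<xi>0)) (\<tau> 1) g)"
    if g: "g \<in> X0" for g
  proof -
    let ?V = "vertices (Suc k)" and ?P = "punctured_vertices (Suc k)" and ?o = "zero_vertex (Suc k)"
    let ?C = "face_orbit_closure (Suc k) (hc_subspace (orb \<xi>0)) (\<tau> 1) g"
    let ?F = "face_fibre (Suc k) (hc_subspace (orb \<xi>0)) (\<tau> 1) g"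
    have gO: "g \<in> orb \<xi>0" using gdelta_in_subset[OF X0(1)] g by auto
    have sub: "z \<in> ?P \<rightarrow>\<^sub>E orb \<xi>0" if zF: "z \<in> ?F" for z
    proof -
      obtain y where "y \<in> ?C" "z = restrict y ?P" using zF by (auto simp: face_fibre_def)
      then show ?thesis using face_orbit_closure_cube(1)[OF \<xi>0_W gO, of y]
        by (auto simp: punctured_vertices_def PiE_iff)
    qed
    have sat: "z \<in> ?F" if z: "z \<in> ?P \<rightarrow>\<^sub>E orb \<xi>0" "power_map (Suc k) to_Y z \<in> power_map (Suc k) to_Y ` ?F" for z
    proof -
      obtain y where y: "y \<in> ?C" "power_map (Suc k) to_Y z = power_map (Suc k) to_Y (restrict y ?P)"
        using z(2) by (auto simp: face_fibre_def)
      note yc = face_orbit_closure_cube[OF \<xi>0_W gO y(1)]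
      define z' where "z' = (\<lambda>e\<in>?V. if e = ?o then g else z e)"
      have z'V: "z' \<in> ?V \<rightarrow>\<^sub>E orb \<xi>0"
        using gO z(1) by (auto simp: z'_def punctured_vertices_def PiE_iff)
      have "cube \<xi>0 z'"
      proof (rule cube_saturated[OF yc(2)])
        fix e assume e: "e \<in> ?V"
        show "\<exists>q\<in>E. z' e = q \<xi>0" using z'V e by (auto simp: PiE_iff orb_def)
        show "z' e \<circ> retag False = y e \<circ> retag False"
        proof (cases "e = ?o")
          case True
          then show ?thesis using yc(3) e by (simp add: z'_def)
        next
          case False
          then have "e \<in> ?P" using e by (simp add: punctured_vertices_def)
          then have "to_Y (z e) = to_Y (y e)"
            using fun_cong[OF y(2), of e] by (simp add: power_map_def)
          then show ?thesis using e False by (simp add: z'_def to_Y_def)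
        qed
      qed
      then have "z' \<in> ?C" using X0(3)[OF g z'V] zero_vertex_in[of "Suc k"] by (simp add: z'_def)
      moreover have "restrict z' ?P = z"
      proof
        fix e show "restrict z' ?P e = z e"
          using z(1) by (auto simp: z'_def punctured_vertices_def PiE_iff extensional_def restrict_def)
      qed
      ultimately show ?thesis unfolding face_fibre_def by (intro image_eqI[of _ _ z']) simp_all
    qed
    show ?thesis unfolding saturated_def using sub sat by auto
  qed
  then show ?thesis
    unfolding cubic_characteristic_factor_def using factor_to_Y X0(1,2) by (auto)
qed

end

text \<open>Total boundedness provides both the dense sequence and the bound.\<close>

lemma coded_system_exists:
  assumes "minimal_tds X T"
  obtains a B where "coded_system X T a B"
proof -
  have c: "compact_space (mtopology_of X)" and ne: "mspace X \<noteq> {}"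
    using assms by (auto simp: minimal_tds_def tds_def)
  interpret M: Metric_space "mspace X" "mdist X" by (rule Metric_space_mspace_mdist)
  have tb: "M.mtotally_bounded (mspace X)"
    using c M.compact_space_eq_mcomplete_mtotally_bounded by (simp add: mtopology_of_def)
  obtain B where B: "\<And>x y. x \<in> mspace X \<Longrightarrow> y \<in> mspace X \<Longrightarrow> mdist X x y \<le> B"
    using M.mtotally_bounded_imp_mbounded[OF tb] unfolding M.mbounded_alt by blast
  have "\<exists>K. finite K \<and> K \<subseteq> mspace X \<and> mspace X \<subseteq> (\<Union>x\<in>K. M.mball x (inverse (real (Suc n))))" for n
    using tb unfolding M.mtotally_bounded_def by simp
  then obtain K where K: "\<And>n. finite (K n)" "\<And>n. K n \<subseteq> mspace X"
    "\<And>n. mspace X \<subseteq> (\<Union>x\<in>K n. M.mball x (inverse (real (Suc n))))" by metis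
  let ?D = "\<Union>n. K n"
  have "K 0 \<noteq> {}" using K(3)[of 0] ne by auto
  then have D: "?D \<noteq> {}" "?D \<subseteq> mspace X" using K(2) by blast+
  have cD: "countable ?D" by (rule countable_UN) (simp_all add: countable_finite K(1))
  have ran: "range (from_nat_into ?D) = ?D" using D(1) cD by simp
  have "coded_system X T (from_nat_into ?D) B"
  proof
    show "from_nat_into ?D i \<in> mspace X" for i using D(2) from_nat_into[OF D(1)] by blast
    show "\<exists>i. mdist X (from_nat_into ?D i) x < \<delta>" if x: "x \<in> mspace X" and \<delta>: "\<delta> > 0" for x \<delta>
    proof -
      obtain n where n: "inverse (real (Suc n)) < \<delta>" using reals_Archimedean[OF \<delta>] by blast
      obtain y where "y \<in> K n" "mdist X y x < inverse (real (Suc n))" using K(3)[of n] x by auto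
      then have "y \<in> ?D" "mdist X y x < \<delta>" using n by auto
      then show ?thesis using ran by (metis imageE)
    qed
  qed (use assms B in auto)
  then show ?thesis using that by blast
qed

theorem theorem1p7:
  fixes X :: "'a metric" and T :: "'a \<Rightarrow> 'a" and d :: nat
  assumes "minimal_tds X T" and "d \<ge> 1"
  shows "\<exists>(X' :: hc metric) (TX' :: hc \<Rightarrow> hc) (Y' :: hc metric) (TY' :: hc \<Rightarrow> hc)
           (\<theta>' :: hc \<Rightarrow> 'a) (\<pi>' :: hc \<Rightarrow> hc) (\<theta> :: hc \<Rightarrow> 'a set).
      minimal_tds X' TX' \<and> minimal_tds Y' TY' \<and>
      factor_map (mtopology_of X') TX' (mtopology_of X) T \<theta>' \<and>
      factor_map (mtopology_of X') TX' (mtopology_of Y') TY' \<pi>' \<and>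
      factor_map (mtopology_of Y') TY' (pronil_space (d - 1) X T) (pronil_action T) \<theta> \<and>
      (\<forall>x\<in>mspace X'. pronil_map (d - 1) X T (\<theta>' x) = \<theta> (\<pi>' x)) \<and>
      proximal_extension Y' TY' (pronil_space (d - 1) X T) (pronil_action T) \<theta> \<and>
      proximal_extension X' TX' (mtopology_of X) T \<theta>' \<and>
      cubic_characteristic_factor d X' TX' Y' TY' \<pi>'"
proof -
  define k where "k = d - 1"
  have d: "d = Suc k" using assms(2) by (simp add: k_def)
  obtain a B where ab: "coded_system X T a B" using coded_system_exists[OF assms(1)] by metis
  interpret coded_system X T a B k by (rule ab)
  obtain u where u: "u \<in> E" "u \<circ> u = u" "\<And>v. \<lbrakk>v \<in> E; v \<circ> v = v; v \<circ> u = v\<rbrakk> \<Longrightarrow> u \<circ> v = u"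
    using E.minimal_idempotent_exists by metis
  define x0 where "x0 = u (\<iota> (a 0))"
  have "x0 \<in> X_coded"
    unfolding x0_def
    by (rule E_preserves[OF u(1) compact_imp_closed[OF compact_X_coded]])
      (use \<tau>_\<iota>[OF a_in] ziter_in[OF T_bij a_in] in simp)
  moreover have "u x0 = x0" unfolding x0_def using u(2) by (metis comp_apply)
  ultimately interpret coded_minimal_system X T a B k u x0
    by unfold_locales (use u in auto)
  show ?thesis
    unfolding d diff_Suc_1
    using minimal_orb[OF \<xi>0_W u_\<xi>0] minimal_orb[OF \<psi>0_W u_\<psi>0] factor_to_X factor_to_Y factor_to_Z
      diagram proximal_to_Z proximal_to_X characteristic_to_Y
    by (intro exI[of _ "hc_subspace (orb \<xi>0)"] exI[of _ "\<tau> 1"] exI[of _ "hc_subspace (orb \<psi>0)"] exI[of _ to_X]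
      exI[of _ to_Y] exI[of _ to_Z] conjI) (simp_all del: hc_subspace_simps(3))
qed

end
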